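(* (In $\mathsf{ZFC}^-$.) Let $\sim$ be a graph relation that is regular and has the set property. Then $\mathbf{V}_c^\sim$ (as the $\mathcal{L}_\in$-structure $(\mathbf{V}_c^\sim,\leftarrow)$) is a class model of $\mathsf{ZFC}^-$. If in addition $\sim$ is absolute for $\mathbf{V}_c^\sim$, then $\mathbf{V}_c^\sim$ is a class model of $\mathsf{ZFC}^-+\mathsf{AFA}^\sim$.
   Context: $\mathsf{ZFC}^-$ denotes $\mathsf{ZFC}$ without the axiom of foundation; $\mathcal{L}_\in$ is the language of set theory. A graph is an accessible pointed directed graph: a set of vertices (also denoted $G$) with a binary edge relation $\to$ and a distinguished vertex $p_G$ (the point), such that every vertex is reachable from $p_G$ by a finite directed path. $C_G(a)=\{b\in G: a\to b\}$ is the set of children of $a$. For $a\in G$, $G[a]$ is the subgraph induced by the vertices reachable from $a$ (including $a$), with point $a$. $\cong$ is isomorphism of pointed directed graphs. $G\approx G'$ means $\{G[a]: a\in C_G(p_G)\}=\{G'[a']: a'\in C_{G'}(p_{G'})\}$. A graph relation $\sim$ is a binary relation between graphs given by an $\mathcal{L}_\in$-formula. It is regular if it is an equivalence relation, $G\approx G'$ implies $G\sim G'$, and $G\cong G'$ implies $G\sim G'$. $G$ is $\sim$-extensional if for all $a_1,a_2\in G$, $G[a_1]\sim G[a_2]$ implies $a_1=a_2$. $\sim$ has the set property if for every set $X$ of mutually non-isomorphic $\sim$-extensional graphs there is a $\sim$-extensional graph $G$ with $\{G[a]: a\in C_G(p_G)\}=X$ up to isomorphism (every $G[a]$ with $a\in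 C_G(p_G)$ is isomorphic to a member of $X$ and vice versa). A graph is an exact picture if it is isomorphic to $(\mathrm{trcl}(\{X\}),\ni,X)$ for some set $X$ (children of a vertex $x$ are the elements of $x$). $\mathsf{AFA}^\sim$ is the statement: a graph is an exact picture if and only if it is $\sim$-extensional. $\mathbf{V}_0^\sim$ is the class of $\sim$-extensional graphs. $\mathbf{V}_c^\sim$ is the class of sets of minimal-rank representatives of $\mathbf{V}_0^\sim$ modulo $\sim$: for $G\in\mathbf{V}_0^\sim$, $\pi(G)$ is the set of members of minimal rank of $\{G'\in\mathbf{V}_0^\sim: G'\sim G\}$ (this class has well-founded members by choice), and $\mathbf{V}_c^\sim=\{\pi(G): G\in\mathbf{V}_0^\sim\}$. (Equivalently, one may take the quotient of $\mathbf{V}_0^\sim$ modulo $\cong$.) It carries the natural graph structure $x\to y$ iff $x=\pi(G)$ and $y=\pi(G[a])$ for some $G\in\mathbf{V}_0^\sim$ and $a\in C_G(p_G)$; the symbol $\in$ is interpreted by $\leftarrow$, i.e. $y\in_{\mathbf{V}_c^\sim}x$ iff $x\to y$. For a class model $\mathbf{M}$ and $x\in\mathbf{M}$ with $\mathbf{M}\vDash$ "$x$ is a graph", say $x=(V,E,p)^{\mathbf{M}}$, put $ext_{\mathbf{M}}(x)=(\{a: a\in_{\mathbf{M}}V\},\{(a,b): (a,b)^{\mathbf{M}}\in_{\mathbf{M}}E\},p)$. $\sim$ is absolute for $\mathbf{M}$ if for all such $x,y\in\mathbf{M}$, $(x\sim y)^{\mathbf{M}}\Leftrightarrow ext_{\mathbf{M}}(x)\sim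 ext_{\mathbf{M}}(y)$. *)

theory Defs
  imports Main
begin

text \<open>
  The ambient theory is ZFC without foundation.  Working in that theory is rendered semantically:
  statements are made about an arbitrary structure for the language of set theory that satisfies
  the axioms.  By the completeness theorem this is the same as provability.  All set-theoretic
  notions below (finite path, isomorphism, rank, ...) are the internal notions of the structure:
  they quantify only over elements of its universe.  The same definitions are thus used both for
  the ambient universe and for class models inside it.
\<close>

section \<open>The language of set theory\<close>

datatype fm = FMem nat nat | FEq nat nat | FNeg fm | FConj fm fm | FAll nat fm

primrec fv :: "fm \<Rightarrow> nat set" where
  "fv (FMem i j) = {i, j}"
| "fv (FEq i j) = {i, j}"
| "fv (FNeg \<phi>) = fv \<phi>"
| "fv (FConj \<phi> \<psi>) = fv \<phi> \<union> fv \<psi>"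
| "fv (FAll i \<phi>) = fv \<phi> - {i}"

record 'a estruct =
  univ :: "'a set"
  mem :: "'a \<Rightarrow> 'a \<Rightarrow> bool"  \<comment> \<open>\<open>mem S y x\<close> means that \<open>y\<close> is an element of \<open>x\<close>\<close>

primrec sat :: "'a estruct \<Rightarrow> (nat \<Rightarrow> 'a) \<Rightarrow> fm \<Rightarrow> bool" where
  "sat S e (FMem i j) \<longleftrightarrow> mem S (e i) (e j)"
| "sat S e (FEq i j) \<longleftrightarrow> e i = e j"
| "sat S e (FNeg \<phi>) \<longleftrightarrow> \<not> sat S e \<phi>"
| "sat S e (FConj \<phi> \<psi>) \<longleftrightarrow> sat S e \<phi> \<and> sat S e \<psi>"
| "sat S e (FAll i \<phi>) \<longleftrightarrow> (\<forall>a\<in>univ S. sat S (e(i := a)) \<phi>)"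

definition elts :: "'a estruct \<Rightarrow> 'a \<Rightarrow> 'a set" where
  "elts S x = {y \<in> univ S. mem S y x}"


section \<open>ZFC without foundation\<close>

definition is_inductive :: "'a estruct \<Rightarrow> 'a \<Rightarrow> bool" where
  "is_inductive S I \<longleftrightarrow>
     (\<exists>z\<in>elts S I. elts S z = {}) \<and>
     (\<forall>n\<in>elts S I. \<exists>m\<in>elts S I. elts S m = insert n (elts S n))"

definition extensionality_ax :: "'a estruct \<Rightarrow> bool" where
  "extensionality_ax S \<longleftrightarrow> (\<forall>x\<in>univ S. \<forall>y\<in>univ S. elts S x = elts S y \<longrightarrow> x = y)"

definition pairing_ax :: "'a estruct \<Rightarrow> bool" where
  "pairing_ax S \<longleftrightarrow> (\<forall>x\<in>univ S. \<forall>y\<in>univ S. \<exists>z\<in>univ S. elts S z = {x, y})"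

definition union_ax :: "'a estruct \<Rightarrow> bool" where
  "union_ax S \<longleftrightarrow> (\<forall>x\<in>univ S. \<exists>y\<in>univ S. elts S y = (\<Union>z\<in>elts S x. elts S z))"

definition powerset_ax :: "'a estruct \<Rightarrow> bool" where
  "powerset_ax S \<longleftrightarrow>
     (\<forall>x\<in>univ S. \<exists>y\<in>univ S. elts S y = {z \<in> univ S. elts S z \<subseteq> elts S x})"

definition infinity_ax :: "'a estruct \<Rightarrow> bool" where
  "infinity_ax S \<longleftrightarrow> (\<exists>I\<in>univ S. is_inductive S I)"

text \<open>In the two schemes the assignment \<open>e\<close> supplies the parameters of the formula.\<close>

definition separation_ax :: "'a estruct \<Rightarrow> bool" where
  "separation_ax S \<longleftrightarrow>
     (\<forall>\<phi> e. range e \<subseteq> univ S \<longrightarrow>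
       (\<forall>x\<in>univ S. \<exists>y\<in>univ S. elts S y = {z \<in> elts S x. sat S (e(0 := z)) \<phi>}))"

definition replacement_ax :: "'a estruct \<Rightarrow> bool" where
  "replacement_ax S \<longleftrightarrow>
     (\<forall>\<phi> e. range e \<subseteq> univ S \<longrightarrow>
       (\<forall>A\<in>univ S.
         (\<forall>x\<in>elts S A. \<forall>y\<in>univ S. \<forall>y'\<in>univ S.
            sat S (e(0 := x, 1 := y)) \<phi> \<and> sat S (e(0 := x, 1 := y')) \<phi> \<longrightarrow> y = y') \<longrightarrow>
         (\<exists>B\<in>univ S.
            elts S B = {y \<in> univ S. \<exists>x\<in>elts S A. sat S (e(0 := x, 1 := y)) \<phi>})))"

definition choice_ax :: "'a estruct \<Rightarrow> bool" where
  "choice_ax S \<longleftrightarrow>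
     (\<forall>A\<in>univ S.
        (\<forall>x\<in>elts S A. elts S x \<noteq> {}) \<and>
        (\<forall>x\<in>elts S A. \<forall>y\<in>elts S A. x \<noteq> y \<longrightarrow> elts S x \<inter> elts S y = {}) \<longrightarrow>
        (\<exists>C\<in>univ S. \<forall>x\<in>elts S A. \<exists>z. elts S C \<inter> elts S x = {z}))"

definition ZFC_minus :: "'a estruct \<Rightarrow> bool" where
  "ZFC_minus S \<longleftrightarrow>
     extensionality_ax S \<and> pairing_ax S \<and> union_ax S \<and> powerset_ax S \<and> infinity_ax S \<and>
     separation_ax S \<and> replacement_ax S \<and> choice_ax S"


section \<open>Basic set theory inside a structure\<close>

text \<open>
  \<open>setof S A\<close> is the element of the universe whose elements are exactly those of \<open>A\<close>.  It is
  meaningful only if \<open>A\<close> is (the extension of) a set of the structure; in models of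
  ZFC without foundation this is so wherever it is used below.
\<close>

definition setof :: "'a estruct \<Rightarrow> 'a set \<Rightarrow> 'a" where
  "setof S A = (THE x. x \<in> univ S \<and> elts S x = A)"

definition pair :: "'a estruct \<Rightarrow> 'a \<Rightarrow> 'a \<Rightarrow> 'a" where
  "pair S a b = setof S {setof S {a}, setof S {a, b}}"

definition triple :: "'a estruct \<Rightarrow> 'a \<Rightarrow> 'a \<Rightarrow> 'a \<Rightarrow> 'a" where
  "triple S a b c = pair S a (pair S b c)"

text \<open>The restriction of \<open>h\<close> to \<open>A\<close> is an element of the structure.\<close>

definition internal_fun :: "'a estruct \<Rightarrow> 'a set \<Rightarrow> ('a \<Rightarrow> 'a) \<Rightarrow> bool" where
  "internal_fun S A h \<longleftrightarrow>
     h ` A \<subseteq> univ S \<and> (\<exists>f\<in>univ S. elts S f = (\<lambda>a. pair S a (h a)) ` A)"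

definition zero :: "'a estruct \<Rightarrow> 'a" where
  "zero S = setof S {}"

definition succ :: "'a estruct \<Rightarrow> 'a \<Rightarrow> 'a" where
  "succ S n = setof S (insert n (elts S n))"

definition omega :: "'a estruct \<Rightarrow> 'a set" where
  "omega S = {n \<in> univ S. \<forall>I\<in>univ S. is_inductive S I \<longrightarrow> n \<in> elts S I}"

definition transitive_set :: "'a estruct \<Rightarrow> 'a \<Rightarrow> bool" where
  "transitive_set S t \<longleftrightarrow> (\<forall>y\<in>elts S t. elts S y \<subseteq> elts S t)"

definition trcl :: "'a estruct \<Rightarrow> 'a \<Rightarrow> 'a" where
  "trcl S x = setof S {y \<in> univ S.
     \<forall>t\<in>univ S. transitive_set S t \<and> elts S x \<subseteq> elts S t \<longrightarrow> y \<in> elts S t}"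

text \<open>
  In the absence of foundation, well-foundedness of membership on an ordinal has to be required.
\<close>

definition ordinal :: "'a estruct \<Rightarrow> 'a \<Rightarrow> bool" where
  "ordinal S \<alpha> \<longleftrightarrow>
     \<alpha> \<in> univ S \<and> transitive_set S \<alpha> \<and>
     (\<forall>x\<in>elts S \<alpha>. \<forall>y\<in>elts S \<alpha>. x = y \<or> x \<in> elts S y \<or> y \<in> elts S x) \<and>
     (\<forall>b\<in>univ S. elts S b \<subseteq> elts S \<alpha> \<and> elts S b \<noteq> {} \<longrightarrow>
        (\<exists>m\<in>elts S b. elts S b \<inter> elts S m = {}))"

text \<open>
  \<open>has_rank S x \<alpha>\<close>: the set \<open>x\<close> is well-founded and \<open>\<alpha>\<close> is its rank, where the rank of \<open>y\<close> is
  the supremum of the successors of the ranks of the elements of \<open>y\<close>.  Since the values of \<open>h\<close>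
  are ordinals, ill-founded sets have no rank.
\<close>

definition has_rank :: "'a estruct \<Rightarrow> 'a \<Rightarrow> 'a \<Rightarrow> bool" where
  "has_rank S x \<alpha> \<longleftrightarrow>
     (\<exists>t\<in>univ S. \<exists>h. transitive_set S t \<and> x \<in> elts S t \<and> internal_fun S (elts S t) h \<and>
        (\<forall>y\<in>elts S t. ordinal S (h y) \<and>
           elts S (h y) = (\<Union>z\<in>elts S y. insert (h z) (elts S (h z)))) \<and>
        h x = \<alpha>)"


section \<open>Graphs\<close>

text \<open>
  A graph is an element \<open>(V, E, p)\<close> of the structure.  \<open>decode\<close> turns it into its external
  counterpart, and \<open>encode\<close> goes back.
\<close>

type_synonym 'a pgraph = "'a set \<times> ('a \<times> 'a) set \<times> 'a"

definition decode :: "'a estruct \<Rightarrow> 'a \<Rightarrow> 'a pgraph" where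
  "decode S x =
     (let (V, E, p) = (THE (V, E, p). V \<in> univ S \<and> E \<in> univ S \<and> p \<in> univ S \<and> x = triple S V E p)
      in (elts S V, {(a, b). a \<in> univ S \<and> b \<in> univ S \<and> pair S a b \<in> elts S E}, p))"

definition encode :: "'a estruct \<Rightarrow> 'a pgraph \<Rightarrow> 'a" where
  "encode S = (\<lambda>(V, R, p). triple S (setof S V) (setof S ((\<lambda>(a, b). pair S a b) ` R)) p)"

definition verts :: "'a estruct \<Rightarrow> 'a \<Rightarrow> 'a set" where
  "verts S G = fst (decode S G)"

definition edges :: "'a estruct \<Rightarrow> 'a \<Rightarrow> ('a \<times> 'a) set" where
  "edges S G = fst (snd (decode S G))"

definition pt :: "'a estruct \<Rightarrow> 'a \<Rightarrow> 'a" where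
  "pt S G = snd (snd (decode S G))"

text \<open>There is a finite path \<open>h 0 \<rightarrow> h 1 \<rightarrow> \<dots> \<rightarrow> h n\<close> from \<open>a\<close> to \<open>b\<close>, finite in the sense of \<open>S\<close>.\<close>

definition reach :: "'a estruct \<Rightarrow> 'a \<Rightarrow> 'a \<Rightarrow> 'a \<Rightarrow> bool" where
  "reach S G a b \<longleftrightarrow>
     (\<exists>n\<in>omega S. \<exists>h. internal_fun S (elts S (succ S n)) h \<and>
        h (zero S) = a \<and> h n = b \<and> (\<forall>k\<in>elts S n. (h k, h (succ S k)) \<in> edges S G))"

definition is_graph :: "'a estruct \<Rightarrow> 'a \<Rightarrow> bool" where
  "is_graph S G \<longleftrightarrow> G \<in> univ S \<and>
     (\<exists>V\<in>univ S. \<exists>E\<in>univ S. \<exists>p\<in>univ S. G = triple S V E p \<and>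
        elts S E \<subseteq> {pair S a b | a b. a \<in> elts S V \<and> b \<in> elts S V} \<and> p \<in> elts S V) \<and>
     (\<forall>a\<in>verts S G. reach S G (pt S G) a)"

definition children :: "'a estruct \<Rightarrow> 'a \<Rightarrow> 'a \<Rightarrow> 'a set" where
  "children S G a = {b. (a, b) \<in> edges S G}"

definition subgraph_at :: "'a estruct \<Rightarrow> 'a \<Rightarrow> 'a \<Rightarrow> 'a" where
  "subgraph_at S G a =
     (let W = {b \<in> verts S G. reach S G a b} in encode S (W, edges S G \<inter> W \<times> W, a))"

definition graph_iso :: "'a estruct \<Rightarrow> 'a \<Rightarrow> 'a \<Rightarrow> bool" where
  "graph_iso S G H \<longleftrightarrow>
     (\<exists>h. internal_fun S (verts S G) h \<and> bij_betw h (verts S G) (verts S H) \<and>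
        h (pt S G) = pt S H \<and>
        (\<forall>a\<in>verts S G. \<forall>b\<in>verts S G. (a, b) \<in> edges S G \<longleftrightarrow> (h a, h b) \<in> edges S H))"

definition same_child_graphs :: "'a estruct \<Rightarrow> 'a \<Rightarrow> 'a \<Rightarrow> bool" where
  "same_child_graphs S G H \<longleftrightarrow>
     subgraph_at S G ` children S G (pt S G) = subgraph_at S H ` children S H (pt S H)"


section \<open>Graph relations\<close>

text \<open>
  A graph relation is given by a formula \<open>\<phi>\<close> without parameters, in the free variables 0 and 1;
  \<open>grel S \<phi>\<close> is its interpretation in \<open>S\<close>.
\<close>

definition grel :: "'a estruct \<Rightarrow> fm \<Rightarrow> 'a \<Rightarrow> 'a \<Rightarrow> bool" where
  "grel S \<phi> G H \<longleftrightarrow> sat S ((\<lambda>_. G)(1 := H)) \<phi>"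

definition regular :: "'a estruct \<Rightarrow> fm \<Rightarrow> bool" where
  "regular S \<phi> \<longleftrightarrow>
     equiv {G. is_graph S G} {(G, H). is_graph S G \<and> is_graph S H \<and> grel S \<phi> G H} \<and>
     (\<forall>G H. is_graph S G \<and> is_graph S H \<and> same_child_graphs S G H \<longrightarrow> grel S \<phi> G H) \<and>
     (\<forall>G H. is_graph S G \<and> is_graph S H \<and> graph_iso S G H \<longrightarrow> grel S \<phi> G H)"

definition rel_extensional :: "'a estruct \<Rightarrow> fm \<Rightarrow> 'a \<Rightarrow> bool" where
  "rel_extensional S \<phi> G \<longleftrightarrow>
     (\<forall>a\<in>verts S G. \<forall>b\<in>verts S G. grel S \<phi> (subgraph_at S G a) (subgraph_at S G b) \<longrightarrow> a = b)"

definition V0 :: "'a estruct \<Rightarrow> fm \<Rightarrow> 'a set" where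
  "V0 S \<phi> = {G. is_graph S G \<and> rel_extensional S \<phi> G}"

definition set_property :: "'a estruct \<Rightarrow> fm \<Rightarrow> bool" where
  "set_property S \<phi> \<longleftrightarrow>
     (\<forall>X\<in>univ S.
        elts S X \<subseteq> V0 S \<phi> \<and> (\<forall>H\<in>elts S X. \<forall>K\<in>elts S X. graph_iso S H K \<longrightarrow> H = K) \<longrightarrow>
        (\<exists>G\<in>V0 S \<phi>.
           (\<forall>a\<in>children S G (pt S G). \<exists>H\<in>elts S X. graph_iso S (subgraph_at S G a) H) \<and>
           (\<forall>H\<in>elts S X. \<exists>a\<in>children S G (pt S G). graph_iso S (subgraph_at S G a) H)))"

definition exact_picture :: "'a estruct \<Rightarrow> 'a \<Rightarrow> bool" where
  "exact_picture S G \<longleftrightarrow>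
     (\<exists>X\<in>univ S. let T = elts S (trcl S (setof S {X})) in
        graph_iso S G (encode S (T, {(x, y). x \<in> T \<and> y \<in> T \<and> y \<in> elts S x}, X)))"

definition AFA :: "'a estruct \<Rightarrow> fm \<Rightarrow> bool" where
  "AFA S \<phi> \<longleftrightarrow> (\<forall>G. is_graph S G \<longrightarrow> (exact_picture S G \<longleftrightarrow> rel_extensional S \<phi> G))"


section \<open>The class model\<close>

definition min_rank_reps :: "'a estruct \<Rightarrow> fm \<Rightarrow> 'a \<Rightarrow> 'a" where
  "min_rank_reps S \<phi> G =
     (let C = {H \<in> V0 S \<phi>. grel S \<phi> H G} in
      setof S {H \<in> C. \<exists>\<alpha>. has_rank S H \<alpha> \<and>
                 (\<forall>K\<in>C. \<forall>\<beta>. has_rank S K \<beta> \<longrightarrow> \<beta> \<notin> elts S \<alpha>)})"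

definition Vc :: "'a estruct \<Rightarrow> fm \<Rightarrow> 'a estruct" where
  "Vc S \<phi> =
     \<lparr>univ = min_rank_reps S \<phi> ` V0 S \<phi>,
      mem = (\<lambda>y x. \<exists>G\<in>V0 S \<phi>. \<exists>a\<in>children S G (pt S G).
               x = min_rank_reps S \<phi> G \<and> y = min_rank_reps S \<phi> (subgraph_at S G a))\<rparr>"

text \<open>
  For a class model \<open>N\<close> inside \<open>S\<close> and an internal graph \<open>x\<close> of \<open>N\<close>, \<open>decode N x\<close> is the external
  graph of \<open>x\<close> and \<open>encode S (decode N x)\<close> is that graph as an element of \<open>S\<close>.
\<close>

definition absolute_for :: "'a estruct \<Rightarrow> fm \<Rightarrow> 'a estruct \<Rightarrow> bool" where
  "absolute_for S \<phi> N \<longleftrightarrow>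
     (\<forall>x y. is_graph N x \<and> is_graph N y \<longrightarrow>
        (grel N \<phi> x y \<longleftrightarrow> grel S \<phi> (encode S (decode N x)) (encode S (decode N y))))"

end

(*
  Let N be the class model. The class graph pi(G) -> pi(G[a]) is extensional, and every set of its
  points is the set of children of exactly one point:

  - Related extensional graphs G, H are isomorphic: otherwise the set property yields an extensional
    K with G and H among its child graphs, and extensionality of K identifies the two children.
    Hence the children of pi(G) do not depend on the representative.
  - If pi(G) and pi(H) have the same children, the same K shows that G and H are isomorphic to graphs
    with literally the same child graphs, so G ~ H by regularity.
  - The set property together with choice of representatives realises every set of points.

  Thus the sets of N are exactly the sets of the universe that are included in N, and each axiom of
  N follows from the corresponding axiom of the universe.

  Under this identification graphs, reachability and isomorphisms mean the same in N and in the
  universe. By absoluteness a graph of N is therefore extensional in N iff it lies in V0. The exact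
  picture of pi(G) in N is isomorphic to G via a |-> pi(G[a]), because G is extensional. So the exact
  pictures of N are, up to isomorphism, precisely the members of V0.

  That pi(G) is a nonempty set needs every graph to be isomorphic to a well-founded one, which holds
  because choice injects every set into the ordinals.
*)
theory Submission
  imports Defs
begin

section \<open>Definable predicates, functions and classes\<close>

text \<open>The obstacle is definability. Separation and replacement speak of formulas under an
  assignment, while the development manipulates predicates, functions and classes of the metalogic.
  So \<open>dfn\<close>, \<open>df\<close> and \<open>dc\<close>, definability with parameters of
  predicates, total functions and classes, are carried through every construction; their closure
  rules let formulas largely disappear after the comprehension lemmas. Notions given by
  \<open>THE\<close> or by quantifying over functions of the metalogic get a definable twin and an
  agreement lemma.

  The structure may be nonstandard: its omega may contain infinite elements, and its ordinals need
  not be well-founded from outside. Hence induction, recursion and minimality are available only for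
  definable predicates, and reachability is rephrased as membership in every closed set. Absence of
  foundation rules out induction on membership, so arguments about rank descend along ordinals.

  \<open>isset S A\<close> links the two levels: the external set \<open>A\<close> is the extension
  of an element of the universe.\<close>

definition isset :: "'a estruct \<Rightarrow> 'a set \<Rightarrow> bool" where
  "isset S A \<longleftrightarrow> (\<exists>x\<in>univ S. elts S x = A)"

definition env :: "'a estruct \<Rightarrow> (nat \<Rightarrow> 'a) \<Rightarrow> bool" where
  "env S e \<longleftrightarrow> (\<forall>n. e n \<in> univ S)"

text \<open>Interleaving leaves infinitely many slots for variables and for parameters, so neither
  list needs a bound, and two parameter lists merge into one by a second \<open>mix\<close>.\<close>

definition mix :: "(nat \<Rightarrow> 'a) \<Rightarrow> (nat \<Rightarrow> 'a) \<Rightarrow> nat \<Rightarrow> 'a" where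
  "mix e c n = (if even n then e (n div 2) else c (n div 2))"

section \<open>Coincidence and renaming of variables in formulas\<close>

lemma finite_fv: "finite (fv \<psi>)"
  by (induction \<psi>) auto

lemma sat_cong:
  assumes "\<And>n. n \<in> fv \<psi> \<Longrightarrow> e n = e' n"
  shows "sat S e \<psi> \<longleftrightarrow> sat S e' \<psi>"
  using assms
proof (induction \<psi> arbitrary: e e')
  case (FAll i \<psi>)
  have "sat S (e(i := a)) \<psi> \<longleftrightarrow> sat S (e'(i := a)) \<psi>" for a
    using FAll.prems by (intro FAll.IH) auto
  then show ?case by simp
next
  case (FNeg \<psi>) show ?case using FNeg.IH[of e e'] FNeg.prems by simp
next
  case (FConj \<psi>1 \<psi>2) show ?case using FConj.IH(1)[of e e'] FConj.IH(2)[of e e'] FConj.prems by simp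
qed simp_all

text \<open>The renaming \<open>f\<close> may identify variables, so a bound variable has to be
  moved to an index that no renamed free variable uses. The formula therefore depends on
  \<open>f\<close> in a non-uniform way and is only asserted to exist.\<close>

lemma sat_rename: "\<exists>\<psi>'. \<forall>e. sat S e \<psi>' \<longleftrightarrow> sat S (\<lambda>n. e (f n)) \<psi>"
proof (induction \<psi> arbitrary: f)
  case (FMem i j) show ?case by (rule exI[of _ "FMem (f i) (f j)"]) simp
next
  case (FEq i j) show ?case by (rule exI[of _ "FEq (f i) (f j)"]) simp
next
  case (FNeg \<psi>)
  then obtain \<psi>' where "\<forall>e. sat S e \<psi>' \<longleftrightarrow> sat S (\<lambda>n. e (f n)) \<psi>" by blast
  then show ?case by (intro exI[of _ "FNeg \<psi>'"]) simp
next
  case (FConj \<psi>1 \<psi>2)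
  obtain a where "\<forall>e. sat S e a \<longleftrightarrow> sat S (\<lambda>n. e (f n)) \<psi>1" using FConj by blast
  moreover obtain b where "\<forall>e. sat S e b \<longleftrightarrow> sat S (\<lambda>n. e (f n)) \<psi>2" using FConj by blast
  ultimately show ?case by (intro exI[of _ "FConj a b"]) simp
next
  case (FAll i \<psi>)
  obtain k where k: "k \<notin> f ` fv \<psi>"
    using ex_new_if_finite[of "f ` fv \<psi>"] finite_fv by auto
  obtain \<psi>' where \<psi>': "\<forall>e. sat S e \<psi>' \<longleftrightarrow> sat S (\<lambda>n. e ((f(i := k)) n)) \<psi>" using FAll by blast
  have "sat S (e(k := a)) \<psi>' \<longleftrightarrow> sat S ((\<lambda>n. e (f n))(i := a)) \<psi>" for e a
    unfolding \<psi>'[rule_format] by (rule sat_cong) (use k in auto)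
  then show ?case by (intro exI[of _ "FAll k \<psi>'"]) simp
qed

abbreviation (input) shift :: "(nat \<Rightarrow> 'a) \<Rightarrow> nat \<Rightarrow> 'a" where
  "shift e \<equiv> \<lambda>n. e (Suc n)"

locale zfc =
  fixes S :: "'a estruct"
  assumes zfc: "ZFC_minus S"
begin

abbreviation U :: "'a set" where "U \<equiv> univ S"

text \<open>The parameters of the formula occupy the odd variables. Bound and result variables get number 0, as with de Bruijn indices.\<close>

definition dfn :: "((nat \<Rightarrow> 'a) \<Rightarrow> bool) \<Rightarrow> bool" where
  "dfn P \<longleftrightarrow> (\<exists>\<psi> c. env S c \<and> (\<forall>e. env S e \<longrightarrow> (P e \<longleftrightarrow> sat S (mix e c) \<psi>)))"

definition df :: "((nat \<Rightarrow> 'a) \<Rightarrow> 'a) \<Rightarrow> bool" where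
  "df t \<longleftrightarrow> (\<forall>e. env S e \<longrightarrow> t e \<in> U) \<and> dfn (\<lambda>e. e 0 = t (shift e))"

definition dc :: "((nat \<Rightarrow> 'a) \<Rightarrow> 'a set) \<Rightarrow> bool" where
  "dc A \<longleftrightarrow> (\<forall>e. env S e \<longrightarrow> A e \<subseteq> U) \<and> dfn (\<lambda>e. e 0 \<in> A (shift e))"

lemma U_nonempty: "\<exists>z. z \<in> U"
  using zfc by (auto simp: ZFC_minus_def infinity_ax_def)

lemma eltsU: "y \<in> elts S x \<Longrightarrow> y \<in> U"
  by (simp add: elts_def)

lemma elts_subset_U: "elts S x \<subseteq> U"
  by (auto simp: elts_def)

lemma isset_subset_U: "isset S A \<Longrightarrow> A \<subseteq> U"
  by (auto simp: isset_def elts_def)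

lemma elts_eqD: "x \<in> U \<Longrightarrow> y \<in> U \<Longrightarrow> elts S x = elts S y \<Longrightarrow> x = y"
  using zfc by (auto simp: ZFC_minus_def extensionality_ax_def)

lemma setof_elts[simp]: "x \<in> U \<Longrightarrow> setof S (elts S x) = x"
  unfolding setof_def by (rule the_equality) (auto intro: elts_eqD)

lemma setof_U: "isset S A \<Longrightarrow> setof S A \<in> U"
  unfolding isset_def by auto

lemma elts_setof: "isset S A \<Longrightarrow> elts S (setof S A) = A"
  unfolding isset_def by auto

lemma setof_eqI: "x \<in> U \<Longrightarrow> elts S x = A \<Longrightarrow> setof S A = x"
  by auto

lemma setof_inject: "isset S A \<Longrightarrow> isset S B \<Longrightarrow> setof S A = setof S B \<Longrightarrow> A = B"
  using elts_setof by metis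

lemma isset_elts: "x \<in> U \<Longrightarrow> isset S (elts S x)"
  by (auto simp: isset_def)

lemma env_mix: "env S e \<Longrightarrow> env S c \<Longrightarrow> env S (mix e c)"
  by (auto simp: env_def mix_def)

lemma envD: "env S e \<Longrightarrow> e n \<in> U"
  by (simp add: env_def)

lemma env_Suc: "env S e \<Longrightarrow> env S (shift e)"
  by (simp add: env_def)

lemma env_case_nat: "env S e \<Longrightarrow> x \<in> U \<Longrightarrow> env S (case_nat x e)"
  by (simp add: env_def split: nat.split)

section \<open>Closure properties of definable predicates\<close>

lemma dfn_cong:
  assumes "\<And>e. env S e \<Longrightarrow> P e \<longleftrightarrow> Q e" "dfn Q"
  shows "dfn P"
  using assms unfolding dfn_def by metis

text \<open>Freezing of variables: those selected by \<open>D\<close> become parameters with values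
  \<open>d\<close>. The new parameter list is \<open>mix d c\<close>, so \<open>d k\<close> sits in
  parameter slot 2k and \<open>c k\<close> in slot 2k+1; the numbers in \<open>g\<close> are these
  slots.\<close>

lemma dfn_inst:
  assumes P: "dfn P" and d: "env S d"
  shows "dfn (\<lambda>e. P (\<lambda>n. if D n then d n else e (f n)))"
proof -
  obtain \<psi> c where c: "env S c" and \<psi>: "\<And>e. env S e \<Longrightarrow> P e \<longleftrightarrow> sat S (mix e c) \<psi>"
    using P unfolding dfn_def by blast
  define g where "g n = (if even n then if D (n div 2) then 2 * (2 * (n div 2)) + 1 else 2 * f (n div 2)
    else 2 * (2 * (n div 2) + 1) + 1)" for n
  obtain \<psi>' where \<psi>': "\<forall>e. sat S e \<psi>' \<longleftrightarrow> sat S (\<lambda>n. e (g n)) \<psi>" using sat_rename[where S=S] by meson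
  have "mix (\<lambda>n. if D n then d n else e (f n)) c = (\<lambda>n. mix e (mix d c) (g n))" for e
    by (rule ext) (simp add: mix_def g_def)
  moreover have "env S (\<lambda>n. if D n then d n else e (f n))" if "env S e" for e
    using d that by (auto simp: env_def)
  ultimately show ?thesis
    unfolding dfn_def using \<psi> \<psi>' env_mix[OF d c] by (intro exI[of _ \<psi>'] exI[of _ "mix d c"]) auto
qed

lemma dfn_ren: "dfn P \<Longrightarrow> dfn (\<lambda>e. P (\<lambda>n. e (f n)))"
  using dfn_inst[of P "\<lambda>_. SOME z. z \<in> U" "\<lambda>_. False" f] U_nonempty
  by (simp add: env_def some_in_eq ex_in_conv)

lemma dfn_sat: "dfn (\<lambda>e. sat S e \<psi>)"
proof -
  obtain \<psi>' where \<psi>': "\<forall>e. sat S e \<psi>' \<longleftrightarrow> sat S (\<lambda>n. e (2 * n)) \<psi>" using sat_rename[where S=S] by meson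
  obtain z where "z \<in> U" using U_nonempty by blast
  then show ?thesis unfolding dfn_def
    by (intro exI[of _ \<psi>'] exI[of _ "\<lambda>_. z"]) (simp add: \<psi>' env_def mix_def)
qed

named_theorems dfi
named_theorems dfc

lemma dfn_const[dfc]: "dfn (\<lambda>e. Q)"
proof (cases Q)
  case True then show ?thesis using dfn_sat[of "FEq 0 0"] by simp
next
  case False then show ?thesis using dfn_sat[of "FNeg (FEq 0 0)"] by simp
qed

lemma dfn_not[dfi]:
  assumes "dfn P" shows "dfn (\<lambda>e. \<not> P e)"
proof -
  obtain \<psi> c where "env S c" "\<And>e. env S e \<Longrightarrow> P e \<longleftrightarrow> sat S (mix e c) \<psi>"
    using assms unfolding dfn_def by blast
  then show ?thesis unfolding dfn_def by (intro exI[of _ "FNeg \<psi>"] exI[of _ c]) simp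
qed

text \<open>The two formulas come with unrelated parameters. Both lists are stored in
  \<open>mix c d\<close>, and each formula is renamed to read its own half.\<close>

lemma dfn_conj[dfi]:
  assumes "dfn P" "dfn Q" shows "dfn (\<lambda>e. P e \<and> Q e)"
proof -
  obtain \<psi> c where 1: "env S c" "\<And>e. env S e \<Longrightarrow> P e \<longleftrightarrow> sat S (mix e c) \<psi>"
    using assms unfolding dfn_def by blast
  obtain \<chi> d where 2: "env S d" "\<And>e. env S e \<Longrightarrow> Q e \<longleftrightarrow> sat S (mix e d) \<chi>"
    using assms unfolding dfn_def by blast
  obtain \<psi>' where \<psi>': "\<forall>e. sat S e \<psi>' \<longleftrightarrow>
      sat S (\<lambda>n. e (if even n then n else 2 * (2 * (n div 2)) + 1)) \<psi>"
    using sat_rename[where S=S] by meson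
  obtain \<chi>' where \<chi>': "\<forall>e. sat S e \<chi>' \<longleftrightarrow>
      sat S (\<lambda>n. e (if even n then n else 2 * (2 * (n div 2) + 1) + 1)) \<chi>"
    using sat_rename[where S=S] by meson
  have "sat S (mix e (mix c d)) \<psi>' \<longleftrightarrow> sat S (mix e c) \<psi>" for e
    unfolding \<psi>'[rule_format]
    by (rule arg_cong[where f = "\<lambda>e. sat S e \<psi>"], rule ext, auto simp: mix_def elim!: oddE)
  moreover have "sat S (mix e (mix c d)) \<chi>' \<longleftrightarrow> sat S (mix e d) \<chi>" for e
    unfolding \<chi>'[rule_format]
    by (rule arg_cong[where f = "\<lambda>e. sat S e \<chi>"], rule ext, auto simp: mix_def elim!: oddE)
  ultimately show ?thesis unfolding dfn_def using 1 2 env_mix[OF 1(1) 2(1)]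
    by (intro exI[of _ "FConj \<psi>' \<chi>'"] exI[of _ "mix c d"]) simp
qed

lemma dfn_disj[dfi]: "dfn P \<Longrightarrow> dfn Q \<Longrightarrow> dfn (\<lambda>e. P e \<or> Q e)"
  using dfn_not[OF dfn_conj[OF dfn_not[of P] dfn_not[of Q]]] by simp

lemma dfn_imp[dfi]: "dfn P \<Longrightarrow> dfn Q \<Longrightarrow> dfn (\<lambda>e. P e \<longrightarrow> Q e)"
  unfolding imp_conv_disj by (intro dfn_disj dfn_not)

text \<open>The rule has de Bruijn form. The formula itself binds variable 1, that is, parameter
  slot 0, because every even variable may be in use by \<open>e\<close>.\<close>

lemma dfn_allU[dfi]:
  assumes "dfn (\<lambda>e. P (e 0) (shift e))"
  shows "dfn (\<lambda>e. \<forall>x\<in>U. P x e)"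
proof -
  obtain \<psi> c where c: "env S c"
    and \<psi>: "\<And>e. env S e \<Longrightarrow> P (e 0) (shift e) \<longleftrightarrow> sat S (mix e c) \<psi>"
    using assms unfolding dfn_def by blast
  have P: "P x e \<longleftrightarrow> sat S (mix (case_nat x e) c) \<psi>" if "x \<in> U" "env S e" for x e
    using \<psi>[OF env_case_nat[OF that(2,1)]] by simp
  \<comment> \<open>Variable 0 of the body is the bound one and is read from 1. Any other even index
    is a variable and moves down one place; an odd index is a parameter and moves up one place to
    free slot 0. The entry \<open>c 0\<close> put into that slot is a filler that the quantifier
    overwrites.\<close>
  define g where "g n = (if n = 0 then 1 else if even n then n - 2 else n + 2)" for n :: nat
  obtain \<psi>' where \<psi>': "\<forall>e. sat S e \<psi>' \<longleftrightarrow> sat S (\<lambda>n. e (g n)) \<psi>" using sat_rename[where S=S] by meson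
  have eq: "(\<lambda>n. ((mix e (case_nat (c 0) c))(1 := x)) (g n)) = mix (case_nat x e) c" for e x
  proof
    fix n
    show "((mix e (case_nat (c 0) c))(1 := x)) (g n) = mix (case_nat x e) c n"
    proof (cases "even n")
      case True
      then show ?thesis
        by (cases "n div 2") (auto simp: g_def mix_def elim!: evenE)
    next
      case False
      then show ?thesis by (auto simp: g_def mix_def)
    qed
  qed
  have "sat S (mix e (case_nat (c 0) c)) (FAll 1 \<psi>') \<longleftrightarrow> (\<forall>x\<in>U. P x e)" if "env S e" for e
    using \<psi>' eq P[OF _ that] by simp
  then show ?thesis unfolding dfn_def using env_case_nat[OF c, of "c 0"] envD[OF c] by metis
qed

lemma dfn_exU[dfi]: "dfn (\<lambda>e. P (e 0) (shift e)) \<Longrightarrow> dfn (\<lambda>e. \<exists>x\<in>U. P x e)"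
  using dfn_not[OF dfn_allU[OF dfn_not]] by simp

text \<open>The term is substituted without touching the formula, by quantifying over an
  \<open>x\<close> equal to its value; this works because a \<open>df\<close> term takes values in
  the universe.\<close>

lemma dfn_subst1:
  assumes "dfn (\<lambda>e. P (e 0) (shift e))" "df t"
  shows "dfn (\<lambda>e. P (t e) e)"
proof (rule dfn_cong)
  show "dfn (\<lambda>e. \<exists>x\<in>U. x = t e \<and> P x e)"
    using assms by (intro dfn_exU dfn_conj) (auto simp: df_def)
  show "P (t e) e \<longleftrightarrow> (\<exists>x\<in>U. x = t e \<and> P x e)" if "env S e" for e
    using assms(2) that by (auto simp: df_def)
qed

lemma df_ren: "df t \<Longrightarrow> df (\<lambda>e. t (\<lambda>n. e (f n)))"
  unfolding df_def using dfn_ren[of "\<lambda>e. e 0 = t (shift e)" "case_nat 0 (\<lambda>n. Suc (f n))"]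
  by (auto simp: env_def)

lemma dc_ren: "dc A \<Longrightarrow> dc (\<lambda>e. A (\<lambda>n. e (f n)))"
  unfolding dc_def using dfn_ren[of "\<lambda>e. e 0 \<in> A (shift e)" "case_nat 0 (\<lambda>n. Suc (f n))"]
  by (auto simp: env_def)

lemma dfn_rel1:
  assumes "dfn (\<lambda>e. R (e 0))" "df s"
  shows "dfn (\<lambda>e. R (s e))"
  by (rule dfn_subst1[where P="\<lambda>x e. R x"]) (use assms in auto)

text \<open>With this rule a relation has to be analysed only at the plain variables 0 and 1. Terms
  are put in afterwards, the second one under the shift caused by the first.\<close>

lemma dfn_rel2:
  assumes "dfn (\<lambda>e. R (e 0) (e 1))" "df s" "df t"
  shows "dfn (\<lambda>e. R (s e) (t e))"
proof (rule dfn_subst1[where P="\<lambda>x e. R x (t e)"])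
  show "dfn (\<lambda>e. R (e 0) (t (shift e)))"
  proof (rule dfn_subst1[where P="\<lambda>x e. R (e 0) x"])
    show "dfn (\<lambda>e. R (e (Suc 0)) (e 0))"
      using dfn_ren[OF assms(1), of "\<lambda>n. if n = 0 then 1 else 0"] by simp
  qed (rule df_ren, fact)
qed fact

lemma dfn_rel3:
  assumes "dfn (\<lambda>e. R (e 0) (e 1) (e 2))" "df s" "df t" "df u"
  shows "dfn (\<lambda>e. R (s e) (t e) (u e))"
proof (rule dfn_subst1[where P="\<lambda>x e. R x (t e) (u e)"])
  show "dfn (\<lambda>e. R (e 0) (t (shift e)) (u (shift e)))"
  proof (rule dfn_subst1[where P="\<lambda>x e. R (e 0) x (u (shift e))"])
    show "dfn (\<lambda>e. R (e (Suc 0)) (e 0) (u (\<lambda>n. e (Suc (Suc n)))))"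
    proof (rule dfn_subst1[where P="\<lambda>x e. R (e (Suc 0)) (e 0) x"])
      show "dfn (\<lambda>e. R (e (Suc (Suc 0))) (e (Suc 0)) (e 0))"
        using dfn_ren[OF assms(1), of "\<lambda>n. if n = 0 then 2 else if n = 1 then 1 else 0"]
        by (simp add: numeral_2_eq_2)
    qed (rule df_ren, fact)
  qed (rule df_ren, fact)
qed fact

lemma df_funU: "df (\<lambda>e. F (e 0)) \<Longrightarrow> x \<in> U \<Longrightarrow> F x \<in> U"
  unfolding df_def by (drule conjunct1, drule spec[of _ "\<lambda>_. x"]) (simp add: env_def)

lemma df_app1:
  assumes "df (\<lambda>e. F (e 0))" "df s"
  shows "df (\<lambda>e. F (s e))"
proof -
  have "dfn (\<lambda>e. e 0 = F (s (shift e)))"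
  proof (rule dfn_subst1[where P="\<lambda>x e. e 0 = F x"])
    show "dfn (\<lambda>e. e (Suc 0) = F (e 0))"
      using assms(1) dfn_ren[of "\<lambda>e. e 0 = F (e 1)" "\<lambda>n. if n = 0 then 1 else 0"]
      by (simp add: df_def)
  qed (rule df_ren, fact)
  moreover have "F (s e) \<in> U" if "env S e" for e
    using df_funU[OF assms(1)] assms(2) that by (simp add: df_def)
  ultimately show ?thesis by (simp add: df_def)
qed

lemma df_app2:
  assumes "df (\<lambda>e. F (e 0) (e 1))" "df s" "df t"
  shows "df (\<lambda>e. F (s e) (t e))"
proof -
  have F: "dfn (\<lambda>e. e 0 = F (e 1) (e 2))" using assms(1) by (simp add: df_def numeral_2_eq_2)
  have "dfn (\<lambda>e. e 0 = F (s (shift e)) (t (shift e)))"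
  proof (rule dfn_rel3[of "\<lambda>x y z. x = F y z"])
    show "df (\<lambda>e. e 0)" unfolding df_def
      using dfn_sat[of "FEq 0 1"] by (auto simp: envD)
  qed (use F df_ren assms in auto)
  moreover have "F (s e) (t e) \<in> U" if "env S e" for e
  proof -
    have "env S (case_nat (s e) (\<lambda>_. t e))"
      using assms that by (intro env_case_nat) (auto simp: df_def env_def)
    with assms(1) have "F (case_nat (s e) (\<lambda>_. t e) 0) (case_nat (s e) (\<lambda>_. t e) 1) \<in> U"
      unfolding df_def by (elim conjE allE) (erule impE)
    then show ?thesis by simp
  qed
  ultimately show ?thesis by (simp add: df_def)
qed

lemma df_var[dfi]: "df (\<lambda>e. e n)"
  unfolding df_def using dfn_sat[of "FEq 0 (Suc n)"] by (auto simp: envD)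

lemma df_const[dfc]: "c \<in> U \<Longrightarrow> df (\<lambda>e. c)"
  using dfn_inst[OF dfn_sat[of "FEq 0 1"], of "\<lambda>_. c" "\<lambda>n. n = 1" "\<lambda>_. 0"]
  by (simp add: df_def env_def)

text \<open>Any definable description \<open>P\<close> of the graph will do, however the function
  was defined. This is how \<open>THE\<close> and \<open>SOME\<close> are eliminated later.\<close>

lemma df_rel:
  assumes "\<And>e. env S e \<Longrightarrow> t e \<in> U"
    and "\<And>e y. env S e \<Longrightarrow> y \<in> U \<Longrightarrow> y = t e \<longleftrightarrow> P y e"
    and "dfn (\<lambda>e. P (e 0) (shift e))"
  shows "df t"
  unfolding df_def using assms(1)
  by (auto intro!: dfn_cong[OF _ assms(3)] assms(2) envD env_Suc)

lemma dfn_eq[dfi]: "df s \<Longrightarrow> df t \<Longrightarrow> dfn (\<lambda>e. s e = t e)"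
  using dfn_rel2[of "(=)"] dfn_sat[of "FEq 0 1"] by simp

lemma dfn_mem[dfi]: "df s \<Longrightarrow> df t \<Longrightarrow> dfn (\<lambda>e. mem S (s e) (t e))"
  using dfn_rel2[of "mem S"] dfn_sat[of "FMem 0 1"] by simp

lemma dfU: "df s \<Longrightarrow> env S e \<Longrightarrow> s e \<in> U"
  by (simp add: df_def)

lemma dcU: "dc A \<Longrightarrow> env S e \<Longrightarrow> x \<in> A e \<Longrightarrow> x \<in> U"
  by (auto simp: dc_def)

section \<open>Definable classes and bounded quantifiers\<close>

lemma dfn_in[dfi]:
  assumes "df s" "dc A" shows "dfn (\<lambda>e. s e \<in> A e)"
  by (rule dfn_subst1[where P="\<lambda>x e. x \<in> A e"]) (use assms in \<open>auto simp: dc_def\<close>)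

lemma dc_elts[dfi]:
  assumes "df t" shows "dc (\<lambda>e. elts S (t e))"
proof -
  have "dfn (\<lambda>e. mem S (e 0) (t (shift e)))" by (intro dfi df_ren[OF assms])
  then have "dfn (\<lambda>e. e 0 \<in> elts S (t (shift e)))"
    by (rule dfn_cong[rotated]) (simp add: elts_def envD)
  then show ?thesis by (simp add: dc_def elts_subset_U)
qed

lemma dc_U[dfi]: "dc (\<lambda>e. U)"
  using dfn_cong[OF _ dfn_const[of True]] by (auto simp: dc_def envD)

lemma dc_const[dfc]: "isset S A \<Longrightarrow> dc (\<lambda>e. A)"
  unfolding isset_def by (auto intro!: dfi dfc)

lemma dc_empty[dfi]: "dc (\<lambda>e. {})"
  by (simp add: dc_def dfn_const)

lemma dc_insert[dfi]:
  assumes "df s" "dc A" shows "dc (\<lambda>e. insert (s e) (A e))"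
proof -
  have "dfn (\<lambda>e. e 0 = s (shift e) \<or> e 0 \<in> A (shift e))"
    by (intro dfi df_ren[OF assms(1)] dc_ren[OF assms(2)])
  then show ?thesis using assms unfolding dc_def df_def by simp
qed

lemma dc_Un[dfi]:
  assumes "dc A" "dc B" shows "dc (\<lambda>e. A e \<union> B e)"
proof -
  have "dfn (\<lambda>e. e 0 \<in> A (shift e) \<or> e 0 \<in> B (shift e))"
    by (intro dfi dc_ren[OF assms(1)] dc_ren[OF assms(2)])
  then show ?thesis using assms unfolding dc_def by (simp add: subset_iff)
qed

lemma dc_Int[dfi]:
  assumes "dc A" "dc B" shows "dc (\<lambda>e. A e \<inter> B e)"
proof -
  have "dfn (\<lambda>e. e 0 \<in> A (shift e) \<and> e 0 \<in> B (shift e))"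
    by (intro dfi dc_ren[OF assms(1)] dc_ren[OF assms(2)])
  then show ?thesis using assms unfolding dc_def by (simp add: subset_iff)
qed

lemma dc_Diff[dfi]:
  assumes "dc A" "dc B" shows "dc (\<lambda>e. A e - B e)"
proof -
  have "dfn (\<lambda>e. e 0 \<in> A (shift e) \<and> \<not> e 0 \<in> B (shift e))"
    by (intro dfi dc_ren[OF assms(1)] dc_ren[OF assms(2)])
  then show ?thesis using assms unfolding dc_def by (simp add: subset_iff)
qed

lemma dc_Collect[dfi]:
  assumes "dc A" "dfn (\<lambda>e. P (e 0) (shift e))"
  shows "dc (\<lambda>e. {x\<in>A e. P x e})"
proof -
  have "dfn (\<lambda>e. e 0 \<in> A (shift e) \<and> P (e 0) (shift e))"
    by (intro dfi dc_ren[OF assms(1)] assms(2))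
  then show ?thesis using assms(1) unfolding dc_def by auto
qed

lemma dfn_ball[dfi]:
  assumes "dc A" "dfn (\<lambda>e. P (e 0) (shift e))"
  shows "dfn (\<lambda>e. \<forall>x\<in>A e. P x e)"
proof (rule dfn_cong)
  show "dfn (\<lambda>e. \<forall>x\<in>U. x \<in> A e \<longrightarrow> P x e)" by (intro dfi dc_ren[OF assms(1)] assms(2))
qed (use assms(1) in \<open>auto dest: dcU\<close>)

lemma dfn_bex[dfi]:
  assumes "dc A" "dfn (\<lambda>e. P (e 0) (shift e))"
  shows "dfn (\<lambda>e. \<exists>x\<in>A e. P x e)"
  using dfn_not[OF dfn_ball[OF assms(1) dfn_not[OF assms(2)]]] by simp

lemma dfn_subset[dfi]:
  assumes "dc A" "dc B" shows "dfn (\<lambda>e. A e \<subseteq> B e)"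
  unfolding subset_eq by (intro dfi dc_ren[OF assms(2)] assms(1))

lemma dfn_seteq[dfi]: "dc A \<Longrightarrow> dc B \<Longrightarrow> dfn (\<lambda>e. A e = B e)"
  unfolding set_eq_subset by (intro dfi)

lemma dc_UN[dfi]:
  assumes "dc A" "dc (\<lambda>e. B (e 0) (shift e))"
  shows "dc (\<lambda>e. \<Union>x\<in>A e. B x e)"
proof -
  have "dfn (\<lambda>e. \<exists>x\<in>A (shift e). e 0 \<in> B x (shift e))"
  proof (rule dfn_bex)
    show "dfn (\<lambda>e. e (Suc 0) \<in> B (e 0) (\<lambda>n. e (Suc (Suc n))))"
      \<comment> \<open>There are two binders here: variable 0 is \<open>x\<close> and variable 1
        the candidate element. The renaming makes \<open>B\<close> skip the latter.\<close>
      using dc_ren[OF assms(2), of "case_nat 0 (\<lambda>n. Suc (Suc n))"] by (intro dfi) simp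
  qed (rule dc_ren[OF assms(1)])
  moreover have "B x e \<subseteq> U" if "env S e" "x \<in> A e" for x e
    using assms(2) env_case_nat[OF that(1) dcU[OF assms(1) that]] unfolding dc_def by fastforce
  ultimately show ?thesis by (auto simp: dc_def)
qed

lemma dc_image[dfi]:
  assumes "dc A" "df (\<lambda>e. F (e 0) (shift e))"
  shows "dc (\<lambda>e. (\<lambda>x. F x e) ` A e)"
  using dc_UN[OF assms(1), of "\<lambda>x e. {F x e}"] assms(2)
  by (simp add: dc_insert[OF _ dc_empty] UNION_singleton_eq_range)

lemma df_setof[dfi]:
  assumes "dc A" "\<And>e. env S e \<Longrightarrow> isset S (A e)"
  shows "df (\<lambda>e. setof S (A e))"
proof (rule df_rel[where P="\<lambda>y e. elts S y = A e"])
  show "dfn (\<lambda>e. elts S (e 0) = A (shift e))" by (intro dfi dc_ren[OF assms(1)])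
  show "y = setof S (A e) \<longleftrightarrow> elts S y = A e" if "env S e" "y \<in> U" for e y
    using elts_setof[OF assms(2)[OF that(1)]] setof_eqI[OF that(2)] by auto
qed (use assms(2) in \<open>auto simp: setof_U\<close>)

lemma df_if[dfi]:
  assumes "dfn P" "df s" "df t"
  shows "df (\<lambda>e. if P e then s e else t e)"
proof (rule df_rel[where P="\<lambda>y e. (P e \<longrightarrow> y = s e) \<and> (\<not> P e \<longrightarrow> y = t e)"])
  show "dfn (\<lambda>e. (P (shift e) \<longrightarrow> e 0 = s (shift e)) \<and> (\<not> P (shift e) \<longrightarrow> e 0 = t (shift e)))"
    by (intro dfi df_ren[OF assms(2)] df_ren[OF assms(3)] dfn_ren[OF assms(1)])
qed (use assms in \<open>auto dest: dfU\<close>)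

section \<open>Sets of the structure\<close>

text \<open>The axiom varies only variable 0 of its assignment. As \<open>P\<close> depends on
  \<open>e 0\<close> alone, all even variables may be read as 0, hence as \<open>z\<close>, and the
  parameters move to the positions from 1 on.\<close>

lemma isset_sep:
  assumes "isset S A" "dfn (\<lambda>e. P (e 0))"
  shows "isset S {z\<in>A. P z}"
proof -
  obtain x where x: "x \<in> U" "elts S x = A" using assms(1) by (auto simp: isset_def)
  obtain \<psi> c where c: "env S c" and \<psi>: "\<And>e. env S e \<Longrightarrow> P (e 0) \<longleftrightarrow> sat S (mix e c) \<psi>"
    using assms(2) unfolding dfn_def by blast
  obtain \<psi>' where \<psi>': "\<forall>e. sat S e \<psi>' \<longleftrightarrow> sat S (\<lambda>n. e (if even n then 0 else Suc (n div 2))) \<psi>"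
    using sat_rename[where S=S] by meson
  let ?e = "case_nat x c"
  have e: "range ?e \<subseteq> U" using env_case_nat[OF c x(1)] by (auto simp: env_def)
  have "sat S (?e(0 := z)) \<psi>' \<longleftrightarrow> P z" if "z \<in> U" for z
  proof -
    have "(\<lambda>n. (?e(0 := z)) (if even n then 0 else Suc (n div 2))) = mix (\<lambda>_. z) c"
      by (rule ext) (simp add: mix_def)
    then show ?thesis using \<psi>' \<psi>[of "\<lambda>_. z"] that by (simp add: env_def)
  qed
  moreover obtain y where "y \<in> U" "elts S y = {z \<in> elts S x. sat S (?e(0 := z)) \<psi>'}"
    using zfc e x(1) unfolding ZFC_minus_def separation_ax_def by blast
  ultimately show ?thesis unfolding isset_def using x eltsU by (intro bexI[of _ y]) auto
qed

lemma isset_sub: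
  assumes "isset S A" "dc (\<lambda>e. B)" "B \<subseteq> A"
  shows "isset S B"
proof -
  have "{z\<in>A. z \<in> B} = B" using assms(3) by auto
  then show ?thesis using isset_sep[OF assms(1), of "\<lambda>z. z \<in> B"] dfn_in[OF df_var assms(2)] by simp
qed

text \<open>As in \<open>isset_sep\<close>, with the argument in position 0, the value in position 1
  and the parameters from 2 on. The two leading copies of \<open>x\<close> in the assignment are
  placeholders for argument and value.\<close>

lemma isset_repl:
  assumes "isset S A" "dfn (\<lambda>e. P (e 0) (e 1))"
    and "\<And>x y z. x \<in> A \<Longrightarrow> y \<in> U \<Longrightarrow> z \<in> U \<Longrightarrow> P x y \<Longrightarrow> P x z \<Longrightarrow> y = z"
  shows "isset S {y\<in>U. \<exists>x\<in>A. P x y}"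
proof -
  obtain x where x: "x \<in> U" "elts S x = A" using assms(1) by (auto simp: isset_def)
  obtain \<psi> c where c: "env S c" and \<psi>: "\<And>e. env S e \<Longrightarrow> P (e 0) (e 1) \<longleftrightarrow> sat S (mix e c) \<psi>"
    using assms(2) unfolding dfn_def by blast
  obtain \<psi>' where \<psi>': "\<forall>e. sat S e \<psi>' \<longleftrightarrow>
      sat S (\<lambda>n. e (if n = 0 then 0 else if even n then 1 else Suc (Suc (n div 2)))) \<psi>"
    using sat_rename[where S=S] by meson
  let ?e = "case_nat x (case_nat x c)"
  have e: "range ?e \<subseteq> U" using env_case_nat[OF env_case_nat[OF c x(1)] x(1)] by (auto simp: env_def)
  have s: "sat S (?e(0 := y, 1 := z)) \<psi>' \<longleftrightarrow> P y z" if "y \<in> U" "z \<in> U" for y z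
  proof -
    have "(\<lambda>n. (?e(0 := y, 1 := z)) (if n = 0 then 0 else if even n then 1 else Suc (Suc (n div 2))))
        = mix (case_nat y (\<lambda>_. z)) c"
      by (rule ext) (auto simp: mix_def elim!: evenE split: nat.split)
    moreover have "env S (case_nat y (\<lambda>_. z))" using that by (simp add: env_def split: nat.split)
    ultimately show ?thesis using \<psi>' \<psi>[of "case_nat y (\<lambda>_. z)"] by simp
  qed
  have "\<forall>a\<in>elts S x. \<forall>y\<in>U. \<forall>y'\<in>U. sat S (?e(0 := a, 1 := y)) \<psi>' \<and> sat S (?e(0 := a, 1 := y')) \<psi>' \<longrightarrow> y = y'"
    using s assms(3) x eltsU by blast
  then obtain b where "b \<in> U" "elts S b = {y \<in> U. \<exists>a\<in>elts S x. sat S (?e(0 := a, 1 := y)) \<psi>'}"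
    using zfc e x(1) unfolding ZFC_minus_def replacement_ax_def by blast
  then show ?thesis unfolding isset_def using x eltsU s by (intro bexI[of _ b]) blast+
qed

lemma isset_image:
  assumes "isset S A" "df (\<lambda>e. F (e 0))"
  shows "isset S (F ` A)"
proof -
  have "dfn (\<lambda>e. e 1 = F (e 0))"
    using dfn_eq[OF df_var df_app1[OF assms(2) df_var]] .
  moreover have "{y\<in>U. \<exists>x\<in>A. y = F x} = F ` A"
    using isset_subset_U[OF assms(1)] df_funU[OF assms(2)] by auto
  ultimately show ?thesis using isset_repl[OF assms(1), of "\<lambda>x y. y = F x"] by simp
qed

lemma isset_pair: "a \<in> U \<Longrightarrow> b \<in> U \<Longrightarrow> isset S {a, b}"
  using zfc by (auto simp: ZFC_minus_def pairing_ax_def isset_def)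

lemma isset_single: "a \<in> U \<Longrightarrow> isset S {a}"
  using isset_pair[of a a] by simp

lemma isset_Union: "isset S A \<Longrightarrow> isset S (\<Union>x\<in>A. elts S x)"
  using zfc by (auto simp: ZFC_minus_def union_ax_def isset_def)

lemma isset_UN:
  assumes "isset S A" "df (\<lambda>e. F (e 0))"
  shows "isset S (\<Union>x\<in>A. elts S (F x))"
  using isset_Union[OF isset_image[OF assms]] by simp

lemma isset_UN':
  assumes "isset S A" "dc (\<lambda>e. B (e 0))" "\<And>x. x \<in> A \<Longrightarrow> isset S (B x)"
  shows "isset S (\<Union>x\<in>A. B x)"
proof -
  \<comment> \<open>\<open>df_setof\<close> asks for a set at every element of the universe, so
    \<open>B x\<close> is replaced by the empty set outside \<open>A\<close>.\<close>
  have e: "isset S {y\<in>B x. x \<in> A}" if "x \<in> U" for x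
  proof (cases "x \<in> A")
    case False
    obtain z where "z \<in> U" using U_nonempty by blast
    then have "isset S {}"
      using isset_sub[OF isset_elts[of z] dc_empty] by blast
    with False show ?thesis by simp
  qed (simp add: assms(3))
  have "df (\<lambda>e. setof S {y\<in>B (e 0). e 0 \<in> A})"
    by (intro dfi dc_ren[OF assms(2)] dc_const assms) (auto simp: envD e assms(2))
  from isset_UN[OF assms(1) this] show ?thesis
    using elts_setof[OF assms(3)] by (simp cong: SUP_cong)
qed

lemma isset_Un: "isset S A \<Longrightarrow> isset S B \<Longrightarrow> isset S (A \<union> B)"
  using isset_Union[OF isset_pair[of "setof S A" "setof S B"]] by (simp add: elts_setof setof_U)

lemma isset_insert: "a \<in> U \<Longrightarrow> isset S A \<Longrightarrow> isset S (insert a A)"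
  using isset_Un[OF isset_single, of a A] by simp

lemma isset_pow: "isset S A \<Longrightarrow> isset S {z\<in>U. elts S z \<subseteq> A}"
  using zfc by (auto simp: ZFC_minus_def powerset_ax_def isset_def)

lemma isset_empty: "isset S {}"
proof -
  obtain z where "z \<in> U" using U_nonempty by blast
  then show ?thesis using isset_sub[OF isset_single dc_empty] by blast
qed

lemma zero_U[simp]: "zero S \<in> U" and elts_zero[simp]: "elts S (zero S) = {}"
  by (auto simp: zero_def isset_empty setof_U elts_setof)

lemma df_zero[dfi]: "df (\<lambda>e. zero S)"
  by (rule df_const) simp

section \<open>Ordered pairs, projections and application of coded functions\<close>

lemma pair_U[simp]: "a \<in> U \<Longrightarrow> b \<in> U \<Longrightarrow> pair S a b \<in> U"
  by (simp add: pair_def setof_U isset_pair isset_single)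

lemma pair_inject[simp]:
  assumes "a \<in> U" "b \<in> U" "c \<in> U" "d \<in> U"
  shows "pair S a b = pair S c d \<longleftrightarrow> a = c \<and> b = d"
proof
  assume "pair S a b = pair S c d"
  then have "{setof S {a}, setof S {a, b}} = {setof S {c}, setof S {c, d}}"
    unfolding pair_def using assms by (intro setof_inject) (simp_all add: setof_U isset_pair isset_single)
  then have "elts S ` {setof S {a}, setof S {a, b}} = elts S ` {setof S {c}, setof S {c, d}}"
    by (rule arg_cong)
  then have "{{a}, {a, b}} = {{c}, {c, d}}"
    using assms by (simp add: elts_setof isset_pair isset_single)
  then show "a = c \<and> b = d" by (auto simp: doubleton_eq_iff)
qed simp

lemma df_pair[dfi]: "df s \<Longrightarrow> df t \<Longrightarrow> df (\<lambda>e. pair S (s e) (t e))"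
  unfolding pair_def by (intro dfi) (auto simp: isset_pair isset_single setof_U dfU)

lemma triple_U[simp]: "a \<in> U \<Longrightarrow> b \<in> U \<Longrightarrow> c \<in> U \<Longrightarrow> triple S a b c \<in> U"
  by (simp add: triple_def)

lemma triple_inject[simp]:
  "\<lbrakk>a \<in> U; b \<in> U; c \<in> U; a' \<in> U; b' \<in> U; c' \<in> U\<rbrakk> \<Longrightarrow>
    triple S a b c = triple S a' b' c' \<longleftrightarrow> a = a' \<and> b = b' \<and> c = c'"
  by (simp add: triple_def)

lemma df_triple[dfi]: "df s \<Longrightarrow> df t \<Longrightarrow> df u \<Longrightarrow> df (\<lambda>e. triple S (s e) (t e) (u e))"
  unfolding triple_def by (intro dfi)

lemma succ_U[simp]: "n \<in> U \<Longrightarrow> succ S n \<in> U"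
  and elts_succ[simp]: "n \<in> U \<Longrightarrow> elts S (succ S n) = insert n (elts S n)"
  by (simp_all add: succ_def setof_U elts_setof isset_insert isset_elts)

lemma df_succ[dfi]: "df s \<Longrightarrow> df (\<lambda>e. succ S (s e))"
  unfolding succ_def by (intro dfi) (auto simp: isset_insert isset_elts dfU)

text \<open>Total with default \<open>zero S\<close>, because \<open>df\<close> requires a value in
  the universe at every argument.\<close>

definition tfst :: "'a \<Rightarrow> 'a" where
  "tfst x = (if \<exists>a\<in>U. \<exists>b\<in>U. x = pair S a b then THE a. a \<in> U \<and> (\<exists>b\<in>U. x = pair S a b) else zero S)"

definition tsnd :: "'a \<Rightarrow> 'a" where
  "tsnd x = (if \<exists>a\<in>U. \<exists>b\<in>U. x = pair S a b then THE b. b \<in> U \<and> (\<exists>a\<in>U. x = pair S a b) else zero S)"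

lemma tfst_pair[simp]: "a \<in> U \<Longrightarrow> b \<in> U \<Longrightarrow> tfst (pair S a b) = a"
  unfolding tfst_def by (auto intro!: the_equality)

lemma tsnd_pair[simp]: "a \<in> U \<Longrightarrow> b \<in> U \<Longrightarrow> tsnd (pair S a b) = b"
  unfolding tsnd_def by (auto intro!: the_equality)

lemma tfst_default: "\<not> (\<exists>a\<in>U. \<exists>b\<in>U. x = pair S a b) \<Longrightarrow> tfst x = zero S"
  and tsnd_default: "\<not> (\<exists>a\<in>U. \<exists>b\<in>U. x = pair S a b) \<Longrightarrow> tsnd x = zero S"
  by (simp_all add: tfst_def tsnd_def)

lemma tfst_U[simp]: "tfst x \<in> U" and tsnd_U[simp]: "tsnd x \<in> U"
  by (metis tfst_pair tfst_default zero_U, metis tsnd_pair tsnd_default zero_U)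

lemma df_tfst[dfi]:
  assumes "df s" shows "df (\<lambda>e. tfst (s e))"
proof (rule df_app1[OF df_rel assms])
  let ?P = "\<lambda>y e. (\<exists>b\<in>U. (e 0) = pair S y b) \<or> y = zero S \<and> \<not> (\<exists>a\<in>U. \<exists>b\<in>U. (e 0) = pair S a b)"
  show "y = tfst (e 0) \<longleftrightarrow> ?P y e" if "env S e" "y \<in> U" for e y
  proof (cases "\<exists>a\<in>U. \<exists>b\<in>U. e 0 = pair S a b")
    case True
    then obtain a b where "a \<in> U" "b \<in> U" "e 0 = pair S a b" by blast
    then show ?thesis using that(2) by auto
  next
    case False
    then show ?thesis using that(2) tfst_default[OF False] by auto
  qed
  show "dfn (\<lambda>e. ?P (e 0) (shift e))" by (intro dfi)
qed auto

lemma df_tsnd[dfi]: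
  assumes "df s" shows "df (\<lambda>e. tsnd (s e))"
proof (rule df_app1[OF df_rel assms])
  let ?P = "\<lambda>y e. (\<exists>b\<in>U. (e 0) = pair S b y) \<or> y = zero S \<and> \<not> (\<exists>a\<in>U. \<exists>b\<in>U. (e 0) = pair S a b)"
  show "y = tsnd (e 0) \<longleftrightarrow> ?P y e" if "env S e" "y \<in> U" for e y
  proof (cases "\<exists>a\<in>U. \<exists>b\<in>U. e 0 = pair S a b")
    case True
    then obtain a b where "a \<in> U" "b \<in> U" "e 0 = pair S a b" by blast
    then show ?thesis using that(2) by auto
  next
    case False
    then show ?thesis using that(2) tsnd_default[OF False] by auto
  qed
  show "dfn (\<lambda>e. ?P (e 0) (shift e))" by (intro dfi)
qed auto

text \<open>The value is \<open>zero S\<close> unless it is unique.\<close>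

definition ap :: "'a \<Rightarrow> 'a \<Rightarrow> 'a" where
  "ap f x = (if \<exists>!y. y \<in> U \<and> pair S x y \<in> elts S f then THE y. y \<in> U \<and> pair S x y \<in> elts S f else zero S)"

lemma ap_U[simp]: "ap f x \<in> U"
  unfolding ap_def using theI'[of "\<lambda>y. y \<in> U \<and> pair S x y \<in> elts S f"] by simp

lemma ap_eq: "y \<in> U \<Longrightarrow> pair S x y \<in> elts S f \<Longrightarrow> (\<And>z. z \<in> U \<Longrightarrow> pair S x z \<in> elts S f \<Longrightarrow> z = y) \<Longrightarrow> ap f x = y"
  unfolding ap_def by (metis (no_types, lifting) the_equality)

text \<open>A description of the graph of \<open>ap\<close> with quantifiers over the universe and
  without \<open>THE\<close>, as needed for its definability.\<close>

lemma ap_iff: "y \<in> U \<Longrightarrow> y = ap f x \<longleftrightarrow> (pair S x y \<in> elts S f \<and> (\<forall>z\<in>U. pair S x z \<in> elts S f \<longrightarrow> z = y)) \<or>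
    (y = zero S \<and> \<not> (\<exists>y\<in>U. pair S x y \<in> elts S f \<and> (\<forall>z\<in>U. pair S x z \<in> elts S f \<longrightarrow> z = y)))"
proof -
  assume y: "y \<in> U"
  have *: "(\<exists>!y. y \<in> U \<and> pair S x y \<in> elts S f) \<longleftrightarrow>
    (\<exists>y\<in>U. pair S x y \<in> elts S f \<and> (\<forall>z\<in>U. pair S x z \<in> elts S f \<longrightarrow> z = y))" by blast
  show ?thesis
  proof (cases "\<exists>y\<in>U. pair S x y \<in> elts S f \<and> (\<forall>z\<in>U. pair S x z \<in> elts S f \<longrightarrow> z = y)")
    case True
    then show ?thesis using ap_eq by blast
  next
    case False
    then have "ap f x = zero S" unfolding ap_def * by (rule if_not_P)
    moreover have "\<not> (pair S x y \<in> elts S f \<and> (\<forall>z\<in>U. pair S x z \<in> elts S f \<longrightarrow> z = y))"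
      using False y by blast
    ultimately show ?thesis using False by (simp only: simp_thms)
  qed
qed

lemma df_ap[dfi]:
  assumes "df s" "df t" shows "df (\<lambda>e. ap (s e) (t e))"
proof (rule df_app2[where F = ap, OF df_rel assms])
  let ?Q = "\<lambda>y e. pair S (e 1) y \<in> elts S (e 0) \<and> (\<forall>z\<in>U. pair S (e 1) z \<in> elts S (e 0) \<longrightarrow> z = y)"
  let ?P = "\<lambda>y e. ?Q y e \<or> y = zero S \<and> \<not> (\<exists>y\<in>U. ?Q y e)"
  show "y = ap (e 0) (e 1) \<longleftrightarrow> ?P y e" if "env S e" "y \<in> U" for e y
    using ap_iff[OF that(2)] .
  show "dfn (\<lambda>e. ?P (e 0) (shift e))" by (intro dfi)
qed simp

lemma ap_image:
  assumes "A \<subseteq> U" "h ` A \<subseteq> U" "elts S f = (\<lambda>a. pair S a (h a)) ` A" "x \<in> A"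
  shows "ap f x = h x"
  by (rule ap_eq) (use assms in \<open>auto simp: subset_eq\<close>)

lemma isset_graph: "isset S A \<Longrightarrow> df (\<lambda>e. h (e 0)) \<Longrightarrow> isset S ((\<lambda>a. pair S a (h a)) ` A)"
  using isset_image[of A "\<lambda>a. pair S a (h a)"] by (simp add: df_pair[OF df_var])

lemma internal_funI:
  assumes "isset S A" "df (\<lambda>e. h (e 0))"
  shows "internal_fun S A h"
proof -
  note df_funU[OF assms(2)]
  then show ?thesis
    using isset_graph[OF assms] isset_subset_U[OF assms(1)] by (auto simp: internal_fun_def isset_def)
qed

lemma internal_funE:
  assumes "internal_fun S A h" "A \<subseteq> U"
  obtains f where "f \<in> U" "\<And>x. x \<in> A \<Longrightarrow> h x = ap f x"
  using assms ap_image[of A h] unfolding internal_fun_def by metis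

lemma df_ap_const: "f \<in> U \<Longrightarrow> df (\<lambda>e. ap f (e 0))"
  by (intro dfi dfc)

section \<open>Ordinals and natural numbers\<close>

lemma dfn_transitive_set[dfi]: 
  assumes "df s" shows "dfn (\<lambda>e. transitive_set S (s e))"
  by (rule dfn_rel1[OF _ assms]) (unfold transitive_set_def, intro dfi)

lemma dfn_ordinal[dfi]: 
  assumes "df s" shows "dfn (\<lambda>e. ordinal S (s e))"
  by (rule dfn_rel1[OF _ assms]) (unfold ordinal_def, intro dfi)

lemma ordinalU: "ordinal S \<alpha> \<Longrightarrow> \<alpha> \<in> U"
  by (simp add: ordinal_def)

lemma ordinal_trans: "ordinal S \<alpha> \<Longrightarrow> \<beta> \<in> elts S \<alpha> \<Longrightarrow> \<gamma> \<in> elts S \<beta> \<Longrightarrow> \<gamma> \<in> elts S \<alpha>"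
  by (auto simp: ordinal_def transitive_set_def)

lemma ordinal_trichotomy:
  "ordinal S \<alpha> \<Longrightarrow> x \<in> elts S \<alpha> \<Longrightarrow> y \<in> elts S \<alpha> \<Longrightarrow> x = y \<or> x \<in> elts S y \<or> y \<in> elts S x"
  by (simp add: ordinal_def)

lemma ordinal_wf:
  assumes "ordinal S \<alpha>" "isset S B" "B \<subseteq> elts S \<alpha>" "B \<noteq> {}"
  shows "\<exists>m\<in>B. B \<inter> elts S m = {}"
  using assms unfolding ordinal_def isset_def by blast

lemma ordinal_elts_irrefl: 
  assumes "ordinal S \<alpha>" "x \<in> elts S \<alpha>" shows "x \<notin> elts S x"
  using ordinal_wf[OF assms(1) isset_single, of x] assms eltsU[OF assms(2)] by auto

lemma ordinal_irrefl: "ordinal S \<alpha> \<Longrightarrow> \<alpha> \<notin> elts S \<alpha>"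
  using ordinal_elts_irrefl by blast

lemma ordinal_elt:
  assumes "ordinal S \<alpha>" "\<beta> \<in> elts S \<alpha>" shows "ordinal S \<beta>"
proof -
  have sub: "x \<in> elts S \<alpha>" if "x \<in> elts S \<beta>" for x
    using ordinal_trans[OF assms that] .
  have "\<delta> \<in> elts S \<beta>" if g: "\<gamma> \<in> elts S \<beta>" and d: "\<delta> \<in> elts S \<gamma>" for \<gamma> \<delta>
  proof (rule ccontr)
    assume "\<delta> \<notin> elts S \<beta>"
    moreover have da: "\<delta> \<in> elts S \<alpha>" using ordinal_trans[OF assms(1) sub[OF g] d] .
    ultimately have "\<delta> = \<beta> \<or> \<beta> \<in> elts S \<delta>" using ordinal_trichotomy[OF assms(1) da assms(2)] by blast
    \<comment> \<open>If \<delta> equals \<beta> or contains it, then the three ordinals form a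
      membership cycle, so the set of them has no minimal element.\<close>
    moreover have "isset S {\<beta>, \<gamma>, \<delta>}"
      using eltsU[OF assms(2)] eltsU[OF g] eltsU[OF d] by (simp add: isset_insert isset_empty)
    then have "\<exists>m\<in>{\<beta>, \<gamma>, \<delta>}. {\<beta>, \<gamma>, \<delta>} \<inter> elts S m = {}"
      using da g assms sub by (intro ordinal_wf) auto
    ultimately show False using g d by auto
  qed
  then show ?thesis
    using assms eltsU[OF assms(2)] sub unfolding ordinal_def[of S \<alpha>] ordinal_def[of S \<beta>] transitive_set_def
    by (meson subset_iff)
qed

text \<open>The least element \<open>m\<close> of the difference works: what lies below
  \<open>m\<close> is in \<beta> by minimality, and a common element cannot be equal to or above
  \<open>m\<close>, since that would put \<open>m\<close> into \<beta>.\<close>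

lemma ordinal_not_subset:
  assumes "ordinal S \<alpha>" "ordinal S \<beta>" "\<not> elts S \<alpha> \<subseteq> elts S \<beta>"
  shows "\<exists>m\<in>elts S \<alpha>. m \<notin> elts S \<beta> \<and> elts S m = elts S \<alpha> \<inter> elts S \<beta>"
proof -
  let ?D = "elts S \<alpha> - elts S \<beta>"
  have "isset S ?D"
    by (rule isset_sub[OF isset_elts[OF ordinalU[OF assms(1)]]], intro dfi df_const ordinalU assms) auto
  then obtain m where m: "m \<in> ?D" "?D \<inter> elts S m = {}"
    using ordinal_wf[OF assms(1), of ?D] assms(3) by blast
  have "elts S m \<subseteq> elts S \<alpha> \<inter> elts S \<beta>" using m ordinal_trans[OF assms(1)] by blast
  moreover have "x \<in> elts S m" if "x \<in> elts S \<alpha>" "x \<in> elts S \<beta>" for x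
    using ordinal_trichotomy[OF assms(1) that(1), of m] m that ordinal_trans[OF assms(2) that(2)] by blast
  ultimately show ?thesis using m by blast
qed

lemma ordinal_linear:
  assumes "ordinal S \<alpha>" "ordinal S \<beta>"
  shows "\<alpha> = \<beta> \<or> \<alpha> \<in> elts S \<beta> \<or> \<beta> \<in> elts S \<alpha>"
proof (cases "elts S \<alpha> \<subseteq> elts S \<beta>")
  case True
  show ?thesis
  proof (cases "elts S \<beta> \<subseteq> elts S \<alpha>")
    case True
    with \<open>elts S \<alpha> \<subseteq> elts S \<beta>\<close> show ?thesis using elts_eqD assms ordinalU by blast
  next
    case False
    then obtain m where "m \<in> elts S \<beta>" "elts S m = elts S \<alpha>"
      using ordinal_not_subset[OF assms(2,1)] True by blast
    then show ?thesis using elts_eqD assms ordinalU eltsU by blast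
  qed
next
  case False
  then obtain m where m: "m \<in> elts S \<alpha>" "m \<notin> elts S \<beta>" "elts S m = elts S \<alpha> \<inter> elts S \<beta>"
    using ordinal_not_subset[OF assms] by blast
  show ?thesis
  proof (cases "elts S \<beta> \<subseteq> elts S \<alpha>")
    case True
    then have "elts S m = elts S \<beta>" using m by blast
    then show ?thesis using elts_eqD assms ordinalU eltsU m by blast
  next
    case False
    then obtain n where "n \<in> elts S \<beta>" "elts S n = elts S \<alpha> \<inter> elts S \<beta>"
      using ordinal_not_subset[OF assms(2,1)] by blast
    then have "n = m" using elts_eqD[of n m] m eltsU by metis
    then show ?thesis using m \<open>n \<in> elts S \<beta>\<close> by blast
  qed
qed

text \<open>\<open>B\<close> may be a proper class. Below any one of its members it is a set, to
  which the well-foundedness of that member applies.\<close>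

lemma ordinal_least:
  assumes "dc (\<lambda>e. B)" "\<And>x. x \<in> B \<Longrightarrow> ordinal S x" "B \<noteq> {}"
  shows "\<exists>m\<in>B. B \<inter> elts S m = {}"
proof -
  obtain \<alpha> where \<alpha>: "\<alpha> \<in> B" using assms(3) by blast
  show ?thesis
  proof (cases "B \<inter> elts S \<alpha> = {}")
    case False
    have "isset S (B \<inter> elts S \<alpha>)"
      using isset_sub[OF isset_elts, of \<alpha> "B \<inter> elts S \<alpha>"] assms \<alpha> ordinalU by (simp add: dc_Int dc_elts df_const)
    then obtain m where "m \<in> B \<inter> elts S \<alpha>" "(B \<inter> elts S \<alpha>) \<inter> elts S m = {}"
      using ordinal_wf[OF assms(2)[OF \<alpha>], of "B \<inter> elts S \<alpha>"] False by blast
    then show ?thesis using ordinal_trans[OF assms(2)[OF \<alpha>]] by blast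
  qed (use \<alpha> in blast)
qed

lemma ordinalI:
  assumes "x \<in> U" "transitive_set S x" "\<And>y. y \<in> elts S x \<Longrightarrow> ordinal S y"
  shows "ordinal S x"
proof -
  have "\<exists>m\<in>elts S b. elts S b \<inter> elts S m = {}"
    if "b \<in> U" "elts S b \<subseteq> elts S x \<and> elts S b \<noteq> {}" for b
    using ordinal_least[OF dc_const[OF isset_elts[OF that(1)]]] assms(3) that(2) by blast
  moreover have "y = z \<or> y \<in> elts S z \<or> z \<in> elts S y" if "y \<in> elts S x" "z \<in> elts S x" for y z
    using ordinal_linear assms(3) that by blast
  ultimately show ?thesis using assms(1,2) unfolding ordinal_def by blast
qed

lemma ordinal_zero: "ordinal S (zero S)"
  by (rule ordinalI) (auto simp: transitive_set_def)

lemma ordinal_succ: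
  assumes "ordinal S \<alpha>" shows "ordinal S (succ S \<alpha>)"
proof (rule ordinalI)
  note e = elts_succ[OF ordinalU[OF assms]]
  show "transitive_set S (succ S \<alpha>)"
    unfolding transitive_set_def e using ordinal_trans[OF assms] by blast
  show "ordinal S y" if "y \<in> elts S (succ S \<alpha>)" for y
    using that assms ordinal_elt[OF assms] unfolding e by blast
qed (simp add: ordinalU assms)

section \<open>The natural numbers of the structure\<close>

lemma is_inductive_iff:
  "is_inductive S I \<longleftrightarrow> zero S \<in> elts S I \<and> (\<forall>n\<in>elts S I. succ S n \<in> elts S I)"
proof -
  have "z = zero S" if "z \<in> elts S I" "elts S z = {}" for z
    using elts_eqD[of z "zero S"] eltsU that by simp
  moreover have "m = succ S n" if "m \<in> elts S I" "n \<in> elts S I" "elts S m = insert n (elts S n)" for n m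
    using elts_eqD[of m "succ S n"] eltsU that by simp
  ultimately show ?thesis unfolding is_inductive_def using eltsU elts_zero elts_succ by metis
qed

lemma isset_omega: "isset S (omega S)"
proof -
  obtain I where "I \<in> U" "is_inductive S I"
    using zfc by (auto simp: ZFC_minus_def infinity_ax_def)
  then show ?thesis unfolding omega_def is_inductive_iff
    by (intro isset_sub[OF isset_elts]) (auto intro!: dfi)
qed

lemmas dc_omega[dfi] = dc_const[OF isset_omega]

lemma zero_omega[simp]: "zero S \<in> omega S"
  and succ_omega[simp]: "n \<in> omega S \<Longrightarrow> succ S n \<in> omega S"
  by (auto simp: omega_def is_inductive_iff)

lemma omegaU: "n \<in> omega S \<Longrightarrow> n \<in> U"
  by (simp add: omega_def)

text \<open>Omega may have nonstandard elements, so induction is tied to definable \<open>P\<close>: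
  separation turns such a \<open>P\<close> into an inductive set.\<close>

lemma omega_induct[consumes 1, case_names dfn zero succ]:
  assumes "n \<in> omega S" "dfn (\<lambda>e. P (e 0))"
    and "P (zero S)" "\<And>n. n \<in> omega S \<Longrightarrow> P n \<Longrightarrow> P (succ S n)"
  shows "P n"
proof -
  obtain x where x: "x \<in> U" "elts S x = {n\<in>omega S. P n}"
    using isset_sep[OF isset_omega assms(2)] by (auto simp: isset_def)
  then have "is_inductive S x" using assms by (simp add: is_inductive_iff)
  then have "n \<in> elts S x" using assms(1) x(1) unfolding omega_def by blast
  then show ?thesis unfolding x(2) by simp
qed

lemma omega_ordinal: "n \<in> omega S \<Longrightarrow> ordinal S n"
  by (induction rule: omega_induct) (auto intro!: dfi ordinal_zero ordinal_succ)

lemma omega_elt: "n \<in> omega S \<Longrightarrow> m \<in> elts S n \<Longrightarrow> m \<in> omega S"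
proof -
  assume "n \<in> omega S"
  then have "elts S n \<subseteq> omega S"
    by (induction rule: omega_induct) (auto intro!: dfi simp: omegaU)
  then show "m \<in> elts S n \<Longrightarrow> m \<in> omega S" by blast
qed

lemma zero_in_succ: "n \<in> omega S \<Longrightarrow> zero S \<in> elts S (succ S n)"
  by (induction rule: omega_induct) (auto intro!: dfi simp: omegaU)

lemma succ_in_succ:
  assumes "n \<in> omega S" "k \<in> elts S n"
  shows "succ S k \<in> elts S (succ S n)"
proof -
  have o: "ordinal S n" "ordinal S k" using omega_ordinal[OF assms(1)] ordinal_elt assms by blast+
  note U = ordinalU[OF o(1)] ordinalU[OF o(2)]
  have "succ S n \<noteq> succ S k \<and> succ S n \<notin> elts S (succ S k)"
  proof (rule ccontr)
    assume "\<not> ?thesis"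
    then have "n \<in> elts S (succ S k)"
      using ordinal_trans[OF ordinal_succ[OF o(2)], of "succ S n" n] elts_succ[OF U(1)] by auto
    then have "n = k \<or> n \<in> elts S k" using U by simp
    then show False
      using ordinal_irrefl[OF o(1)] ordinal_trans[OF o(1) assms(2)] assms(2) by blast
  qed
  then show ?thesis using ordinal_linear[OF ordinal_succ[OF o(1)] ordinal_succ[OF o(2)]] by blast
qed

section \<open>Recursion\<close>

text \<open>Recursion by attempts: a set function is an attempt at \<open>x\<close> if it obeys the
  equation at \<open>x\<close> and at everything below. Two attempts agree on common ground by a
  minimal disagreement, and a minimal point without an attempt would receive one. Transitivity of
  \<open>r\<close> makes the segments \<open>sg x\<close> closed downwards.\<close>

lemma wf_recursion:
  assumes A: "isset S A" and r: "dfn (\<lambda>e. r (e 0) (e 1))" and H: "df (\<lambda>e. H (e 0))"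
    and tr: "\<And>x y z. \<lbrakk>x \<in> A; y \<in> A; z \<in> A; r x y; r y z\<rbrakk> \<Longrightarrow> r x z"
    and wf: "\<And>B. \<lbrakk>isset S B; B \<subseteq> A; B \<noteq> {}\<rbrakk> \<Longrightarrow> \<exists>m\<in>B. \<forall>y\<in>B. \<not> r y m"
  shows "\<exists>g. df (\<lambda>e. g (e 0)) \<and> (\<forall>x\<in>A. g x = H (setof S (g ` {y\<in>A. r y x})))"
proof -
  note rd = dfn_rel2[of r, OF r] and Hd = df_app1[of H, OF H] and Ad = dc_const[OF A]
  define sg where "sg x = {y\<in>A. r y x}" for x
  have isg: "isset S (sg x)" if "x \<in> U" for x
    unfolding sg_def by (rule isset_sep[OF A]) (intro rd dfi df_const that)
  have sgd: "dc (\<lambda>e. sg (s e))" if "df s" for s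
    unfolding sg_def by (intro dfi Ad rd df_ren[OF that])
  define good where "good x f \<longleftrightarrow> (\<forall>z\<in>insert x (sg x). ap f z = H (setof S (ap f ` sg z)))" for x f
  have goodd: "dfn (\<lambda>e. good (s e) (t e))" if "df s" "df t" for s t
    unfolding good_def
    by (intro dfi Hd that sgd df_ren[OF that(2)]) (auto intro!: isset_image isg df_ap_const simp: envD env_Suc dfU[OF that(2)])
  have AU: "x \<in> U" if "x \<in> A" for x using isset_subset_U[OF A] that by blast
  have sgA: "sg x \<subseteq> A" for x by (auto simp: sg_def)
  have sgt: "sg y \<subseteq> sg x" if "x \<in> A" "y \<in> sg x" for x y
    using that tr[of _ y x] by (auto simp: sg_def)
  have good_sub: "good y f" if "x \<in> A" "good x f" "y \<in> sg x" for x y f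
    using sgt[OF that(1,3)] that unfolding good_def by blast
  have uniq: "ap f z = ap f' z"
    if a: "x \<in> A" "x' \<in> A" "f \<in> U" "f' \<in> U" "good x f" "good x' f'" "z \<in> insert x (sg x)" "z \<in> insert x' (sg x')"
    for x x' f f' z
  proof (rule ccontr)
    assume ne: "ap f z \<noteq> ap f' z"
    let ?B = "{z\<in>insert x (sg x) \<inter> insert x' (sg x'). ap f z \<noteq> ap f' z}"
    have "isset S ?B"
      by (rule isset_sub[OF A], intro dfi sgd df_const AU a) (use a(1) sgA in blast)
    moreover have "?B \<subseteq> A" using sgA a by blast
    ultimately obtain m where m: "m \<in> ?B" "\<forall>y\<in>?B. \<not> r y m" using wf[of ?B] ne a by blast
    have "ap f y = ap f' y" if y: "y \<in> sg m" for y
    proof -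
      have "y \<in> sg x" "y \<in> sg x'" using y m sgt[OF a(1)] sgt[OF a(2)] by blast+
      then show ?thesis using m(2) y by (auto simp: sg_def)
    qed
    then have "ap f ` sg m = ap f' ` sg m" by (rule image_cong[OF refl])
    moreover have "ap f m = H (setof S (ap f ` sg m))" "ap f' m = H (setof S (ap f' ` sg m))"
      using m(1) a unfolding good_def by blast+
    ultimately show False using m(1) by simp
  qed
  \<comment> \<open>\<open>SOME\<close> gives no formula, but by \<open>uniq\<close> the value does
    not depend on the attempt, so the graph of \<open>g\<close> has a definable description.\<close>
  define g where "g x = (if x \<in> A \<and> (\<exists>f\<in>U. good x f) then ap (SOME f. f \<in> U \<and> good x f) x else zero S)" for x
  have g: "g x = ap f x" if "x \<in> A" "f \<in> U" "good x f" for x f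
  proof -
    have "(SOME f. f \<in> U \<and> good x f) \<in> U \<and> good x (SOME f. f \<in> U \<and> good x f)"
      by (rule someI[of _ f]) (use that in simp)
    then have "ap (SOME f. f \<in> U \<and> good x f) x = ap f x"
      using uniq[OF that(1,1) _ that(2) _ that(3)] by blast
    then show ?thesis using that unfolding g_def by (metis (no_types, lifting))
  qed
  have gU: "g x \<in> U" for x by (simp add: g_def)
  have gd: "df (\<lambda>e. g (e 0))"
  proof (rule df_rel)
    let ?P = "\<lambda>y e. (\<exists>f\<in>U. e 0 \<in> A \<and> good (e 0) f \<and> y = ap f (e 0)) \<or>
      y = zero S \<and> \<not> (e 0 \<in> A \<and> (\<exists>f\<in>U. good (e 0) f))"
    show "y = g (e 0) \<longleftrightarrow> ?P y e" if "env S e" "y \<in> U" for e y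
    proof (cases "e 0 \<in> A \<and> (\<exists>f\<in>U. good (e 0) f)")
      case True
      then obtain f where "f \<in> U" "good (e 0) f" by blast
      then show ?thesis using True g by metis
    next
      case False then show ?thesis by (auto simp: g_def)
    qed
    show "dfn (\<lambda>e. ?P (e 0) (shift e))" by (intro dfi goodd Ad)
  qed (rule gU)
  note gd' = df_app1[of g, OF gd]
  have ex: "\<exists>f\<in>U. good x f" if xA: "x \<in> A" for x
  proof (rule ccontr)
    assume "\<not> (\<exists>f\<in>U. good x f)"
    let ?B = "{x\<in>A. \<not> (\<exists>f\<in>U. good x f)}"
    have "isset S ?B" by (rule isset_sep[OF A]) (intro dfi goodd)
    then obtain m where m: "m \<in> ?B" "\<forall>y\<in>?B. \<not> r y m"
      using wf[of ?B] xA \<open>\<not> (\<exists>f\<in>U. good x f)\<close> by blast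
    have mA: "m \<in> A" using m by simp
    have "\<not> r m m" using wf[OF isset_single[OF AU[OF mA]]] mA by simp
    then have mm: "m \<notin> sg m" by (simp add: sg_def)
    \<comment> \<open>The values of \<open>g\<close> below \<open>m\<close> together with the value
      that the equation prescribes at \<open>m\<close>. Replacement codes them as a set function,
      and this is an attempt at \<open>m\<close>.\<close>
    define k where "k y = (if y = m then H (setof S (g ` sg m)) else g y)" for y
    have gs: "setof S (g ` sg m) \<in> U" using isset_image[OF isg[OF AU[OF mA]] gd] by (rule setof_U)
    have kd: "df (\<lambda>e. k (e 0))" unfolding k_def
      by (intro dfi gd' df_const df_funU[OF H] gs AU[OF mA])
    have "isset S (insert m (sg m))" using AU[OF mA] isg by (intro isset_insert) auto
    note ins = this
    obtain f where f: "f \<in> U" "elts S f = (\<lambda>y. pair S y (k y)) ` insert m (sg m)"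
      using isset_graph[OF ins kd] unfolding isset_def by blast
    have apf: "ap f y = k y" if "y \<in> insert m (sg m)" for y
      using ap_image[OF isset_subset_U[OF ins] _ f(2) that] df_funU[OF kd] isset_subset_U[OF ins] by blast
    have apg: "ap f y = g y" if "y \<in> sg m" for y
      using apf[of y] that mm by (auto simp: k_def)
    have "ap f z = H (setof S (ap f ` sg z))" if z: "z \<in> insert m (sg m)" for z
    proof (cases "z = m")
      case True
      have "ap f ` sg m = g ` sg m" using apg by (rule image_cong[OF refl])
      then show ?thesis using True apf[of m] by (simp add: k_def)
    next
      case False
      then have zs: "z \<in> sg m" using z by simp
      then have zA: "z \<in> A" using sgA by blast
      obtain h where h: "h \<in> U" "good z h" using m(2) zs zA by (auto simp: sg_def)
      have "ap f z = ap h z" using apg[OF zs] g[OF zA h] by simp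
      also have "\<dots> = H (setof S (ap h ` sg z))" using h(2) by (simp add: good_def)
      also have "ap h ` sg z = ap f ` sg z"
      proof (rule image_cong[OF refl])
        fix y assume y: "y \<in> sg z"
        then have "y \<in> A" "y \<in> sg m" using sgA sgt[OF mA zs] by blast+
        then show "ap h y = ap f y" using apg g h(1) good_sub[OF zA h(2) y] by simp
      qed
      finally show ?thesis .
    qed
    then have "good m f" by (simp add: good_def)
    then show False using m(1) f(1) by blast
  qed
  have "g x = H (setof S (g ` sg x))" if x: "x \<in> A" for x
  proof -
    obtain f where f: "f \<in> U" "good x f" using ex[OF x] by blast
    have "ap f ` sg x = g ` sg x"
    proof (rule image_cong[OF refl])
      fix y assume y: "y \<in> sg x"
      then show "ap f y = g y" using g f(1) good_sub[OF x f(2) y] sgA by (metis subsetD)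
    qed
    then show ?thesis using g[OF x f] f(2) by (simp add: good_def)
  qed
  then show ?thesis using gd unfolding sg_def by blast
qed

text \<open>Course-of-values form: \<open>H\<close> receives the set of all earlier values, not the
  number \<open>n\<close>.\<close>

lemma omega_recursion:
  assumes "df (\<lambda>e. H (e 0))"
  obtains g where "df (\<lambda>e. g (e 0))" "\<And>n. n \<in> omega S \<Longrightarrow> g n = H (setof S (g ` elts S n))"
proof -
  have "\<exists>g. df (\<lambda>e. g (e 0)) \<and> (\<forall>x\<in>omega S. g x = H (setof S (g ` {y\<in>omega S. y \<in> elts S x})))"
  proof (rule wf_recursion[OF isset_omega _ assms])
    show "dfn (\<lambda>e. e 0 \<in> elts S (e 1))" by (intro dfi)
    show "\<exists>m\<in>B. \<forall>y\<in>B. y \<notin> elts S m" if "isset S B" "B \<subseteq> omega S" "B \<noteq> {}" for B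
      using ordinal_least[OF dc_const[OF that(1)]] that omega_ordinal by blast
  qed (use ordinal_trans omega_ordinal in blast)
  moreover have "{y\<in>omega S. y \<in> elts S x} = elts S x" if "x \<in> omega S" for x
    using omega_elt that by blast
  ultimately show ?thesis using that by auto
qed

section \<open>Transitive closure\<close>

lemma transitive_superset:
  assumes "x \<in> U"
  shows "\<exists>t\<in>U. transitive_set S t \<and> elts S x \<subseteq> elts S t"
proof -
  \<comment> \<open>Iterated union in course-of-values form: a level consists of \<open>x\<close>
    and of the elements of elements of all earlier levels. The next level absorbs the elements of
    members of a level, so the union over omega is transitive.\<close>
  let ?H = "\<lambda>w. setof S (elts S x \<union> (\<Union>u\<in>elts S w. \<Union>v\<in>elts S u. elts S v))"
  have ins: "isset S (elts S x \<union> (\<Union>u\<in>elts S w. \<Union>v\<in>elts S u. elts S v))" if "w \<in> U" for w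
  proof (rule isset_Un[OF isset_elts[OF assms] isset_UN'[OF isset_elts[OF that]]])
    show "dc (\<lambda>e. \<Union>v\<in>elts S (e 0). elts S v)" by (intro dfi)
  qed (intro isset_Union isset_elts eltsU)
  have "df (\<lambda>e. ?H (e 0))" by (intro dfi df_const assms ins) (simp add: envD)
  then obtain g where g: "df (\<lambda>e. g (e 0))" "\<And>n. n \<in> omega S \<Longrightarrow> g n = ?H (setof S (g ` elts S n))"
    by (rule omega_recursion) blast
  have eg: "elts S (g n) = elts S x \<union> (\<Union>m\<in>elts S n. \<Union>v\<in>elts S (g m). elts S v)" if "n \<in> omega S" for n
  proof -
    have i: "isset S (g ` elts S n)" by (rule isset_image[OF isset_elts[OF omegaU[OF that]] g(1)])
    show ?thesis unfolding g(2)[OF that]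
      by (subst elts_setof[OF ins[OF setof_U[OF i]]]) (simp add: elts_setof[OF i])
  qed
  obtain t where t: "t \<in> U" "elts S t = (\<Union>n\<in>omega S. elts S (g n))"
    using isset_UN[OF isset_omega g(1)] by (auto simp: isset_def)
  have "elts S y \<subseteq> elts S (g (succ S n))" if "n \<in> omega S" "y \<in> elts S (g n)" for n y
    using that elts_succ[OF omegaU[OF that(1)]] unfolding eg[OF succ_omega[OF that(1)]] by blast
  then have "transitive_set S t" unfolding transitive_set_def t using succ_omega by blast
  moreover have "elts S x \<subseteq> elts S t" unfolding t using eg[OF zero_omega] zero_omega by blast
  ultimately show ?thesis using t(1) by blast
qed

lemma elts_trcl:
  assumes "x \<in> U"
  shows "trcl S x \<in> U" "elts S (trcl S x) = {y\<in>U. \<forall>t\<in>U. transitive_set S t \<and> elts S x \<subseteq> elts S t \<longrightarrow> y \<in> elts S t}" (is "_ = ?T")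
proof -
  obtain t where t: "t \<in> U" "transitive_set S t" "elts S x \<subseteq> elts S t"
    using transitive_superset[OF assms] by blast
  have "isset S ?T"
    by (rule isset_sub[OF isset_elts[OF t(1)]]) (use t in \<open>auto intro!: dfi df_const assms\<close>)
  then show "trcl S x \<in> U" "elts S (trcl S x) = ?T"
    unfolding trcl_def by (auto simp: setof_U elts_setof)
qed

lemma trcl_single:
  assumes "x \<in> U"
  defines "T \<equiv> trcl S (setof S {x})"
  shows trcl_single_U: "T \<in> U" and trcl_single_self: "x \<in> elts S T"
    and trcl_single_trans: "\<And>y z. y \<in> elts S T \<Longrightarrow> z \<in> elts S y \<Longrightarrow> z \<in> elts S T"
    and trcl_single_least: "\<And>B. isset S B \<Longrightarrow> x \<in> B \<Longrightarrow> (\<And>y z. y \<in> B \<Longrightarrow> z \<in> elts S y \<Longrightarrow> z \<in> B) \<Longrightarrow> elts S T \<subseteq> B"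
proof -
  have x: "setof S {x} \<in> U" "elts S (setof S {x}) = {x}"
    using isset_single[OF assms(1)] by (simp_all add: setof_U elts_setof)
  show "T \<in> U" unfolding T_def using elts_trcl(1)[OF x(1)] .
  note T = elts_trcl(2)[OF x(1), folded T_def, unfolded x(2)]
  show "x \<in> elts S T" unfolding T using assms(1) by blast
  show "\<And>y z. y \<in> elts S T \<Longrightarrow> z \<in> elts S y \<Longrightarrow> z \<in> elts S T"
    unfolding T transitive_set_def using eltsU by blast
  show "elts S T \<subseteq> B" if B: "isset S B" "x \<in> B" "\<And>y z. y \<in> B \<Longrightarrow> z \<in> elts S y \<Longrightarrow> z \<in> B" for B
  proof -
    obtain b where b: "b \<in> U" "elts S b = B" using B(1) by (auto simp: isset_def)
    have "transitive_set S b" using b B by (auto simp: transitive_set_def)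
    then show ?thesis unfolding T using b B(2) by blast
  qed
qed

section \<open>Rank\<close>

text \<open>\<open>has_rank\<close> quantifies over functions of the metalogic. Here the rank
  function is an element \<open>f\<close> of the universe read through \<open>ap\<close>, so the
  condition is definable.\<close>

definition rankfun :: "'a \<Rightarrow> 'a \<Rightarrow> bool" where
  "rankfun t f \<longleftrightarrow> transitive_set S t \<and> (\<forall>y\<in>elts S t. ordinal S (ap f y) \<and>
     elts S (ap f y) = (\<Union>z\<in>elts S y. insert (ap f z) (elts S (ap f z))))"

lemma rankfun_trans: "rankfun t f \<Longrightarrow> x \<in> elts S t \<Longrightarrow> y \<in> elts S x \<Longrightarrow> y \<in> elts S t"
  unfolding rankfun_def transitive_set_def by blast

lemma dfn_rankfun:
  assumes "df s" "df t" shows "dfn (\<lambda>e. rankfun (s e) (t e))"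
  by (rule dfn_rel2[OF _ assms, of rankfun]) (unfold rankfun_def, intro dfi)

lemma has_rank_iff:
  "has_rank S x \<alpha> \<longleftrightarrow> (\<exists>t\<in>U. \<exists>f\<in>U. rankfun t f \<and> x \<in> elts S t \<and> ap f x = \<alpha>)"
proof
  assume "has_rank S x \<alpha>"
  then obtain t h where t: "t \<in> U" "transitive_set S t" "x \<in> elts S t" "internal_fun S (elts S t) h" "h x = \<alpha>"
    and h: "\<And>y. y \<in> elts S t \<Longrightarrow> ordinal S (h y)"
      "\<And>y. y \<in> elts S t \<Longrightarrow> elts S (h y) = (\<Union>z\<in>elts S y. insert (h z) (elts S (h z)))"
    unfolding has_rank_def by blast
  obtain f where f: "f \<in> U" "\<And>x. x \<in> elts S t \<Longrightarrow> h x = ap f x"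
    using internal_funE[OF t(4) elts_subset_U] by blast
  have "rankfun t f" unfolding rankfun_def
  proof (intro conjI ballI t(2))
    fix y assume y: "y \<in> elts S t"
    show "ordinal S (ap f y)" using h(1)[OF y] f(2)[OF y] by simp
    have "z \<in> elts S t" if "z \<in> elts S y" for z
      using t(2) y that unfolding transitive_set_def by blast
    then show "elts S (ap f y) = (\<Union>z\<in>elts S y. insert (ap f z) (elts S (ap f z)))"
      using h(2)[OF y] f(2)[OF y] f(2) by simp
  qed
  then show "\<exists>t\<in>U. \<exists>f\<in>U. rankfun t f \<and> x \<in> elts S t \<and> ap f x = \<alpha>"
    using t f by metis
next
  assume "\<exists>t\<in>U. \<exists>f\<in>U. rankfun t f \<and> x \<in> elts S t \<and> ap f x = \<alpha>"
  then obtain t f where t: "t \<in> U" "f \<in> U" "rankfun t f" "x \<in> elts S t" "ap f x = \<alpha>" by blast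
  show "has_rank S x \<alpha>" unfolding has_rank_def
    using t internal_funI[OF isset_elts[OF t(1)] df_ap_const[OF t(2)]] unfolding rankfun_def
    by (intro bexI[OF _ t(1)] exI[of _ "ap f"]) blast
qed

lemma dfn_has_rank[dfi]:
  assumes "df s" "df t" shows "dfn (\<lambda>e. has_rank S (s e) (t e))"
  by (rule dfn_rel2[OF _ assms, of "has_rank S"]) (unfold has_rank_iff, intro dfi dfn_rankfun)

lemma rankfun_unique:
  assumes "f \<in> U" "f' \<in> U" "t \<in> U" "t' \<in> U"
    and R: "rankfun t f" "rankfun t' f'" and x: "x \<in> elts S t" "x \<in> elts S t'"
  shows "ap f x = ap f' x"
proof (rule ccontr)
  assume ne: "ap f x \<noteq> ap f' x"
  let ?B = "ap f ` {x\<in>elts S t \<inter> elts S t'. ap f x \<noteq> ap f' x}"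
  have "dc (\<lambda>e. ?B)" by (intro dfi df_const assms)
  moreover have "ordinal S y" if "y \<in> ?B" for y using that R(1) unfolding rankfun_def by blast
  moreover have "?B \<noteq> {}" using ne x by blast
  ultimately obtain m where m: "m \<in> ?B" "?B \<inter> elts S m = {}" using ordinal_least by blast
  then obtain y where y: "y \<in> elts S t" "y \<in> elts S t'" "ap f y \<noteq> ap f' y" "m = ap f y" by blast
  have e: "elts S (ap f y) = (\<Union>z\<in>elts S y. insert (ap f z) (elts S (ap f z)))"
    "elts S (ap f' y) = (\<Union>z\<in>elts S y. insert (ap f' z) (elts S (ap f' z)))"
    using R y unfolding rankfun_def by blast+
  have "ap f z = ap f' z" if z: "z \<in> elts S y" for z
  proof (rule ccontr)
    assume "ap f z \<noteq> ap f' z"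
    moreover have "z \<in> elts S t" "z \<in> elts S t'" using rankfun_trans R y z by blast+
    ultimately have "ap f z \<in> ?B" by blast
    moreover have "ap f z \<in> elts S m" unfolding y(4) e(1) using z by blast
    ultimately show False using m(2) by blast
  qed
  then have "elts S (ap f y) = elts S (ap f' y)" unfolding e by simp
  then show False using y(3) elts_eqD[of "ap f y" "ap f' y"] by simp
qed

lemma has_rank_unique: "has_rank S x \<alpha> \<Longrightarrow> has_rank S x \<beta> \<Longrightarrow> \<alpha> = \<beta>"
  unfolding has_rank_iff using rankfun_unique by blast

lemma has_rankU: "has_rank S x \<alpha> \<Longrightarrow> x \<in> U"
  unfolding has_rank_iff using eltsU by blast

lemma has_rank_ordinal: "has_rank S x \<alpha> \<Longrightarrow> ordinal S \<alpha>"
  unfolding has_rank_iff rankfun_def by blast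

lemma has_rank_elt:
  assumes "has_rank S x \<alpha>" "y \<in> elts S x"
  shows "\<exists>\<beta>\<in>elts S \<alpha>. has_rank S y \<beta>"
proof -
  obtain t f where t: "t \<in> U" "f \<in> U" "rankfun t f" "x \<in> elts S t" "ap f x = \<alpha>"
    using assms(1) unfolding has_rank_iff by blast
  have "y \<in> elts S t" using rankfun_trans[OF t(3,4) assms(2)] .
  moreover have "ap f y \<in> elts S \<alpha>" using t assms(2) unfolding rankfun_def by blast
  ultimately show ?thesis using t unfolding has_rank_iff by blast
qed

text \<open>On the transitive closure of \<open>y\<close> the rank function is the existing rank
  everywhere except at \<open>y\<close>, where it is the required supremum. Arguing by contradiction
  guarantees that \<open>y\<close> differs from every ranked set, so the new value overwrites no old
  one.\<close>

lemma has_rank_if_elts: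
  assumes y: "y \<in> U" and el: "\<And>z. z \<in> elts S y \<Longrightarrow> \<exists>\<alpha>. has_rank S z \<alpha>"
  shows "\<exists>\<alpha>. has_rank S y \<alpha>"
proof (rule ccontr)
  assume unr: "\<nexists>\<alpha>. has_rank S y \<alpha>"
  define rk where "rk x = (if \<exists>\<alpha>\<in>U. has_rank S x \<alpha> then THE \<alpha>. has_rank S x \<alpha> else zero S)" for x
  have rk: "rk x = \<alpha>" if "has_rank S x \<alpha>" for x \<alpha>
  proof -
    have "(THE \<alpha>. has_rank S x \<alpha>) = \<alpha>"
      using that has_rank_unique by (intro the_equality) blast+
    moreover have "\<exists>\<alpha>\<in>U. has_rank S x \<alpha>" using that has_rank_ordinal ordinalU by blast
    ultimately show ?thesis by (simp add: rk_def)
  qed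
  have rkU: "rk x \<in> U" for x
  proof (cases "\<exists>\<alpha>\<in>U. has_rank S x \<alpha>")
    case True then show ?thesis using rk by metis
  next
    case False then show ?thesis by (simp add: rk_def)
  qed
  have rkd: "df (\<lambda>e. rk (s e))" if "df s" for s
  proof (rule df_app1[of rk, OF df_rel that])
    let ?P = "\<lambda>y e. has_rank S (e 0) y \<or> y = zero S \<and> \<not> (\<exists>\<alpha>\<in>U. has_rank S (e 0) \<alpha>)"
    show "y = rk (e 0) \<longleftrightarrow> ?P y e" if "env S e" "y \<in> U" for e y
    proof (cases "\<exists>\<alpha>\<in>U. has_rank S (e 0) \<alpha>")
      case True then show ?thesis using rk has_rank_unique by metis
    next
      case False
      then have "rk (e 0) = zero S" "\<not> has_rank S (e 0) y" using that by (auto simp: rk_def)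
      then show ?thesis using False by simp
    qed
    show "dfn (\<lambda>e. ?P (e 0) (shift e))" by (intro dfi)
  qed (rule rkU)
  have rke: "ordinal S (rk u) \<and> elts S (rk u) = (\<Union>z\<in>elts S u. insert (rk z) (elts S (rk z)))"
    if u: "has_rank S u \<alpha>" for u \<alpha>
  proof -
    obtain t f where t: "t \<in> U" "f \<in> U" "rankfun t f" "u \<in> elts S t" "ap f u = \<alpha>"
      using u unfolding has_rank_iff by blast
    have a: "rk z = ap f z" if "z \<in> elts S t" for z
      by (rule rk) (use t that in \<open>auto simp: has_rank_iff\<close>)
    have "rk z = ap f z" if "z \<in> elts S u" for z using a rankfun_trans[OF t(3,4) that] by blast
    then have "(\<Union>z\<in>elts S u. insert (rk z) (elts S (rk z))) = (\<Union>z\<in>elts S u. insert (ap f z) (elts S (ap f z)))"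
      by simp
    then show ?thesis using t(3,4) a[OF t(4)] unfolding rankfun_def by simp
  qed
  let ?T = "trcl S (setof S {y})"
  \<comment> \<open>The members of the closure that are \<open>y\<close> or have a rank form a set
    containing \<open>y\<close> and closed under elements, because ranks pass to elements.\<close>
  have T: "u = y \<or> (\<exists>\<alpha>. has_rank S u \<alpha>)" if u: "u \<in> elts S ?T" for u
  proof -
    let ?B = "{u\<in>elts S ?T. u = y \<or> (\<exists>\<alpha>\<in>U. has_rank S u \<alpha>)}"
    have ub: "(\<exists>\<alpha>. has_rank S u \<alpha>) \<longleftrightarrow> (\<exists>\<alpha>\<in>U. has_rank S u \<alpha>)" for u
      using has_rank_ordinal ordinalU by blast
    have "elts S ?T \<subseteq> ?B"
    proof (rule trcl_single_least[OF y])
      show "isset S ?B" by (rule isset_sep[OF isset_elts[OF trcl_single_U[OF y]]]) (intro dfi df_const y)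
      show "y \<in> ?B" using trcl_single_self[OF y] by simp
      show "z \<in> ?B" if "w \<in> ?B" "z \<in> elts S w" for w z
      proof -
        have "\<exists>\<alpha>. has_rank S z \<alpha>"
        proof (cases "w = y")
          case False
          then obtain \<alpha> where "has_rank S w \<alpha>" using \<open>w \<in> ?B\<close> by blast
          then show ?thesis using has_rank_elt that(2) by blast
        qed (use el that(2) in simp)
        then show ?thesis using ub[of z] trcl_single_trans[OF y _ that(2)] that(1) by simp
      qed
    qed
    then have "u \<in> ?B" using u by (rule subsetD)
    then show ?thesis using ub[of u] by simp
  qed
  have isu: "isset S (\<Union>z\<in>elts S y. insert (rk z) (elts S (rk z)))"
    using isset_UN[OF isset_elts[OF y], of "\<lambda>z. succ S (rk z)"] rkd[OF df_var] rkU by (simp add: df_succ)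
  define h where "h u = (if u = y then setof S (\<Union>z\<in>elts S y. insert (rk z) (elts S (rk z))) else rk u)" for u
  have hd: "df (\<lambda>e. h (e 0))" unfolding h_def by (intro dfi df_const y setof_U isu rkd)
  have hrk: "h z = rk z" if "has_rank S z \<alpha>" for z \<alpha>
    using that unr by (auto simp: h_def)
  have hy: "elts S (h y) = (\<Union>z\<in>elts S y. insert (rk z) (elts S (rk z)))"
    by (simp add: h_def elts_setof[OF isu])
  have "ordinal S (h u) \<and> elts S (h u) = (\<Union>z\<in>elts S u. insert (h z) (elts S (h z)))"
    if u: "u \<in> elts S ?T" for u
  proof -
    have re: "\<exists>\<alpha>. has_rank S z \<alpha>" if z: "z \<in> elts S u" for z
      using T[OF u] el z has_rank_elt[of u _ z] by blast
    have "h z = rk z" if "z \<in> elts S u" for z using re[OF that] hrk by blast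
    then have eq: "(\<Union>z\<in>elts S u. insert (h z) (elts S (h z))) = (\<Union>z\<in>elts S u. insert (rk z) (elts S (rk z)))"
      by simp
    show ?thesis
    proof (cases "u = y")
      case True
      have o: "ordinal S (rk z)" if "z \<in> elts S y" for z using rke re that True by blast
      have "ordinal S (h y)"
      proof (rule ordinalI[OF df_funU[OF hd y]])
        show "transitive_set S (h y)" unfolding transitive_set_def hy
        proof (intro ballI subsetI)
          fix w v assume "w \<in> (\<Union>z\<in>elts S y. insert (rk z) (elts S (rk z)))" and v: "v \<in> elts S w"
          then obtain z where z: "z \<in> elts S y" "w = rk z \<or> w \<in> elts S (rk z)" by blast
          then have "v \<in> elts S (rk z)" using ordinal_trans[OF o[OF z(1)] _ v] v by blast
          then show "v \<in> (\<Union>z\<in>elts S y. insert (rk z) (elts S (rk z)))" using z(1) by blast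
        qed
        show "ordinal S w" if "w \<in> elts S (h y)" for w
          using that o ordinal_elt unfolding hy by blast
      qed
      then show ?thesis using True hy eq by simp
    next
      case False
      then obtain \<alpha> where "has_rank S u \<alpha>" using T[OF u] by blast
      then show ?thesis using rke eq hrk by simp
    qed
  qed
  then have "has_rank S y (h y)" unfolding has_rank_def
    using internal_funI[OF isset_elts[OF trcl_single_U[OF y]] hd] trcl_single_self[OF y]
      trcl_single_trans[OF y] trcl_single_U[OF y]
    by (intro bexI[of _ ?T] exI[of _ h]) (auto simp: transitive_set_def)
  then show False using unr by blast
qed

lemma ordinal_has_rank: "ordinal S \<alpha> \<Longrightarrow> \<exists>\<beta>. has_rank S \<alpha> \<beta>"
proof (rule ccontr)
  assume \<alpha>: "ordinal S \<alpha>" and n: "\<nexists>\<beta>. has_rank S \<alpha> \<beta>"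
  let ?B = "{\<alpha>\<in>U. ordinal S \<alpha> \<and> \<not> (\<exists>\<beta>\<in>U. has_rank S \<alpha> \<beta>)}"
  have "dc (\<lambda>e. ?B)" by (intro dfi)
  then obtain m where m: "m \<in> ?B" "?B \<inter> elts S m = {}"
    using ordinal_least[of ?B] \<alpha> ordinalU n by blast
  have "\<exists>\<beta>. has_rank S z \<beta>" if "z \<in> elts S m" for z
    using m that ordinal_elt[of m z] eltsU[OF that] by blast
  then have "\<exists>\<beta>. has_rank S m \<beta>" using has_rank_if_elts m by blast
  then show False using m has_rank_ordinal ordinalU by blast
qed

lemma has_rank_setof:
  "isset S A \<Longrightarrow> (\<And>x. x \<in> A \<Longrightarrow> \<exists>\<alpha>. has_rank S x \<alpha>) \<Longrightarrow> \<exists>\<alpha>. has_rank S (setof S A) \<alpha>"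
  by (rule has_rank_if_elts) (auto simp: setof_U elts_setof)

lemma has_rank_pair:
  assumes "\<exists>\<alpha>. has_rank S a \<alpha>" "\<exists>\<alpha>. has_rank S b \<alpha>"
  shows "\<exists>\<alpha>. has_rank S (pair S a b) \<alpha>"
proof -
  have U: "a \<in> U" "b \<in> U" using assms has_rankU by blast+
  have "\<exists>\<alpha>. has_rank S (setof S {a, b}) \<alpha>" "\<exists>\<alpha>. has_rank S (setof S {a}) \<alpha>"
    by (rule has_rank_setof[OF isset_pair[OF U]], use assms in blast)
      (rule has_rank_setof[OF isset_single[OF U(1)]], use assms in blast)
  then show ?thesis unfolding pair_def
    by (intro has_rank_setof) (auto simp: isset_pair isset_single setof_U U)
qed

text \<open>These are the levels of the well-founded hierarchy. A set of rank \<beta> is a subset of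
  the level of \<beta>, so the level of a least counterexample is carved out of a union of power
  sets of earlier levels.\<close>

lemma isset_rank_below: "ordinal S \<alpha> \<Longrightarrow> isset S {x\<in>U. \<exists>\<beta>\<in>elts S \<alpha>. has_rank S x \<beta>}"
proof (rule ccontr)
  define W where "W \<alpha> = {x\<in>U. \<exists>\<beta>\<in>elts S \<alpha>. has_rank S x \<beta>}" for \<alpha>
  have Wd: "dc (\<lambda>e. W (s e))" if "df s" for s
    unfolding W_def by (intro dfi df_ren[OF that])
  assume \<alpha>: "ordinal S \<alpha>" and n: "\<not> isset S {x\<in>U. \<exists>\<beta>\<in>elts S \<alpha>. has_rank S x \<beta>}"
  let ?B = "{\<alpha>\<in>U. ordinal S \<alpha> \<and> \<not> (\<exists>w\<in>U. elts S w = W \<alpha>)}"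
  have "dc (\<lambda>e. ?B)" by (intro dfi Wd)
  moreover have "\<alpha> \<in> ?B" using \<alpha> n ordinalU[OF \<alpha>] unfolding W_def isset_def by blast
  ultimately obtain m where m: "m \<in> ?B" "?B \<inter> elts S m = {}"
    using ordinal_least[of ?B] by blast
  have mU: "m \<in> U" using m by blast
  have iW: "isset S (W \<beta>)" if "\<beta> \<in> elts S m" for \<beta>
    using m that ordinal_elt[of m \<beta>] eltsU[OF that] unfolding isset_def by blast
  have "isset S (\<Union>\<beta>\<in>elts S m. {z\<in>U. elts S z \<subseteq> W \<beta>})"
    by (rule isset_UN'[OF isset_elts[OF mU]]) (intro dfi Wd, intro isset_pow iW)
  moreover have "dc (\<lambda>e. W m)" by (intro Wd df_const mU)
  moreover have "W m \<subseteq> (\<Union>\<beta>\<in>elts S m. {z\<in>U. elts S z \<subseteq> W \<beta>})"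
  proof
    fix x assume "x \<in> W m"
    then obtain \<beta> where \<beta>: "x \<in> U" "\<beta> \<in> elts S m" "has_rank S x \<beta>" unfolding W_def by blast
    have "elts S x \<subseteq> W \<beta>" using has_rank_elt[OF \<beta>(3)] eltsU unfolding W_def by blast
    then show "x \<in> (\<Union>\<beta>\<in>elts S m. {z\<in>U. elts S z \<subseteq> W \<beta>})" using \<beta> by blast
  qed
  ultimately have "isset S (W m)" by (rule isset_sub)
  then show False using m unfolding isset_def by blast
qed

text \<open>Scott's trick: \<open>C\<close> may be a proper class, but its members of minimal rank
  share one rank and so lie in a level that is a set. The second claim starts from a member that has
  a rank.\<close>

lemma isset_min_rank:
  assumes "dc (\<lambda>e. C)"
  shows "isset S {x\<in>C. \<exists>\<alpha>. has_rank S x \<alpha> \<and> (\<forall>y\<in>C. \<forall>\<beta>. has_rank S y \<beta> \<longrightarrow> \<beta> \<notin> elts S \<alpha>)}" (is "isset S ?M")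
    and "x \<in> C \<Longrightarrow> has_rank S x \<gamma> \<Longrightarrow> {x\<in>C. \<exists>\<alpha>. has_rank S x \<alpha> \<and> (\<forall>y\<in>C. \<forall>\<beta>. has_rank S y \<beta> \<longrightarrow> \<beta> \<notin> elts S \<alpha>)} \<noteq> {}"
proof -
  have CU: "C \<subseteq> U" using assms U_nonempty unfolding dc_def env_def by auto
  have eq: "?M = {x\<in>C. \<exists>\<alpha>\<in>U. has_rank S x \<alpha> \<and> (\<forall>y\<in>C. \<forall>\<beta>\<in>U. has_rank S y \<beta> \<longrightarrow> \<beta> \<notin> elts S \<alpha>)}"
    using has_rank_ordinal ordinalU by blast
  have d: "dc (\<lambda>e. ?M)" unfolding eq by (intro dfi assms)
  show "isset S ?M"
  proof (cases "?M = {}")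
    case False
    then obtain x \<alpha> where x: "x \<in> C" "has_rank S x \<alpha>" "\<forall>y\<in>C. \<forall>\<beta>. has_rank S y \<beta> \<longrightarrow> \<beta> \<notin> elts S \<alpha>" by blast
    note o = has_rank_ordinal[OF x(2)]
    have "?M \<subseteq> {x\<in>U. \<exists>\<beta>\<in>elts S (succ S \<alpha>). has_rank S x \<beta>}"
    proof
      fix y assume "y \<in> ?M"
      then obtain \<beta> where y: "y \<in> C" "has_rank S y \<beta>" "\<forall>y\<in>C. \<forall>\<gamma>. has_rank S y \<gamma> \<longrightarrow> \<gamma> \<notin> elts S \<beta>" by blast
      have "\<alpha> = \<beta>" using ordinal_linear[OF o has_rank_ordinal[OF y(2)]] x y by blast
      then show "y \<in> {x\<in>U. \<exists>\<beta>\<in>elts S (succ S \<alpha>). has_rank S x \<beta>}"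
        using y CU ordinalU[OF o] by auto
    qed
    then show ?thesis using isset_sub[OF isset_rank_below[OF ordinal_succ[OF o]] d] by blast
  qed (simp only: isset_empty)
  show "?M \<noteq> {}" if x: "x \<in> C" "has_rank S x \<gamma>" for x \<gamma>
  proof -
    let ?R = "{\<alpha>\<in>U. \<exists>x\<in>C. has_rank S x \<alpha>}"
    have "dc (\<lambda>e. ?R)" by (intro dfi dc_ren[OF assms] assms)
    then obtain m where "m \<in> ?R" "?R \<inter> elts S m = {}"
      using ordinal_least[of ?R] has_rank_ordinal x ordinalU by blast
    then show ?thesis using eltsU by blast
  qed
qed

section \<open>Choice and well-ordering\<close>

text \<open>The axiom selects from disjoint families only, so each \<open>A\<close> is replaced by
  \<open>F A\<close>, the set of pairs with first component \<open>A\<close> and second component in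
  \<open>A\<close>.\<close>

lemma choice_function:
  assumes X: "isset S X" and ne: "\<And>A. A \<in> X \<Longrightarrow> elts S A \<noteq> {}"
  shows "\<exists>c. df (\<lambda>e. c (e 0)) \<and> (\<forall>A\<in>X. c A \<in> elts S A)"
proof -
  note XU = subsetD[OF isset_subset_U[OF X]]
  define F where "F A = setof S (pair S A ` elts S A)" for A
  have iF: "isset S (pair S A ` elts S A)" if "A \<in> U" for A
    by (rule isset_image[OF isset_elts[OF that], of "pair S A"]) (intro dfi df_const that)
  have Fd: "df (\<lambda>e. F (e 0))" unfolding F_def by (intro dfi iF) (simp add: envD)
  have eF: "elts S (F A) = pair S A ` elts S A" if "A \<in> U" for A
    by (simp add: F_def elts_setof iF that)
  obtain Y where Y: "Y \<in> U" "elts S Y = F ` X" using isset_image[OF X Fd] by (auto simp: isset_def)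
  have "\<forall>x\<in>elts S Y. elts S x \<noteq> {}" using ne eF XU by (simp add: Y)
  moreover have "elts S (F A) \<inter> elts S (F B) = {}" if "A \<in> X" "B \<in> X" "F A \<noteq> F B" for A B
  proof -
    have "A \<noteq> B" using that by blast
    then show ?thesis using that eF XU eltsU by auto
  qed
  then have "\<forall>x\<in>elts S Y. \<forall>y\<in>elts S Y. x \<noteq> y \<longrightarrow> elts S x \<inter> elts S y = {}" by (simp add: Y)
  ultimately obtain C where C: "C \<in> U" "\<forall>x\<in>elts S Y. \<exists>z. elts S C \<inter> elts S x = {z}"
    using zfc Y(1) unfolding ZFC_minus_def choice_ax_def by blast
  \<comment> \<open>The selecting set \<open>C\<close> may contain further pairs that would spoil
    uniqueness for \<open>ap\<close>; the intersection removes them.\<close>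
  have "isset S (elts S C \<inter> (\<Union>A\<in>X. elts S (F A)))"
    by (rule isset_sub[OF isset_elts[OF C(1)]])
      (intro dfi df_const C dc_const[OF isset_UN[OF X Fd]], blast)
  then obtain D where D: "D \<in> U" "elts S D = elts S C \<inter> (\<Union>A\<in>X. elts S (F A))"
    unfolding isset_def by blast
  have "ap D A \<in> elts S A" if A: "A \<in> X" for A
  proof -
    obtain z where z: "elts S C \<inter> elts S (F A) = {z}" using C A by (auto simp: Y)
    then obtain y where y: "y \<in> elts S A" "z = pair S A y" using eF[OF XU[OF A]] by blast
    have "ap D A = y"
    proof (rule ap_eq)
      show "pair S A y \<in> elts S D" using z y(2) A unfolding D by blast
      fix w assume w: "w \<in> U" "pair S A w \<in> elts S D"
      then obtain B where B: "B \<in> X" "pair S A w \<in> elts S (F B)" unfolding D by blast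
      then have "A = B" using eF[OF XU[OF B(1)]] XU[OF A] XU[OF B(1)] w eltsU by auto
      then have "pair S A w = z" using z w B unfolding D by blast
      then show "w = y" using y XU[OF A] w eltsU by simp
    qed (use y eltsU in blast)
    then show ?thesis using y by simp
  qed
  then show ?thesis using df_ap_const[OF D(1)] by (intro exI[of _ "ap D"]) blast
qed

text \<open>
  Zermelo's proof: the least family of subsets of \<open>V\<close> that is closed under unions and under adding
  one chosen element is a chain, and each \<open>v\<close> is the chosen element of the complement of exactly one member.
\<close>

lemma well_ordering:
  assumes V: "isset S V"
  shows "\<exists>I. df (\<lambda>e. I (e 0)) \<and> inj_on I V \<and>
    (\<forall>u\<in>V. \<forall>v\<in>V. elts S (I u) \<subseteq> elts S (I v) \<or> elts S (I v) \<subseteq> elts S (I u)) \<and>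
    (\<forall>B. isset S B \<and> B \<subseteq> V \<and> B \<noteq> {} \<longrightarrow> (\<exists>m\<in>B. \<forall>y\<in>B. \<not> elts S (I y) \<subset> elts S (I m)))"
proof -
  let ?N = "{A\<in>{A\<in>U. elts S A \<subseteq> V}. elts S A \<noteq> {}}"
  have "isset S ?N"
    by (rule isset_sep[OF isset_pow[OF V]]) (intro dfi)
  then obtain c where cd: "df (\<lambda>e. c (e 0))" and "\<forall>A\<in>?N. c A \<in> elts S A"
    using choice_function[of "?N"] by blast
  then have c: "c A \<in> elts S A" if "A \<in> U" "elts S A \<subseteq> V" "elts S A \<noteq> {}" for A using that by blast
  note cd' = df_app1[of c, OF cd]
  note Vd = dc_const[OF V]
  have iD: "isset S (V - elts S A)" if "A \<in> U" for A
    by (rule isset_sub[OF V]) (intro dfi Vd df_const that, blast)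
  define d where "d A = c (setof S (V - elts S A))" for A
  have dd: "df (\<lambda>e. d (s e))" if "df s" for s unfolding d_def
    by (intro cd' dfi Vd that iD dfU[OF that])
  have dV: "d A \<in> V - elts S A" if "A \<in> U" "V - elts S A \<noteq> {}" for A
    using c[of "setof S (V - elts S A)"] that iD[OF that(1)] by (auto simp: d_def setof_U elts_setof)
  \<comment> \<open>The successor of \<open>A\<close> adjoins the chosen element of the complement;
    once \<open>V\<close> is exhausted, \<open>A\<close> stays fixed.\<close>
  define s where "s A = (if V - elts S A = {} then A else setof S (insert (d A) (elts S A)))" for A
  have id: "isset S (insert (d A) (elts S A))" if "A \<in> U" for A
    using that df_funU[OF dd[OF df_var]] by (intro isset_insert isset_elts)
  have sd: "df (\<lambda>e. s (t e))" if "df t" for t unfolding s_def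
    by (intro dfi Vd that dd id dfU[OF that])
  have sU: "s A \<in> U" if "A \<in> U" for A using that id by (simp add: s_def setof_U)
  have s_full: "s A = A" if "V - elts S A = {}" for A using that by (simp add: s_def)
  have es: "elts S (s A) = insert (d A) (elts S A)" if "A \<in> U" "V - elts S A \<noteq> {}" for A
    using that id by (simp add: s_def elts_setof)
  have s_sup: "elts S A \<subseteq> elts S (s A)" if "A \<in> U" for A
    using es[OF that] s_full[of A] by (cases "V - elts S A = {}") auto
  have s_strict: "\<not> elts S (s A) \<subseteq> elts S A" if "A \<in> U" "V - elts S A \<noteq> {}" for A
    using es[OF that] dV[OF that] by auto
  define un where "un C = setof S (\<Union>A\<in>elts S C. elts S A)" for C
  have iun: "isset S (\<Union>A\<in>elts S C. elts S A)" if "C \<in> U" for C by (intro isset_Union isset_elts that)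
  have und: "df (\<lambda>e. un (t e))" if "df t" for t unfolding un_def
    by (intro dfi that iun dfU[OF that])
  have unU: "un C \<in> U" if "C \<in> U" for C using iun[OF that] by (simp add: un_def setof_U)
  have eun: "elts S (un C) = (\<Union>A\<in>elts S C. elts S A)" if "C \<in> U" for C
    using iun[OF that] by (simp add: un_def elts_setof)
  let ?P = "{A\<in>U. elts S A \<subseteq> V}"
  define tower where "tower K \<longleftrightarrow> elts S K \<subseteq> ?P \<and> (\<forall>A\<in>elts S K. s A \<in> elts S K) \<and>
    (\<forall>C\<in>U. elts S C \<subseteq> elts S K \<longrightarrow> un C \<in> elts S K)" for K
  have td: "dfn (\<lambda>e. tower (t e))" if "df t" for t
    by (rule dfn_rel1[of tower, OF _ that]) (unfold tower_def, intro dfi Vd sd und)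
  \<comment> \<open>The least tower. It is a set by separation from the power set of
    \<open>V\<close>, and \<open>ind\<close> below is its induction principle.\<close>
  define W where "W = {A\<in>?P. \<forall>K\<in>U. tower K \<longrightarrow> A \<in> elts S K}"
  have iW: "isset S W" unfolding W_def by (rule isset_sep[OF isset_pow[OF V]]) (intro dfi td)
  note Wd = dc_const[OF iW]
  have WP: "A \<in> U" "elts S A \<subseteq> V" if "A \<in> W" for A using that by (auto simp: W_def)
  have sP: "elts S (s A) \<subseteq> V" if "A \<in> U" "elts S A \<subseteq> V" for A
    using es[OF that(1)] dV[OF that(1)] s_full[of A] that by (cases "V - elts S A = {}") auto
  have sW: "s A \<in> W" if "A \<in> W" for A
    using that sU[OF WP(1)[OF that]] sP[OF WP[OF that]] unfolding W_def tower_def by blast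
  have unW: "un C \<in> W" if "C \<in> U" "elts S C \<subseteq> W" for C
  proof -
    have "elts S (un C) \<subseteq> V" using that WP(2) unfolding eun[OF that(1)] by blast
    moreover have "un C \<in> elts S K" if "K \<in> U" "tower K" for K
      using that \<open>C \<in> U\<close> \<open>elts S C \<subseteq> W\<close> unfolding tower_def W_def by blast
    ultimately show ?thesis using unU[OF that(1)] unfolding W_def by blast
  qed
  have ind: "Q A" if A: "A \<in> W" and Q: "dfn (\<lambda>e. Q (e 0))" "\<And>A. A \<in> W \<Longrightarrow> Q A \<Longrightarrow> Q (s A)"
    "\<And>C. C \<in> U \<Longrightarrow> elts S C \<subseteq> W \<Longrightarrow> (\<And>A. A \<in> elts S C \<Longrightarrow> Q A) \<Longrightarrow> Q (un C)" for A Q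
  proof -
    obtain K where K: "K \<in> U" "elts S K = {A\<in>W. Q A}"
      using isset_sep[OF iW Q(1)] by (auto simp: isset_def)
    have "tower K" unfolding tower_def K
    proof (intro conjI ballI impI)
      show "{A \<in> W. Q A} \<subseteq> ?P" using WP by blast
      show "s A \<in> {A \<in> W. Q A}" if "A \<in> {A \<in> W. Q A}" for A using that sW Q(2) by blast
      show "un C \<in> {A \<in> W. Q A}" if "C \<in> U" "elts S C \<subseteq> {A \<in> W. Q A}" for C
        using that unW[of C] Q(3)[of C] by blast
    qed
    then have "A \<in> elts S K" using A K(1) unfolding W_def by blast
    then show ?thesis using K by blast
  qed
  \<comment> \<open>The extreme points of the Bourbaki-Witt argument: \<open>step1\<close> compares
    an extreme point with every member of \<open>W\<close>, and induction then shows that all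
    members are extreme.\<close>
  define extr where "extr B \<longleftrightarrow> (\<forall>A\<in>W. elts S A \<subseteq> elts S B \<and> elts S A \<noteq> elts S B \<longrightarrow> elts S (s A) \<subseteq> elts S B)" for B
  have step1: "elts S A \<subseteq> elts S B \<or> elts S (s B) \<subseteq> elts S A" if "B \<in> W" "extr B" "A \<in> W" for A B
  proof -
    have BU: "B \<in> U" using WP that by blast
    show ?thesis
    proof (rule ind[OF that(3)])
      show "dfn (\<lambda>e. elts S (e 0) \<subseteq> elts S B \<or> elts S (s B) \<subseteq> elts S (e 0))"
        by (intro dfi df_const BU sU)
      show "elts S (s A) \<subseteq> elts S B \<or> elts S (s B) \<subseteq> elts S (s A)"
        if A: "A \<in> W" "elts S A \<subseteq> elts S B \<or> elts S (s B) \<subseteq> elts S A" for A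
      proof (cases "elts S A = elts S B")
        case True
        then have "A = B" using elts_eqD WP A BU by blast
        then show ?thesis by simp
      next
        case False
        then show ?thesis using A \<open>extr B\<close> s_sup[OF WP(1)[OF A(1)]] unfolding extr_def by blast
      qed
      show "elts S (un C) \<subseteq> elts S B \<or> elts S (s B) \<subseteq> elts S (un C)"
        if "C \<in> U" "elts S C \<subseteq> W" "\<And>A. A \<in> elts S C \<Longrightarrow> elts S A \<subseteq> elts S B \<or> elts S (s B) \<subseteq> elts S A" for C
        unfolding eun[OF that(1)] using that(3) by blast
    qed
  qed
  have extr: "extr B" if "B \<in> W" for B
  proof (rule ind[OF that])
    show "dfn (\<lambda>e. extr (e 0))" unfolding extr_def by (intro dfi Wd sd)
    show "extr (s B)" if B: "B \<in> W" "extr B" for B unfolding extr_def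
    proof (intro ballI impI)
      fix A assume A: "A \<in> W" "elts S A \<subseteq> elts S (s B) \<and> elts S A \<noteq> elts S (s B)"
      then have AB: "elts S A \<subseteq> elts S B" using step1[OF B A(1)] by blast
      show "elts S (s A) \<subseteq> elts S (s B)"
      proof (cases "elts S A = elts S B")
        case True
        then have "A = B" using elts_eqD WP A B by blast
        then show ?thesis by simp
      next
        case False
        then have "elts S (s A) \<subseteq> elts S B" using B(2) A(1) AB unfolding extr_def by blast
        then show ?thesis using s_sup[OF WP(1)[OF B(1)]] by blast
      qed
    qed
    show "extr (un C)" if C: "C \<in> U" "elts S C \<subseteq> W" "\<And>B. B \<in> elts S C \<Longrightarrow> extr B" for C unfolding extr_def
    proof (intro ballI impI)
      fix A assume A: "A \<in> W" "elts S A \<subseteq> elts S (un C) \<and> elts S A \<noteq> elts S (un C)"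
      have st: "elts S A' \<subseteq> elts S B \<or> elts S (s B) \<subseteq> elts S A'" if "B \<in> elts S C" "A' \<in> W" for B A'
        using step1 C that by blast
      have "\<not> elts S (un C) \<subseteq> elts S A" using A by blast
      then obtain B where B: "B \<in> elts S C" "\<not> elts S B \<subseteq> elts S A" unfolding eun[OF C(1)] by blast
      have BW: "B \<in> W" using B C by blast
      have "\<not> elts S (s B) \<subseteq> elts S A" using B s_sup[OF WP(1)[OF BW]] by blast
      then have AB: "elts S A \<subseteq> elts S B" using st[OF B(1) A(1)] by blast
      then have "elts S (s A) \<subseteq> elts S B" using C(3)[OF B(1)] A(1) B(2) unfolding extr_def by blast
      then show "elts S (s A) \<subseteq> elts S (un C)" using B(1) unfolding eun[OF C(1)] by blast
    qed
  qed
  have cmp: "elts S A \<subseteq> elts S B \<or> elts S (s B) \<subseteq> elts S A" if "A \<in> W" "B \<in> W" for A B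
    using step1[OF that(2) extr[OF that(2)] that(1)] .
  \<comment> \<open>The largest member of \<open>W\<close> that omits \<open>v\<close>. Its
    successor must contain \<open>v\<close>, and \<open>s\<close> adds only one element, so
    \<open>d\<close> inverts \<open>I\<close>.\<close>
  define I where "I v = un (setof S {A\<in>W. v \<notin> elts S A})" for v
  have iI: "isset S {A\<in>W. v \<notin> elts S A}" if "v \<in> U" for v
    by (rule isset_sep[OF iW]) (intro dfi df_const that)
  have Id: "df (\<lambda>e. I (e 0))" unfolding I_def by (intro und dfi Wd iI) (simp add: envD)
  have VU: "v \<in> U" if "v \<in> V" for v using isset_subset_U[OF V] that by blast
  have IW: "I v \<in> W" if "v \<in> V" for v
    unfolding I_def by (rule unW) (simp_all add: setof_U elts_setof iI VU[OF that])
  have eI: "elts S (I v) = \<Union> (elts S ` {A\<in>W. v \<notin> elts S A})" if "v \<in> V" for v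
    unfolding I_def by (subst eun) (simp_all add: setof_U elts_setof iI VU[OF that])
  have nI: "v \<notin> elts S (I v)" if "v \<in> V" for v unfolding eI[OF that] by blast
  have dI: "d (I v) = v" if v: "v \<in> V" for v
  proof -
    have ne: "V - elts S (I v) \<noteq> {}" using v nI[OF v] by blast
    note IU = WP(1)[OF IW[OF v]]
    have "v \<in> elts S (s (I v))"
    proof (rule ccontr)
      assume "v \<notin> elts S (s (I v))"
      then have "elts S (s (I v)) \<subseteq> elts S (I v)" using sW[OF IW[OF v]] unfolding eI[OF v] by blast
      then show False using s_strict[OF IU ne] by blast
    qed
    then show ?thesis using es[OF IU ne] nI[OF v] by auto
  qed
  have "\<exists>m\<in>B. \<forall>y\<in>B. \<not> elts S (I y) \<subset> elts S (I m)" if B: "isset S B" "B \<subseteq> V" "B \<noteq> {}" for B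
  proof -
    let ?C = "{A\<in>W. elts S A \<inter> B = {}}"
    have iC: "isset S ?C" by (rule isset_sep[OF iW]) (intro dfi dc_const B)
    \<comment> \<open>The largest member of \<open>W\<close> disjoint from \<open>B\<close>. Its
      successor meets \<open>B\<close>, so \<open>d A\<close> belongs to \<open>B\<close>. Every
      \<open>I y\<close> with \<open>y\<close> in \<open>B\<close> includes \<open>A\<close>, while
      \<open>I (d A)\<close> is included in \<open>A\<close>, which makes \<open>d A\<close>
      minimal.\<close>
    define A where "A = un (setof S ?C)"
    have AW: "A \<in> W" unfolding A_def by (rule unW) (simp_all add: setof_U elts_setof iC)
    have eA: "elts S A = \<Union> (elts S ` ?C)" unfolding A_def
      by (subst eun) (simp_all add: setof_U elts_setof iC)
    then have AB: "elts S A \<inter> B = {}" by blast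
    then have ne: "V - elts S A \<noteq> {}" using B by blast
    note AU = WP(1)[OF AW]
    have "elts S (s A) \<inter> B \<noteq> {}"
    proof
      assume "elts S (s A) \<inter> B = {}"
      then have "elts S (s A) \<subseteq> elts S A" using sW[OF AW] unfolding eA by blast
      then show False using s_strict[OF AU ne] by blast
    qed
    then have b: "d A \<in> B" using AB unfolding es[OF AU ne] by auto
    have le: "elts S A \<subseteq> elts S (I y)" if "y \<in> B" for y
      using that AB AW B(2) eI[of y] by blast
    have "\<not> elts S (s A) \<subseteq> elts S (I (d A))" using nI[of "d A"] b B(2) unfolding es[OF AU ne] by auto
    then have "elts S (I (d A)) \<subseteq> elts S A" using cmp[OF IW AW, of "d A"] b B(2) by blast
    then show ?thesis using b le by blast
  qed
  moreover have "elts S (I u) \<subseteq> elts S (I v) \<or> elts S (I v) \<subseteq> elts S (I u)" if "u \<in> V" "v \<in> V" for u v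
    using cmp[OF IW[OF that(1)] IW[OF that(2)]] s_sup[OF WP(1)[OF IW[OF that(2)]]] by blast
  moreover have "inj_on I V" using dI by (rule inj_on_inverseI)
  ultimately show ?thesis using Id by blast
qed

text \<open>Mostowski collapse of the well-ordering of \<open>V\<close> by strict inclusion of the
  sets \<open>I v\<close>: each point is sent to the set of images of its predecessors.\<close>

lemma inject_into_ordinals:
  assumes V: "isset S V"
  shows "\<exists>h. df (\<lambda>e. h (e 0)) \<and> inj_on h V \<and> (\<forall>v\<in>V. ordinal S (h v))"
proof -
  obtain I where Id: "df (\<lambda>e. I (e 0))" and inj: "inj_on I V"
    and lin: "\<forall>u\<in>V. \<forall>v\<in>V. elts S (I u) \<subseteq> elts S (I v) \<or> elts S (I v) \<subseteq> elts S (I u)"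
    and wf0: "\<forall>B. isset S B \<and> B \<subseteq> V \<and> B \<noteq> {} \<longrightarrow> (\<exists>m\<in>B. \<forall>y\<in>B. \<not> elts S (I y) \<subset> elts S (I m))"
    using well_ordering[OF V] by (elim exE conjE)
  have wf: "\<exists>m\<in>B. \<forall>y\<in>B. \<not> elts S (I y) \<subset> elts S (I m)" if "isset S B" "B \<subseteq> V" "B \<noteq> {}" for B
    using wf0 that by simp
  note Id' = df_app1[of I, OF Id]
  define r where "r u v \<longleftrightarrow> elts S (I u) \<subset> elts S (I v)" for u v
  have rd: "dfn (\<lambda>e. r (e 0) (e 1))" unfolding r_def psubset_eq by (intro dfi Id')
  have "\<exists>g. df (\<lambda>e. g (e 0)) \<and> (\<forall>x\<in>V. g x = setof S (g ` {y\<in>V. r y x}))"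
    by (rule wf_recursion[OF V rd df_var]) (use wf in \<open>auto simp: r_def\<close>)
  then obtain g where gd: "df (\<lambda>e. g (e 0))" and g: "\<And>x. x \<in> V \<Longrightarrow> g x = setof S (g ` {y\<in>V. r y x})" by blast
  note VU = subsetD[OF isset_subset_U[OF V]]
  have eg: "elts S (g x) = g ` {y\<in>V. r y x}" if "x \<in> V" for x
  proof -
    have "isset S {y\<in>V. r y x}"
      by (rule isset_sep[OF V]) (intro dfn_rel2[of r, OF rd] df_var df_const VU that)
    from isset_image[OF this gd] show ?thesis using g[OF that] by (simp add: elts_setof)
  qed
  have rt: "r x z" if "r x y" "r y z" for x y z using that unfolding r_def by blast
  have o: "ordinal S (g v)" if v: "v \<in> V" for v
  proof (rule ccontr)
    assume n: "\<not> ordinal S (g v)"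
    let ?B = "{v\<in>V. \<not> ordinal S (g v)}"
    have "isset S ?B" by (rule isset_sep[OF V]) (intro dfi df_app1[of g, OF gd])
    then obtain m where m: "m \<in> ?B" "\<forall>y\<in>?B. \<not> r y m"
      using wf[of ?B] n v unfolding r_def by blast
    then have mV: "m \<in> V" by blast
    have "ordinal S (g m)"
    proof (rule ordinalI)
      show "g m \<in> U" using df_funU[OF gd VU[OF mV]] .
      show "transitive_set S (g m)"
        unfolding transitive_set_def eg[OF mV] using eg rt by blast
      show "ordinal S y" if "y \<in> elts S (g m)" for y using that m unfolding eg[OF mV] by blast
    qed
    then show False using m by blast
  qed
  have "inj_on g V"
  proof (rule inj_onI, rule ccontr)
    fix u v assume uv: "u \<in> V" "v \<in> V" "g u = g v" "u \<noteq> v"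
    have "I u \<noteq> I v" using inj uv by (auto dest: inj_onD)
    then have "elts S (I u) \<noteq> elts S (I v)"
      using elts_eqD df_funU[OF Id] VU uv by blast
    then have "r u v \<or> r v u" unfolding r_def using lin uv(1,2) by blast
    then have "g u \<in> elts S (g v) \<or> g v \<in> elts S (g u)" using eg uv by blast
    then show False using ordinal_irrefl o uv by metis
  qed
  then show ?thesis using gd o by blast
qed

end

section \<open>Graphs\<close>

definition prs :: "'a estruct \<Rightarrow> ('a \<times> 'a) set \<Rightarrow> 'a set" where
  "prs S R = (\<lambda>(a, b). pair S a b) ` R"

definition isset2 :: "'a estruct \<Rightarrow> ('a \<times> 'a) set \<Rightarrow> bool" where
  "isset2 S R \<longleftrightarrow> R \<subseteq> univ S \<times> univ S \<and> isset S (prs S R)"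

text \<open>Reachability by paths that are finite in the sense of \<open>S\<close>, described by the sets closed under \<open>R\<close>.\<close>

definition rch :: "'a estruct \<Rightarrow> ('a \<times> 'a) set \<Rightarrow> 'a \<Rightarrow> 'a \<Rightarrow> bool" where
  "rch S R a b \<longleftrightarrow> (\<forall>B. isset S B \<and> a \<in> B \<and> (\<forall>u v. (u, v) \<in> R \<and> u \<in> B \<longrightarrow> v \<in> B) \<longrightarrow> b \<in> B)"

text \<open>Conditions on external data under which \<open>encode\<close> yields a graph. In this
  form graphs of two structures can be compared although their ordered pairs are different
  elements.\<close>

definition gr :: "'a estruct \<Rightarrow> 'a set \<Rightarrow> ('a \<times> 'a) set \<Rightarrow> 'a \<Rightarrow> bool" where
  "gr S W R p \<longleftrightarrow> isset S W \<and> isset2 S R \<and> R \<subseteq> W \<times> W \<and> p \<in> W \<and> (\<forall>a\<in>W. rch S R p a)"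

lemma rch_refl: "rch S R a a"
  by (simp add: rch_def)

lemma rch_trans: "rch S R a b \<Longrightarrow> rch S R b c \<Longrightarrow> rch S R a c"
  unfolding rch_def by blast

lemma rch_edge: "(a, b) \<in> R \<Longrightarrow> rch S R a b"
  unfolding rch_def by blast

lemma rch_mono: "R \<subseteq> R' \<Longrightarrow> rch S R a b \<Longrightarrow> rch S R' a b"
  unfolding rch_def by blast

context zfc
begin

section \<open>Sets of pairs and reachability in a structure\<close>

lemma isset2D: "isset2 S R \<Longrightarrow> (a, b) \<in> R \<Longrightarrow> a \<in> U \<and> b \<in> U"
  by (auto simp: isset2_def)

lemma in_prs:
  assumes "isset2 S R" "a \<in> U" "b \<in> U" shows "pair S a b \<in> prs S R \<longleftrightarrow> (a, b) \<in> R"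
proof
  assume "pair S a b \<in> prs S R"
  then obtain c d where cd: "(c, d) \<in> R" "pair S a b = pair S c d" unfolding prs_def by auto
  then show "(a, b) \<in> R" using isset2D[OF assms(1) cd(1)] assms by simp
qed (force simp: prs_def)

lemma dfn_isset2:
  assumes "isset2 S R" "df s" "df t" shows "dfn (\<lambda>e. (s e, t e) \<in> R)"
proof (rule dfn_cong)
  show "dfn (\<lambda>e. pair S (s e) (t e) \<in> prs S R)"
    using assms(1) by (intro dfi dc_const assms(2,3)) (simp add: isset2_def)
qed (use in_prs[OF assms(1)] assms dfU in blast)

lemma isset_prod:
  assumes "isset S A" "isset S B" shows "isset S (prs S (A \<times> B))"
proof -
  have "isset S (\<Union>a\<in>A. pair S a ` B)"
  proof (rule isset_UN'[OF assms(1)])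
    show "dc (\<lambda>e. pair S (e 0) ` B)" by (intro dfi dc_const assms)
    show "isset S (pair S a ` B)" if "a \<in> A" for a
      by (rule isset_image[OF assms(2), of "pair S a"])
        (intro dfi df_const subsetD[OF isset_subset_U[OF assms(1)]] that)
  qed
  moreover have "(\<Union>a\<in>A. pair S a ` B) = prs S (A \<times> B)" unfolding prs_def by auto
  ultimately show ?thesis by simp
qed

lemma isset2I:
  assumes "isset S A" "isset S B" "R \<subseteq> A \<times> B" "dfn (\<lambda>e. (e 0, e 1) \<in> R)"
  shows "isset2 S R"
proof -
  note U = isset_subset_U[OF assms(1)] isset_subset_U[OF assms(2)]
  have "isset S {x\<in>prs S (A \<times> B). (tfst x, tsnd x) \<in> R}"
    by (rule isset_sep[OF isset_prod[OF assms(1,2)]])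
      (intro dfn_rel2[of "\<lambda>x y. (x, y) \<in> R", OF assms(4)] dfi)
  also have "{x\<in>prs S (A \<times> B). (tfst x, tsnd x) \<in> R} = prs S R"
  proof (intro equalityI subsetI)
    fix x assume "x \<in> {x\<in>prs S (A \<times> B). (tfst x, tsnd x) \<in> R}"
    then have R: "(tfst x, tsnd x) \<in> R" and "x \<in> prs S (A \<times> B)" by simp_all
    then obtain a b where ab: "a \<in> A" "b \<in> B" "x = pair S a b" by (auto simp: prs_def)
    have "a \<in> U" "b \<in> U" using ab U by auto
    then have "(a, b) \<in> R" "x = pair S a b" using R ab by auto
    then show "x \<in> prs S R" unfolding prs_def by force
  next
    fix x assume "x \<in> prs S R"
    then obtain a b where ab: "(a, b) \<in> R" "x = pair S a b" unfolding prs_def by auto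
    then have "a \<in> A" "b \<in> B" using assms(3) by auto
    then have "a \<in> U" "b \<in> U" using U by auto
    then show "x \<in> {x\<in>prs S (A \<times> B). (tfst x, tsnd x) \<in> R}"
      using ab \<open>a \<in> A\<close> \<open>b \<in> B\<close> unfolding prs_def by auto
  qed
  finally show ?thesis using assms(3) U unfolding isset2_def by blast
qed

lemma isset2_sub:
  assumes "isset2 S R" "isset S W" "W' \<subseteq> W" "isset S W'" "R \<subseteq> W \<times> W"
  shows "isset2 S (R \<inter> W' \<times> W')"
proof (rule isset2I[OF assms(4,4)])
  have "dfn (\<lambda>e. (e 0, e 1) \<in> R \<and> e 0 \<in> W' \<and> e 1 \<in> W')"
    by (intro dfi dfn_isset2 assms dc_const)
  then show "dfn (\<lambda>e. (e 0, e 1) \<in> R \<inter> W' \<times> W')" by simp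
qed blast

lemma isset_range2:
  assumes "isset2 S R" shows "isset S (snd ` R)"
proof -
  have "isset S (tsnd ` prs S R)"
    using assms by (intro isset_image df_tsnd df_var) (simp add: isset2_def)
  moreover have "tsnd ` prs S R = snd ` R"
    using isset2D[OF assms] unfolding prs_def image_image by (intro image_cong) auto
  ultimately show ?thesis by simp
qed

lemma isset_domain2:
  assumes "isset2 S R" shows "isset S (fst ` R)"
proof -
  have "isset S (tfst ` prs S R)"
    using assms by (intro isset_image df_tfst df_var) (simp add: isset2_def)
  moreover have "tfst ` prs S R = fst ` R"
    using isset2D[OF assms] unfolding prs_def image_image by (intro image_cong) auto
  ultimately show ?thesis by simp
qed

lemma internal_fun_isset2:
  assumes "A \<subseteq> U" shows "internal_fun S A h \<longleftrightarrow> isset2 S ((\<lambda>a. (a, h a)) ` A)"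
proof -
  have "prs S ((\<lambda>a. (a, h a)) ` A) = (\<lambda>a. pair S a (h a)) ` A" by (auto simp: prs_def image_image)
  then show ?thesis using assms unfolding internal_fun_def isset2_def isset_def by auto
qed

lemma rch_iff:
  assumes "isset2 S R"
  shows "rch S R a b \<longleftrightarrow> (\<forall>B\<in>U. a \<in> elts S B \<and> (\<forall>u\<in>U. \<forall>v\<in>U. (u, v) \<in> R \<and> u \<in> elts S B \<longrightarrow> v \<in> elts S B) \<longrightarrow> b \<in> elts S B)"
  unfolding rch_def isset_def using isset2D[OF assms] by blast

lemma dfn_rch:
  assumes "isset2 S R" "df s" "df t" shows "dfn (\<lambda>e. rch S R (s e) (t e))"
  by (rule dfn_rel2[of "rch S R", OF _ assms(2,3)]) (unfold rch_iff[OF assms(1)], intro dfi dfn_isset2 assms(1))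

text \<open>For definable \<open>P\<close> the points of \<open>W\<close> that satisfy it form a set
  closed under \<open>R\<close>, and reachability puts \<open>b\<close> into every such set
  containing \<open>a\<close>.\<close>

lemma rch_induct:
  assumes "rch S R a b" "isset S W" "R \<subseteq> W \<times> W" "a \<in> W" "dfn (\<lambda>e. P (e 0))"
    and "P a" "\<And>u v. (u, v) \<in> R \<Longrightarrow> u \<in> W \<Longrightarrow> v \<in> W \<Longrightarrow> P u \<Longrightarrow> P v"
  shows "b \<in> W \<and> P b"
proof -
  have "isset S {x\<in>W. P x}" using isset_sep[OF assms(2,5)] .
  moreover have "a \<in> {x\<in>W. P x}" using assms by simp
  moreover have "\<forall>u v. (u, v) \<in> R \<and> u \<in> {x\<in>W. P x} \<longrightarrow> v \<in> {x\<in>W. P x}"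
    using assms(3,7) by blast
  ultimately have "b \<in> {x\<in>W. P x}" using assms(1) unfolding rch_def by blast
  then show ?thesis by simp
qed

lemma rch_hom:
  assumes "rch S R a b" "isset S W" "R \<subseteq> W \<times> W" "a \<in> W" "isset2 S R'" "df (\<lambda>e. h (e 0))"
    and "\<And>u v. (u, v) \<in> R \<Longrightarrow> (h u, h v) \<in> R'"
  shows "rch S R' (h a) (h b)"
proof -
  have "b \<in> W \<and> rch S R' (h a) (h b)"
  proof (rule rch_induct[OF assms(1-4)])
    show "dfn (\<lambda>e. rch S R' (h a) (h (e 0)))"
      by (intro dfn_rch assms(5,6) df_const df_funU[OF assms(6)] subsetD[OF isset_subset_U[OF assms(2)] assms(4)])
  qed (auto intro: rch_refl rch_trans rch_edge assms(7))
  then show ?thesis ..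
qed

text \<open>\<open>W'\<close> is closed under \<open>R\<close>, so nothing reachable from
  \<open>x\<close> lies outside; the proof is an induction on being reachable within
  \<open>W'\<close>.\<close>

lemma rch_restrict:
  assumes "rch S R x y" "isset S W" "R \<subseteq> W \<times> W" "isset2 S R" "x \<in> W'" "W' \<subseteq> W" "isset S W'"
    and "\<And>u v. (u, v) \<in> R \<Longrightarrow> u \<in> W' \<Longrightarrow> v \<in> W'"
  shows "rch S (R \<inter> W' \<times> W') x y"
proof -
  note i2 = isset2_sub[OF assms(4,2,6,7,3)]
  have "y \<in> W \<and> (y \<in> W' \<and> rch S (R \<inter> W' \<times> W') x y)"
  proof (rule rch_induct[OF assms(1-3)])
    show "dfn (\<lambda>e. e 0 \<in> W' \<and> rch S (R \<inter> W' \<times> W') x (e 0))"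
      by (intro dfi dfn_rch i2 dc_const assms df_const subsetD[OF isset_subset_U[OF assms(7)] assms(5)])
    show "v \<in> W' \<and> rch S (R \<inter> W' \<times> W') x v" if "(u, v) \<in> R" "u \<in> W' \<and> rch S (R \<inter> W' \<times> W') x u" for u v
    proof -
      have e: "(u, v) \<in> R \<inter> W' \<times> W'" using that assms(8) by blast
      show ?thesis using that(2) e rch_trans[OF _ rch_edge[OF e]] by blast
    qed
  qed (use assms in \<open>auto intro: rch_refl\<close>)
  then show ?thesis by simp
qed

section \<open>Coding and decoding of graphs\<close>

lemma decode_triple:
  assumes "V \<in> U" "E \<in> U" "p \<in> U"
  shows "decode S (triple S V E p) = (elts S V, {(a, b). a \<in> U \<and> b \<in> U \<and> pair S a b \<in> elts S E}, p)"
proof -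
  have "(THE (V', E', p'). V' \<in> U \<and> E' \<in> U \<and> p' \<in> U \<and> triple S V E p = triple S V' E' p') = (V, E, p)"
    by (rule the_equality) (use assms in auto)
  then show ?thesis unfolding decode_def by simp
qed

lemma encode_eq: "encode S (W, R, p) = triple S (setof S W) (setof S (prs S R)) p"
  by (simp add: encode_def prs_def)

lemma decode_encode:
  assumes "isset S W" "isset2 S R" "p \<in> U"
  shows "decode S (encode S (W, R, p)) = (W, R, p)"
proof -
  have i: "isset S (prs S R)" using assms by (simp add: isset2_def)
  have "{(a, b). a \<in> U \<and> b \<in> U \<and> pair S a b \<in> prs S R} = R"
    using in_prs[OF assms(2)] isset2D[OF assms(2)] by auto
  then show ?thesis
    unfolding encode_eq using assms i by (simp add: decode_triple setof_U elts_setof)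
qed

lemma succ_mem_D:
  assumes n: "n \<in> omega S" and k: "k \<in> U" "succ S k \<in> elts S (succ S n)"
  shows "k \<in> elts S n"
proof -
  have "succ S k = n \<or> succ S k \<in> elts S n" using k omegaU[OF n] by simp
  moreover have "k \<in> elts S (succ S k)" using k by simp
  ultimately show ?thesis using ordinal_trans[OF omega_ordinal[OF n]] by blast
qed

text \<open>A path is followed by internal induction along its indices, which keeps it inside any
  closed set. Conversely the ends of paths from \<open>a\<close> form a closed set. Afterwards
  reachability is handled through closed sets rather than paths.\<close>

lemma reach_iff:
  assumes R: "edges S G = R" "isset2 S R" and a: "a \<in> U"
  shows "reach S G a b \<longleftrightarrow> rch S R a b"
proof
  assume "reach S G a b"
  then obtain n h where n: "n \<in> omega S" and h: "internal_fun S (elts S (succ S n)) h" "h (zero S) = a" "h n = b"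
    and e: "\<And>k. k \<in> elts S n \<Longrightarrow> (h k, h (succ S k)) \<in> R"
    unfolding reach_def R by blast
  note nU = omegaU[OF n]
  obtain f where f: "f \<in> U" "\<And>x. x \<in> elts S (succ S n) \<Longrightarrow> h x = ap f x"
    using internal_funE[OF h(1) elts_subset_U] by blast
  show "rch S R a b" unfolding rch_def
  proof (intro allI impI, elim conjE)
    fix B assume B: "isset S B" "a \<in> B" "\<forall>u v. (u, v) \<in> R \<and> u \<in> B \<longrightarrow> v \<in> B"
    have "k \<in> elts S (succ S n) \<longrightarrow> ap f k \<in> B" if "k \<in> omega S" for k
      using that
    proof (induction rule: omega_induct)
      case dfn show ?case by (intro dfi df_const dc_const f succ_U nU B)
    next
      case zero show ?case using f(2) h(2) B(2) by auto
    next
      case (succ k)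
      show ?case
      proof
        assume s: "succ S k \<in> elts S (succ S n)"
        have k: "k \<in> elts S n" using succ_mem_D[OF n omegaU[OF succ(1)] s] .
        then have "k \<in> elts S (succ S n)" using nU by simp
        then show "ap f (succ S k) \<in> B" using succ(2) e[OF k] f(2) s B(3) by metis
      qed
    qed
    then show "b \<in> B" using n h(3) f(2)[of n] nU by simp
  qed
next
  assume r: "rch S R a b"
  \<comment> \<open>The end of a path from \<open>a\<close> is \<open>a\<close> itself or the target
    of an edge, so this set bounds the collection of ends and separation applies.\<close>
  let ?A = "insert a (snd ` R)"
  have iA: "isset S ?A" by (rule isset_insert[OF a isset_range2[OF R(2)]])
  define P where "P b \<longleftrightarrow> (\<exists>n\<in>omega S. \<exists>f\<in>U. ap f (zero S) = a \<and> ap f n = b \<and>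
    (\<forall>k\<in>elts S n. (ap f k, ap f (succ S k)) \<in> R))" for b
  let ?B = "{b\<in>?A. P b}"
  have "isset S ?B"
    by (rule isset_sep[OF iA]) (unfold P_def, intro dfi dfn_isset2 R(2) df_const a)
  moreover have "P a"
  proof -
    obtain f where f: "f \<in> U" "elts S f = (\<lambda>_. pair S (zero S) a) ` {zero S}"
      using isset_single[of "pair S (zero S) a"] a by (auto simp: isset_def)
    have "ap f (zero S) = a" by (rule ap_eq) (use a f in auto)
    then show ?thesis unfolding P_def using f(1) by (intro bexI[of _ "zero S"] bexI[of _ f]) auto
  qed
  moreover have Pcl: "P v" if uv: "(u, v) \<in> R" "P u" for u v
  proof -
    obtain n f where n: "n \<in> omega S" and f: "f \<in> U" "ap f (zero S) = a" "ap f n = u"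
      "\<And>k. k \<in> elts S n \<Longrightarrow> (ap f k, ap f (succ S k)) \<in> R" using uv(2) unfolding P_def by blast
    note U = omegaU[OF n] succ_U[OF omegaU[OF n]]
    \<comment> \<open>The path \<open>f\<close> with last index \<open>n\<close>, prolonged by
      \<open>v\<close> at the successor of \<open>n\<close>. The domain grows to the second
      successor of \<open>n\<close>, and by \<open>ir\<close> the new entry replaces no old
      one.\<close>
    define k where "k x = (if x = succ S n then v else ap f x)" for x
    have vU: "v \<in> U" using isset2D[OF R(2) uv(1)] by simp
    have kd: "df (\<lambda>e. k (e 0))" unfolding k_def by (intro dfi df_const U f(1) vU)
    obtain g where g: "g \<in> U" "elts S g = (\<lambda>x. pair S x (k x)) ` elts S (succ S (succ S n))"
      using isset_graph[OF isset_elts[OF succ_U[OF U(2)]] kd] by (auto simp: isset_def)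
    have apg: "ap g x = k x" if "x \<in> elts S (succ S (succ S n))" for x
      using ap_image[OF elts_subset_U _ g(2) that] df_funU[OF kd] eltsU by blast
    have ir: "succ S n \<notin> elts S (succ S n)"
      using ordinal_irrefl omega_ordinal[OF succ_omega[OF n]] by blast
    have old: "ap g x = ap f x" if "x \<in> elts S (succ S n)" for x
      using apg[of x] that ir U by (auto simp: k_def)
    have new: "ap g (succ S n) = v" using apg[of "succ S n"] U by (simp add: k_def)
    have z: "ap g (zero S) = a" using old[OF zero_in_succ[OF n]] f(2) by simp
    have "(ap g x, ap g (succ S x)) \<in> R" if x: "x \<in> elts S (succ S n)" for x
    proof (cases "x = n")
      case True
      then show ?thesis using new old[of n] f(3) uv(1) U by simp
    next
      case False
      then have xn: "x \<in> elts S n" using x U by simp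
      show ?thesis using old[OF x] old[OF succ_in_succ[OF n xn]] f(4)[OF xn] by simp
    qed
    then show ?thesis unfolding P_def using g(1) z new succ_omega[OF n] by blast
  qed
  moreover have "v \<in> ?B" if "(u, v) \<in> R" "u \<in> ?B" for u v
    using that Pcl[OF that(1)] imageI[OF that(1), of snd] by simp
  ultimately have "b \<in> ?B" using r unfolding rch_def by (metis (no_types, lifting) insertI1 mem_Collect_eq)
  then obtain n f where n: "n \<in> omega S" and f: "f \<in> U" "ap f (zero S) = a" "ap f n = b"
      "\<forall>k\<in>elts S n. (ap f k, ap f (succ S k)) \<in> R" unfolding P_def by blast
  have "internal_fun S (elts S (succ S n)) (ap f)"
    by (rule internal_funI[OF isset_elts[OF succ_U[OF omegaU[OF n]]] df_ap_const[OF f(1)]])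
  then show "reach S G a b" unfolding reach_def R using n f by blast
qed

lemma grD:
  assumes "gr S W R p"
  shows gr_verts: "verts S (encode S (W, R, p)) = W" and gr_edges: "edges S (encode S (W, R, p)) = R"
    and gr_pt: "pt S (encode S (W, R, p)) = p" and gr_is_graph: "is_graph S (encode S (W, R, p))"
proof -
  have W: "isset S W" "isset2 S R" "p \<in> W" "R \<subseteq> W \<times> W" and rp: "\<And>a. a \<in> W \<Longrightarrow> rch S R p a"
    using assms unfolding gr_def by blast+
  have iR: "isset S (prs S R)" using W(2) by (simp add: isset2_def)
  have pU: "p \<in> U" using W isset_subset_U by blast
  note d = decode_encode[OF W(1,2) pU]
  show v: "verts S (encode S (W, R, p)) = W" and e: "edges S (encode S (W, R, p)) = R"
    and p: "pt S (encode S (W, R, p)) = p"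
    by (simp_all add: verts_def edges_def pt_def d)
  have "elts S (setof S (prs S R)) \<subseteq> {pair S a b | a b. a \<in> elts S (setof S W) \<and> b \<in> elts S (setof S W)}"
    using W(1,4) iR by (auto simp: elts_setof prs_def)
  moreover have "\<forall>a\<in>verts S (encode S (W, R, p)). reach S (encode S (W, R, p)) (pt S (encode S (W, R, p))) a"
    unfolding v p reach_iff[OF e W(2) pU] using rp by blast
  ultimately show "is_graph S (encode S (W, R, p))"
    unfolding is_graph_def using W(1,3) pU iR setof_U[OF W(1)] setof_U[OF iR] elts_setof[OF W(1)] encode_eq
    by (metis triple_U)
qed

lemma is_graph_gr:
  assumes "is_graph S G"
  shows "gr S (verts S G) (edges S G) (pt S G)" "encode S (verts S G, edges S G, pt S G) = G"
proof -
  obtain V E p where U: "V \<in> U" "E \<in> U" "p \<in> U" and G: "G = triple S V E p"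
    and E: "elts S E \<subseteq> {pair S a b | a b. a \<in> elts S V \<and> b \<in> elts S V}" and p: "p \<in> elts S V"
    and r: "\<forall>a\<in>verts S G. reach S G (pt S G) a"
    using assms unfolding is_graph_def by blast
  let ?R = "{(a, b). a \<in> U \<and> b \<in> U \<and> pair S a b \<in> elts S E}"
  have v: "verts S G = elts S V" "edges S G = ?R" "pt S G = p"
    using decode_triple[OF U] by (simp_all add: verts_def edges_def pt_def G)
  have "x \<in> prs S ?R" if x: "x \<in> elts S E" for x
  proof -
    obtain a b where "x = pair S a b" "a \<in> elts S V" "b \<in> elts S V" using E x by blast
    then show ?thesis using x eltsU unfolding prs_def by force
  qed
  then have pr: "prs S ?R = elts S E" unfolding prs_def by auto
  have i2: "isset2 S ?R" using pr isset_elts[OF U(2)] unfolding isset2_def by auto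
  have "?R \<subseteq> elts S V \<times> elts S V"
  proof clarify
    fix a b assume ab: "a \<in> U" "b \<in> U" "pair S a b \<in> elts S E"
    then obtain c d where "pair S a b = pair S c d" "c \<in> elts S V" "d \<in> elts S V" using E by blast
    then show "a \<in> elts S V \<and> b \<in> elts S V" using ab eltsU by auto
  qed
  then show "gr S (verts S G) (edges S G) (pt S G)"
    using r isset_elts[OF U(1)] i2 p reach_iff[OF v(2) i2 U(3)] unfolding gr_def v by blast
  show "encode S (verts S G, edges S G, pt S G) = G"
    unfolding encode_eq v pr using U G by simp
qed

lemma is_graphD:
  assumes "is_graph S G"
  shows "isset S (verts S G)" "isset2 S (edges S G)" "edges S G \<subseteq> verts S G \<times> verts S G" "pt S G \<in> verts S G"
    "\<And>a. a \<in> verts S G \<Longrightarrow> rch S (edges S G) (pt S G) a" "\<And>a. a \<in> verts S G \<Longrightarrow> a \<in> U" "G \<in> U"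
  using is_graph_gr(1)[OF assms] isset_subset_U assms unfolding gr_def is_graph_def by blast+

lemma children_verts: "is_graph S G \<Longrightarrow> a \<in> children S G b \<Longrightarrow> a \<in> verts S G"
  using is_graphD(3) unfolding children_def by blast

section \<open>Subgraphs generated by a vertex\<close>

lemma subgraph_eq:
  assumes G: "is_graph S G" "a \<in> verts S G"
  defines "W \<equiv> {b\<in>verts S G. rch S (edges S G) a b}"
  shows "subgraph_at S G a = encode S (W, edges S G \<inter> W \<times> W, a)" "gr S W (edges S G \<inter> W \<times> W) a"
proof -
  note g = is_graphD[OF G(1)]
  show "subgraph_at S G a = encode S (W, edges S G \<inter> W \<times> W, a)"
    unfolding subgraph_at_def Let_def W_def using reach_iff[OF refl g(2) g(6)[OF G(2)]] by simp
  have iW: "isset S W" unfolding W_def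
    by (rule isset_sep[OF g(1)]) (intro dfn_rch g(2) df_var df_const g(6) G(2))
  have WV: "W \<subseteq> verts S G" by (auto simp: W_def)
  have cl: "v \<in> W" if "(u, v) \<in> edges S G" "u \<in> W" for u v
    using that g(3) rch_trans[OF _ rch_edge[OF that(1)]] unfolding W_def by blast
  have aW: "a \<in> W" using G(2) unfolding W_def by (simp add: rch_refl)
  have "rch S (edges S G \<inter> W \<times> W) a b" if "b \<in> W" for b
    by (rule rch_restrict[OF _ g(1,3,2) aW WV iW cl]) (use that W_def in auto)
  then show "gr S W (edges S G \<inter> W \<times> W) a"
    unfolding gr_def using iW aW isset2_sub[OF g(2,1) WV iW g(3)] by blast
qed

lemma subgraph_at:
  assumes "is_graph S G" "a \<in> verts S G"
  shows subgraph_is_graph: "is_graph S (subgraph_at S G a)"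
    and subgraph_verts: "verts S (subgraph_at S G a) = {b\<in>verts S G. rch S (edges S G) a b}"
    and subgraph_edges: "edges S (subgraph_at S G a) =
      edges S G \<inter> {b\<in>verts S G. rch S (edges S G) a b} \<times> {b\<in>verts S G. rch S (edges S G) a b}"
    and subgraph_pt: "pt S (subgraph_at S G a) = a"
  using grD[OF subgraph_eq(2)[OF assms]] unfolding subgraph_eq(1)[OF assms] by blast+

lemma subgraph_rch_iff:
  assumes G: "is_graph S G" "a \<in> verts S G" and b: "b \<in> verts S (subgraph_at S G a)"
  shows "rch S (edges S (subgraph_at S G a)) b c \<longleftrightarrow> rch S (edges S G) b c"
proof
  note g = is_graphD[OF G(1)]
  show "rch S (edges S (subgraph_at S G a)) b c \<Longrightarrow> rch S (edges S G) b c"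
    unfolding subgraph_edges[OF G] by (rule rch_mono[OF Int_lower1])
  assume r: "rch S (edges S G) b c"
  show "rch S (edges S (subgraph_at S G a)) b c"
    unfolding subgraph_edges[OF G]
  proof (rule rch_restrict[OF r g(1,3,2)])
    show "isset S {b \<in> verts S G. rch S (edges S G) a b}"
      using subgraph_eq(2)[OF G] unfolding gr_def by blast
    show "v \<in> {b \<in> verts S G. rch S (edges S G) a b}"
      if "(u, v) \<in> edges S G" "u \<in> {b \<in> verts S G. rch S (edges S G) a b}" for u v
      using that g(3) rch_trans[OF _ rch_edge[OF that(1)]] by blast
  qed (use b subgraph_verts[OF G] in auto)
qed

lemma subgraph_subgraph:
  assumes G: "is_graph S G" "a \<in> verts S G" and b: "b \<in> verts S (subgraph_at S G a)"
  shows "subgraph_at S (subgraph_at S G a) b = subgraph_at S G b"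
proof -
  have bG: "b \<in> verts S G" "rch S (edges S G) a b" using b subgraph_verts[OF G] by auto
  let ?W = "{c\<in>verts S G. rch S (edges S G) b c}"
  let ?W' = "{c\<in>verts S (subgraph_at S G a). rch S (edges S (subgraph_at S G a)) b c}"
  have W: "?W' = ?W" unfolding subgraph_rch_iff[OF G b] subgraph_verts[OF G] using rch_trans[OF bG(2)] by blast
  have "edges S (subgraph_at S G a) \<inter> ?W \<times> ?W = edges S G \<inter> ?W \<times> ?W"
    unfolding subgraph_edges[OF G] using rch_trans[OF bG(2)] by blast
  then show ?thesis
    unfolding subgraph_eq(1)[OF G(1) bG(1)] subgraph_eq(1)[OF subgraph_is_graph[OF G] b] W by simp
qed

lemma subgraph_pt_self: 
  assumes "is_graph S G" shows "subgraph_at S G (pt S G) = G"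
proof -
  note g = is_graphD[OF assms]
  have "{b\<in>verts S G. rch S (edges S G) (pt S G) b} = verts S G" using g(5) by blast
  then show ?thesis
    unfolding subgraph_eq(1)[OF assms g(4)] using g(3) is_graph_gr(2)[OF assms] by (simp add: Int_absorb2)
qed

lemma children_subgraph:
  assumes G: "is_graph S G" "a \<in> verts S G" and b: "b \<in> verts S (subgraph_at S G a)"
  shows "children S (subgraph_at S G a) b = children S G b"
proof -
  have "c \<in> verts S G \<and> rch S (edges S G) a c" if "(b, c) \<in> edges S G" for c
    using b is_graphD(3)[OF G(1)] that rch_trans[OF _ rch_edge[OF that]]
    unfolding subgraph_verts[OF G] by blast
  then show ?thesis using b unfolding children_def subgraph_edges[OF G] subgraph_verts[OF G] by blast
qed

lemma pt_in_subgraph: "is_graph S G \<Longrightarrow> a \<in> verts S G \<Longrightarrow> a \<in> verts S (subgraph_at S G a)"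
  by (simp add: subgraph_verts rch_refl)

lemma children_subgraph_pt:
  "is_graph S G \<Longrightarrow> a \<in> verts S G \<Longrightarrow> children S (subgraph_at S G a) (pt S (subgraph_at S G a)) = children S G a"
  by (simp add: subgraph_pt children_subgraph pt_in_subgraph)

text \<open>An isomorphism is constrained on the vertices only and may be arbitrary elsewhere. It is
  exchanged for \<open>ap f\<close> with \<open>f\<close> its coded graph, which is total and
  definable.\<close>

lemma graph_isoE:
  assumes "graph_iso S G H" "is_graph S G"
  obtains h where "df (\<lambda>e. h (e 0))" "bij_betw h (verts S G) (verts S H)" "h (pt S G) = pt S H"
    "\<And>a b. a \<in> verts S G \<Longrightarrow> b \<in> verts S G \<Longrightarrow> (a, b) \<in> edges S G \<longleftrightarrow> (h a, h b) \<in> edges S H"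
proof -
  obtain h where h: "internal_fun S (verts S G) h" "bij_betw h (verts S G) (verts S H)" "h (pt S G) = pt S H"
    "\<And>a b. a \<in> verts S G \<Longrightarrow> b \<in> verts S G \<Longrightarrow> (a, b) \<in> edges S G \<longleftrightarrow> (h a, h b) \<in> edges S H"
    using assms(1) unfolding graph_iso_def by blast
  note g = is_graphD[OF assms(2)]
  obtain f where f: "f \<in> U" "\<And>x. x \<in> verts S G \<Longrightarrow> h x = ap f x"
    using internal_funE[OF h(1) isset_subset_U[OF g(1)]] by blast
  show ?thesis
  proof (rule that[OF df_ap_const[OF f(1)]])
    show "bij_betw (ap f) (verts S G) (verts S H)" using h(2) f(2) bij_betw_cong by metis
    show "ap f (pt S G) = pt S H" using h(3) f(2) g(4) by simp
  qed (use h(4) f(2) in simp)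
qed

lemma graph_isoI:
  assumes "is_graph S G" "df (\<lambda>e. h (e 0))" "bij_betw h (verts S G) (verts S H)" "h (pt S G) = pt S H"
    "\<And>a b. a \<in> verts S G \<Longrightarrow> b \<in> verts S G \<Longrightarrow> (a, b) \<in> edges S G \<longleftrightarrow> (h a, h b) \<in> edges S H"
  shows "graph_iso S G H"
  unfolding graph_iso_def using internal_funI[OF is_graphD(1)[OF assms(1)] assms(2)] assms(3-5) by blast

lemma graph_iso_refl: "is_graph S G \<Longrightarrow> graph_iso S G G"
  by (rule graph_isoI[of G "\<lambda>x. x"]) (auto intro: df_var simp: bij_betw_def)

lemma graph_iso_trans:
  assumes "graph_iso S G H" "graph_iso S H K" "is_graph S G" "is_graph S H"
  shows "graph_iso S G K"
proof -
  obtain h where h: "df (\<lambda>e. h (e 0))" "bij_betw h (verts S G) (verts S H)" "h (pt S G) = pt S H"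
    "\<And>a b. a \<in> verts S G \<Longrightarrow> b \<in> verts S G \<Longrightarrow> (a, b) \<in> edges S G \<longleftrightarrow> (h a, h b) \<in> edges S H"
    using graph_isoE[OF assms(1,3)] by blast
  obtain k where k: "df (\<lambda>e. k (e 0))" "bij_betw k (verts S H) (verts S K)" "k (pt S H) = pt S K"
    "\<And>a b. a \<in> verts S H \<Longrightarrow> b \<in> verts S H \<Longrightarrow> (a, b) \<in> edges S H \<longleftrightarrow> (k a, k b) \<in> edges S K"
    using graph_isoE[OF assms(2,4)] by blast
  have hV: "h a \<in> verts S H" if "a \<in> verts S G" for a using that bij_betwE[OF h(2)] by blast
  show ?thesis
  proof (rule graph_isoI[of G "\<lambda>x. k (h x)", OF assms(3)])
    show "df (\<lambda>e. k (h (e 0)))" by (rule df_app1[of k, OF k(1) h(1)])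
    show "bij_betw (\<lambda>x. k (h x)) (verts S G) (verts S K)"
      using bij_betw_trans[OF h(2) k(2)] by (simp add: comp_def)
  qed (use h k hV in auto)
qed

lemma graph_iso_sym:
  assumes "graph_iso S G H" "is_graph S G" "is_graph S H"
  shows "graph_iso S H G"
proof -
  obtain h where h: "df (\<lambda>e. h (e 0))" "bij_betw h (verts S G) (verts S H)" "h (pt S G) = pt S H"
    "\<And>a b. a \<in> verts S G \<Longrightarrow> b \<in> verts S G \<Longrightarrow> (a, b) \<in> edges S G \<longleftrightarrow> (h a, h b) \<in> edges S H"
    using graph_isoE[OF assms(1,2)] by blast
  note g = is_graphD[OF assms(2)]
  note hU = df_funU[OF h(1)]
  have inj: "inj_on h (verts S G)" using h(2) by (simp add: bij_betw_def)
  \<comment> \<open>The reversed pairs code the inverse; injectivity of \<open>h\<close> makes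
    \<open>ap f\<close> single-valued on the image.\<close>
  obtain f where f: "f \<in> U" "elts S f = (\<lambda>a. pair S (h a) a) ` verts S G"
    using isset_image[OF g(1), of "\<lambda>a. pair S (h a) a"] df_pair[OF h(1) df_var] by (auto simp: isset_def)
  have apf: "ap f (h a) = a" if "a \<in> verts S G" for a
  proof (rule ap_eq)
    show "pair S (h a) a \<in> elts S f" unfolding f using that by blast
    fix z assume z: "z \<in> U" "pair S (h a) z \<in> elts S f"
    then obtain b where b: "b \<in> verts S G" "pair S (h a) z = pair S (h b) b" unfolding f by blast
    then show "z = a" using z hU g(6) that inj_onD[OF inj, of a b] by auto
  qed (use g(6) that in blast)
  have inv: "ap f y \<in> verts S G \<and> h (ap f y) = y" if "y \<in> verts S H" for y
  proof -
    obtain a where "a \<in> verts S G" "y = h a" using \<open>y \<in> verts S H\<close> h(2) unfolding bij_betw_def by blast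
    then show ?thesis using apf by simp
  qed
  show ?thesis
  proof (rule graph_isoI[OF assms(3) df_ap_const[OF f(1)]])
    show "bij_betw (ap f) (verts S H) (verts S G)"
      by (rule bij_betw_byWitness[of _ h]) (use inv apf h(2) bij_betwE in blast)+
    show "ap f (pt S H) = pt S G" using apf[OF g(4)] h(3) by simp
    show "(a, b) \<in> edges S H \<longleftrightarrow> (ap f a, ap f b) \<in> edges S G" if "a \<in> verts S H" "b \<in> verts S H" for a b
      using inv[OF that(1)] inv[OF that(2)] h(4)[of "ap f a" "ap f b"] by simp
  qed
qed

text \<open>Reachability is carried forwards by \<open>rch_hom\<close>. Backwards, the images of the
  vertices reachable from \<open>a\<close> are closed under the edges of \<open>H\<close>, so they
  exhaust what is reachable from \<open>h a\<close>.\<close>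

lemma graph_iso_subgraph:
  assumes G: "is_graph S G" "is_graph S H" and hd: "df (\<lambda>e. h (e 0))"
    and bij: "bij_betw h (verts S G) (verts S H)"
    and e: "\<And>a b. a \<in> verts S G \<Longrightarrow> b \<in> verts S G \<Longrightarrow> (a, b) \<in> edges S G \<longleftrightarrow> (h a, h b) \<in> edges S H"
    and a: "a \<in> verts S G"
  shows "graph_iso S (subgraph_at S G a) (subgraph_at S H (h a))"
proof -
  note g = is_graphD[OF G(1)] and k = is_graphD[OF G(2)]
  have hV: "h b \<in> verts S H" if "b \<in> verts S G" for b using that bij_betwE[OF bij] by blast
  have inj: "inj_on h (verts S G)" and im: "h ` verts S G = verts S H" using bij by (simp_all add: bij_betw_def)
  have r1: "rch S (edges S H) (h a) (h b)" if "rch S (edges S G) a b" for b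
    by (rule rch_hom[OF that g(1,3) a k(2) hd]) (use e g(3) in blast)
  have r2: "\<exists>b\<in>verts S G. c = h b \<and> rch S (edges S G) a b" if "rch S (edges S H) (h a) c" for c
  proof -
    have "c \<in> verts S H \<and> (\<exists>b\<in>verts S G. c = h b \<and> rch S (edges S G) a b)"
    proof (rule rch_induct[OF that k(1,3) hV[OF a]])
      show "dfn (\<lambda>e. \<exists>b\<in>verts S G. e 0 = h b \<and> rch S (edges S G) a b)"
        by (intro dfi df_app1[of h, OF hd] dfn_rch g(2) df_const g(6) a dc_const g(1))
      show "\<exists>b\<in>verts S G. h a = h b \<and> rch S (edges S G) a b" using a rch_refl[of S] by blast
      fix u v assume uv: "(u, v) \<in> edges S H" "v \<in> verts S H" "\<exists>b\<in>verts S G. u = h b \<and> rch S (edges S G) a b"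
      then obtain b where b: "b \<in> verts S G" "u = h b" "rch S (edges S G) a b" by blast
      obtain c where c: "c \<in> verts S G" "v = h c" using uv(2) im by blast
      have "(b, c) \<in> edges S G" using e[OF b(1) c(1)] uv(1) b c by simp
      then show "\<exists>b\<in>verts S G. v = h b \<and> rch S (edges S G) a b"
        using c rch_trans[OF b(3) rch_edge] by blast
    qed
    then show ?thesis by simp
  qed
  let ?W = "{b\<in>verts S G. rch S (edges S G) a b}" and ?W' = "{b\<in>verts S H. rch S (edges S H) (h a) b}"
  have im': "h ` ?W = ?W'"
  proof (intro equalityI subsetI)
    fix c assume "c \<in> ?W'" then show "c \<in> h ` ?W" using r2 by blast
  next
    fix c assume "c \<in> h ` ?W" then show "c \<in> ?W'" using r1 hV by blast
  qed
  show ?thesis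
  proof (rule graph_isoI[OF subgraph_is_graph[OF G(1) a] hd])
    show "bij_betw h (verts S (subgraph_at S G a)) (verts S (subgraph_at S H (h a)))"
      unfolding subgraph_verts[OF G(1) a] subgraph_verts[OF G(2) hV[OF a]] bij_betw_def
      using im' inj_on_subset[OF inj, of ?W] by blast
    show "h (pt S (subgraph_at S G a)) = pt S (subgraph_at S H (h a))"
      by (simp add: subgraph_pt G a hV)
    show "(b, c) \<in> edges S (subgraph_at S G a) \<longleftrightarrow> (h b, h c) \<in> edges S (subgraph_at S H (h a))"
      if "b \<in> verts S (subgraph_at S G a)" "c \<in> verts S (subgraph_at S G a)" for b c
      using that e[of b c] im' unfolding subgraph_verts[OF G(1) a] subgraph_edges[OF G(1) a] subgraph_edges[OF G(2) hV[OF a]]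
      by blast
  qed
qed

text \<open>Used with an injection of the vertices into the ordinals.\<close>

lemma graph_pushforward:
  assumes G: "is_graph S G" and hd: "df (\<lambda>e. h (e 0))" and inj: "inj_on h (verts S G)"
  defines "W \<equiv> h ` verts S G" and "R \<equiv> {(h a, h b) | a b. (a, b) \<in> edges S G}"
  shows "gr S W R (h (pt S G))" "graph_iso S G (encode S (W, R, h (pt S G)))"
proof -
  note g = is_graphD[OF G]
  have iW: "isset S W" unfolding W_def by (rule isset_image[OF g(1) hd])
  have RW: "R \<subseteq> W \<times> W" unfolding R_def W_def using g(3) by blast
  have i2: "isset2 S R"
  proof (rule isset2I[OF iW iW RW])
    have "dfn (\<lambda>e. \<exists>a\<in>verts S G. \<exists>b\<in>verts S G. (a, b) \<in> edges S G \<and> e 0 = h a \<and> e 1 = h b)"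
      by (intro dfi dfn_isset2 g(2) dc_const g(1) df_app1[of h, OF hd])
    moreover have "(x, y) \<in> R \<longleftrightarrow> (\<exists>a\<in>verts S G. \<exists>b\<in>verts S G. (a, b) \<in> edges S G \<and> x = h a \<and> y = h b)" for x y
      unfolding R_def using g(3) by blast
    ultimately show "dfn (\<lambda>e. (e 0, e 1) \<in> R)" by simp
  qed
  have "rch S R (h (pt S G)) (h a)" if "a \<in> verts S G" for a
    by (rule rch_hom[OF g(5)[OF that] g(1,3,4) i2 hd]) (auto simp: R_def)
  then show gr: "gr S W R (h (pt S G))"
    unfolding gr_def using iW RW i2 g(4) unfolding W_def by blast
  show "graph_iso S G (encode S (W, R, h (pt S G)))"
  proof (rule graph_isoI[OF G hd])
    show "(a, b) \<in> edges S G \<longleftrightarrow> (h a, h b) \<in> edges S (encode S (W, R, h (pt S G)))"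
      if "a \<in> verts S G" "b \<in> verts S G" for a b
      unfolding gr_edges[OF gr] unfolding R_def using that inj g(3) by (auto dest: inj_onD)
    show "bij_betw h (verts S G) (verts S (encode S (W, R, h (pt S G))))"
      unfolding gr_verts[OF gr] unfolding W_def using inj by (simp add: bij_betw_def)
  qed (simp add: gr_pt[OF gr])
qed

text \<open>By choice every graph is isomorphic to one whose vertices are ordinals, which is well-founded.\<close>

lemma graph_iso_has_rank:
  assumes G: "is_graph S G"
  shows "\<exists>H \<alpha>. is_graph S H \<and> graph_iso S G H \<and> has_rank S H \<alpha>"
proof -
  note g = is_graphD[OF G]
  obtain h where h: "df (\<lambda>e. h (e 0))" "inj_on h (verts S G)" "\<And>v. v \<in> verts S G \<Longrightarrow> ordinal S (h v)"
    using inject_into_ordinals[OF g(1)] by blast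
  let ?W = "h ` verts S G" and ?R = "{(h a, h b) | a b. (a, b) \<in> edges S G}"
  note gr = graph_pushforward[OF G h(1,2)]
  have W: "\<exists>\<alpha>. has_rank S x \<alpha>" if "x \<in> ?W" for x
    using that h(3) ordinal_has_rank by blast
  have "isset S ?W" using gr(1) unfolding gr_def by blast
  then have "\<exists>\<alpha>. has_rank S (setof S ?W) \<alpha>" by (rule has_rank_setof[OF _ W])
  moreover have "\<exists>\<alpha>. has_rank S (setof S (prs S ?R)) \<alpha>"
  proof (rule has_rank_setof)
    show "isset S (prs S ?R)" using gr(1) unfolding gr_def isset2_def by blast
    show "\<exists>\<alpha>. has_rank S x \<alpha>" if "x \<in> prs S ?R" for x
    proof -
      obtain a b where "x = pair S a b" "(a, b) \<in> ?R" using \<open>x \<in> prs S ?R\<close> unfolding prs_def by auto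
      moreover have "a \<in> ?W" "b \<in> ?W" using \<open>(a, b) \<in> ?R\<close> g(3) by auto
      ultimately show ?thesis using has_rank_pair[OF W W] by simp
    qed
  qed
  moreover have "\<exists>\<alpha>. has_rank S (h (pt S G)) \<alpha>" using W g(4) by blast
  ultimately have "\<exists>\<alpha>. has_rank S (encode S (?W, ?R, h (pt S G))) \<alpha>"
    unfolding encode_eq triple_def by (intro has_rank_pair)
  then show ?thesis using gr_is_graph[OF gr(1)] gr(2) by blast
qed

section \<open>Definability of the notions on graphs\<close>

text \<open>\<open>decode\<close> rests on \<open>THE\<close>, so \<open>verts\<close>,
  \<open>edges\<close> and \<open>pt\<close> get definable counterparts. \<open>gE\<close> returns
  the coded edge set, an element of the universe, whereas \<open>edges\<close> is a relation of the
  metalogic.\<close>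

definition gV :: "'a \<Rightarrow> 'a" where "gV G = tfst G"
definition gE :: "'a \<Rightarrow> 'a" where "gE G = tfst (tsnd G)"
definition gP :: "'a \<Rightarrow> 'a" where "gP G = tsnd (tsnd G)"

lemma df_gV[dfi]: "df s \<Longrightarrow> df (\<lambda>e. gV (s e))" unfolding gV_def by (intro dfi)
lemma df_gE[dfi]: "df s \<Longrightarrow> df (\<lambda>e. gE (s e))" unfolding gE_def by (intro dfi)
lemma df_gP[dfi]: "df s \<Longrightarrow> df (\<lambda>e. gP (s e))" unfolding gP_def by (intro dfi)

text \<open>Reachability with the coded edge set as an argument; unlike \<open>rch S R\<close> for a
  fixed \<open>R\<close>, it can be handled when the graph itself is a variable.\<close>

definition RE :: "'a \<Rightarrow> 'a \<Rightarrow> 'a \<Rightarrow> bool" where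
  "RE E a b \<longleftrightarrow> (\<forall>B\<in>U. a \<in> elts S B \<and> (\<forall>u\<in>U. \<forall>v\<in>U. pair S u v \<in> elts S E \<and> u \<in> elts S B \<longrightarrow> v \<in> elts S B) \<longrightarrow> b \<in> elts S B)"

lemma dfn_RE[dfi]:
  assumes "df s" "df t" "df u" shows "dfn (\<lambda>e. RE (s e) (t e) (u e))"
  by (rule dfn_rel3[of RE, OF _ assms]) (unfold RE_def, intro dfi)

lemma RE_rch: "isset2 S R \<Longrightarrow> elts S E = prs S R \<Longrightarrow> RE E a b \<longleftrightarrow> rch S R a b"
  unfolding RE_def rch_iff using in_prs by simp

lemma gparts:
  assumes "is_graph S G"
  shows "elts S (gV G) = verts S G" "elts S (gE G) = prs S (edges S G)" "gP G = pt S G"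
    "G = triple S (gV G) (gE G) (gP G)"
proof -
  note g = is_graphD[OF assms]
  have G: "G = triple S (setof S (verts S G)) (setof S (prs S (edges S G))) (pt S G)"
    using is_graph_gr(2)[OF assms] unfolding encode_eq by simp
  have U: "setof S (verts S G) \<in> U" "setof S (prs S (edges S G)) \<in> U" "pt S G \<in> U"
    using g by (auto simp: setof_U isset2_def)
  have *: "gV (triple S a b c) = a" "gE (triple S a b c) = b" "gP (triple S a b c) = c" if "a \<in> U" "b \<in> U" "c \<in> U" for a b c
    using that by (simp_all add: gV_def gE_def gP_def triple_def)
  have e: "gV G = setof S (verts S G)" "gE G = setof S (prs S (edges S G))" "gP G = pt S G"
    using *[OF U] G by metis+
  show "elts S (gV G) = verts S G" "elts S (gE G) = prs S (edges S G)" "gP G = pt S G"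
    unfolding e using g by (simp_all add: elts_setof isset2_def)
  show "G = triple S (gV G) (gE G) (gP G)" unfolding e by (rule G)
qed

lemma edges_gE: "is_graph S G \<Longrightarrow> a \<in> U \<Longrightarrow> b \<in> U \<Longrightarrow> (a, b) \<in> edges S G \<longleftrightarrow> pair S a b \<in> elts S (gE G)"
  using in_prs is_graphD(2) gparts(2) by simp

lemma is_graph_iff:
  "is_graph S G \<longleftrightarrow> G \<in> U \<and> G = triple S (gV G) (gE G) (gP G) \<and>
     (\<forall>x\<in>elts S (gE G). \<exists>a\<in>elts S (gV G). \<exists>b\<in>elts S (gV G). x = pair S a b) \<and>
     gP G \<in> elts S (gV G) \<and> (\<forall>a\<in>elts S (gV G). RE (gE G) (gP G) a)" (is "_ \<longleftrightarrow> ?r")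
proof
  assume G: "is_graph S G"
  note g = is_graphD[OF G]
  have "\<exists>a\<in>verts S G. \<exists>b\<in>verts S G. x = pair S a b" if "x \<in> prs S (edges S G)" for x
    using that g(3) unfolding prs_def by auto
  then show ?r using g gparts[OF G] RE_rch[OF g(2) gparts(2)[OF G]] by simp
next
  assume r: ?r
  let ?R = "{(a, b). a \<in> U \<and> b \<in> U \<and> pair S a b \<in> elts S (gE G)}"
  have U: "gV G \<in> U" "gE G \<in> U" "gP G \<in> U" by (simp_all add: gV_def gE_def gP_def)
  have "elts S (gE G) \<subseteq> prs S ?R"
  proof
    fix x assume x: "x \<in> elts S (gE G)"
    then obtain a b where "x = pair S a b" "a \<in> elts S (gV G)" "b \<in> elts S (gV G)" using r by blast
    then show "x \<in> prs S ?R" using x eltsU unfolding prs_def by force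
  qed
  then have pr: "prs S ?R = elts S (gE G)" unfolding prs_def by auto
  have i2: "isset2 S ?R" using pr isset_elts[OF U(2)] unfolding isset2_def by auto
  have "?R \<subseteq> elts S (gV G) \<times> elts S (gV G)"
  proof clarify
    fix a b assume ab: "a \<in> U" "b \<in> U" "pair S a b \<in> elts S (gE G)"
    then obtain c d where "pair S a b = pair S c d" "c \<in> elts S (gV G)" "d \<in> elts S (gV G)" using r by blast
    then show "a \<in> elts S (gV G) \<and> b \<in> elts S (gV G)" using ab eltsU by auto
  qed
  then have gr: "gr S (elts S (gV G)) ?R (gP G)"
    using r isset_elts[OF U(1)] i2 RE_rch[OF i2 pr[symmetric]] unfolding gr_def by blast
  have "encode S (elts S (gV G), ?R, gP G) = G"
    unfolding encode_eq pr using U r by simp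
  then show "is_graph S G" using gr_is_graph[OF gr] by simp
qed

lemma dfn_is_graph[dfi]: 
  assumes "df s" shows "dfn (\<lambda>e. is_graph S (s e))"
  by (rule dfn_rel1[of "is_graph S", OF _ assms]) (unfold is_graph_iff, intro dfi)

text \<open>Definable counterpart of \<open>subgraph_at\<close>; the two agree at the vertices of a
  graph.\<close>

definition sg :: "'a \<Rightarrow> 'a \<Rightarrow> 'a" where
  "sg G a = triple S (setof S {b\<in>elts S (gV G). RE (gE G) a b})
     (setof S {x\<in>elts S (gE G). RE (gE G) a (tfst x) \<and> RE (gE G) a (tsnd x)}) a"

lemma df_sg[dfi]:
  assumes "df s" "df t" shows "df (\<lambda>e. sg (s e) (t e))"
proof (rule df_app2[of sg, OF _ assms])
  have "isset S {b\<in>elts S (gV G). RE (gE G) a b}" "isset S {x\<in>elts S (gE G). RE (gE G) a (tfst x) \<and> RE (gE G) a (tsnd x)}"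
    if "G \<in> U" "a \<in> U" for G a
    by ((rule isset_sep, rule isset_elts, simp add: gV_def gE_def, intro dfi df_const that))+
  then show "df (\<lambda>e. sg (e 0) (e 1))" unfolding sg_def by (intro dfi) (auto simp: envD)
qed

lemma subgraph_sg:
  assumes G: "is_graph S G" "a \<in> verts S G" shows "subgraph_at S G a = sg G a"
proof -
  note g = is_graphD[OF G(1)] and p = gparts[OF G(1)]
  let ?W = "{b\<in>verts S G. rch S (edges S G) a b}"
  have "x \<in> prs S (edges S G \<inter> ?W \<times> ?W) \<longleftrightarrow> x \<in> prs S (edges S G) \<and> rch S (edges S G) a (tfst x) \<and> rch S (edges S G) a (tsnd x)" for x
  proof
    assume "x \<in> prs S (edges S G \<inter> ?W \<times> ?W)"
    then obtain u v where "(u, v) \<in> edges S G" "u \<in> ?W" "v \<in> ?W" "x = pair S u v" unfolding prs_def by auto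
    then show "x \<in> prs S (edges S G) \<and> rch S (edges S G) a (tfst x) \<and> rch S (edges S G) a (tsnd x)"
      using isset2D[OF g(2)] unfolding prs_def by force
  next
    assume x: "x \<in> prs S (edges S G) \<and> rch S (edges S G) a (tfst x) \<and> rch S (edges S G) a (tsnd x)"
    then obtain u v where "(u, v) \<in> edges S G" "x = pair S u v" unfolding prs_def by auto
    moreover then have "u \<in> ?W" "v \<in> ?W" using x isset2D[OF g(2)] g(3) by auto
    ultimately show "x \<in> prs S (edges S G \<inter> ?W \<times> ?W)" unfolding prs_def by force
  qed
  then have "{x\<in>prs S (edges S G). rch S (edges S G) a (tfst x) \<and> rch S (edges S G) a (tsnd x)} = prs S (edges S G \<inter> ?W \<times> ?W)"
    by blast
  then show ?thesis
    unfolding sg_def subgraph_eq(1)[OF G] encode_eq p(1) p(2) RE_rch[OF g(2) p(2)] by simp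
qed

end

section \<open>Full classes\<close>

text \<open>What is used of the class model for the axioms and for comparing graph notions. The
  membership relation of \<open>N\<close> need not be that of \<open>S\<close>: only extensions are
  compared, through \<open>full\<close>.\<close>

locale full_class = zfc S for S :: "'a estruct" +
  fixes N :: "'a estruct"
  assumes N_subset: "univ N \<subseteq> univ S"
    and dc_N: "dc (\<lambda>e. univ N)"
    and dfn_mem_N: "dfn (\<lambda>e. mem N (e 0) (e 1))"
    and full: "A \<subseteq> univ N \<Longrightarrow> isset N A \<longleftrightarrow> isset S A"
    and extensional_N: "x \<in> univ N \<Longrightarrow> y \<in> univ N \<Longrightarrow> elts N x = elts N y \<Longrightarrow> x = y"
begin

lemma elts_N_subset: "elts N x \<subseteq> univ N"
  by (auto simp: elts_def)

lemma dc_elts_N: "df s \<Longrightarrow> dc (\<lambda>e. elts N (s e))"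
proof -
  assume s: "df s"
  have "dc (\<lambda>e. {y\<in>univ N. mem N y (s e)})"
    by (intro dfi dc_N dfn_rel2[of "mem N", OF dfn_mem_N] df_ren[OF s])
  then show ?thesis by (simp add: elts_def)
qed

lemma isset_elts_N: "x \<in> univ N \<Longrightarrow> isset S (elts N x)"
  using full[OF elts_N_subset, of x] by (auto simp: isset_def)

lemma setof_N:
  assumes "A \<subseteq> univ N" "isset S A"
  shows setof_N_in: "setof N A \<in> univ N" and elts_setof_N: "elts N (setof N A) = A"
proof -
  obtain x where x: "x \<in> univ N" "elts N x = A" using full[OF assms(1)] assms(2) by (auto simp: isset_def)
  then have "setof N A = x" unfolding setof_def using extensional_N by (intro the_equality) auto
  then show "setof N A \<in> univ N" "elts N (setof N A) = A" using x by auto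
qed

text \<open>Relativization: truth in \<open>N\<close> is definable in \<open>S\<close>, with
  quantifiers bounded by the class. The two schemes for \<open>N\<close> reduce to those of
  \<open>S\<close> in this way.\<close>

lemma dfn_sat_N: "dfn (\<lambda>e. sat N e \<psi>)"
proof (induction \<psi>)
  case (FMem i j) show ?case using dfn_rel2[of "mem N", OF dfn_mem_N df_var df_var] by simp
next
  case (FEq i j) show ?case using dfn_eq[OF df_var df_var] by simp
next
  case (FNeg \<psi>) then show ?case using dfn_not by simp
next
  case (FConj \<psi>1 \<psi>2) then show ?case using dfn_conj by simp
next
  case (FAll i \<psi>)
  have "dfn (\<lambda>e. \<forall>a\<in>univ N. sat N (e(i := a)) \<psi>)"
  proof (rule dfn_ball[OF dc_N])
    have "(shift e)(i := e 0) = (\<lambda>n. e (if n = i then 0 else Suc n))" for e :: "nat \<Rightarrow> 'a" by auto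
    then show "dfn (\<lambda>e. sat N ((shift e)(i := e 0)) \<psi>)" using dfn_ren[OF FAll] by simp
  qed
  then show ?case by simp
qed

text \<open>Omega of \<open>S\<close> need not be contained in the class, so it is copied by
  recursion: \<open>g n\<close> is the element of \<open>N\<close> whose members are the earlier
  values, which is the corresponding numeral of \<open>N\<close>.\<close>

lemma infinity_N: "infinity_ax N"
proof -
  \<comment> \<open>The second branch is a default for sets not included in the class; it makes
    \<open>mk\<close> total.\<close>
  define mk where "mk w = (if elts S w \<subseteq> univ N then setof N (elts S w) else setof N {})" for w
  have mkN: "mk w \<in> univ N" if "w \<in> U" for w
    using that setof_N_in isset_elts isset_empty by (simp add: mk_def)
  have "df (\<lambda>e. mk (e 0))"
  proof (rule df_rel)
    let ?P = "\<lambda>y e. (elts S (e 0) \<subseteq> univ N \<and> y \<in> univ N \<and> elts N y = elts S (e 0)) \<or>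
      \<not> elts S (e 0) \<subseteq> univ N \<and> y = setof N {}"
    show "y = mk (e 0) \<longleftrightarrow> ?P y e" if "env S e" "y \<in> U" for e y
    proof (cases "elts S (e 0) \<subseteq> univ N")
      case True
      have i: "isset S (elts S (e 0))" using envD[OF that(1)] by (rule isset_elts)
      show ?thesis using True setof_N[OF True i] extensional_N[of y] by (auto simp: mk_def)
    qed (simp add: mk_def)
    have "setof N {} \<in> U" using setof_N_in[OF _ isset_empty] N_subset by blast
    then show "dfn (\<lambda>e. ?P (e 0) (shift e))"
      by (intro dfi dc_N dc_elts_N df_const)
  qed (use mkN N_subset envD in blast)
  then obtain g where g: "df (\<lambda>e. g (e 0))" "\<And>n. n \<in> omega S \<Longrightarrow> g n = mk (setof S (g ` elts S n))"
    by (rule omega_recursion) blast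
  have i: "isset S (g ` elts S n)" if "n \<in> omega S" for n
    by (rule isset_image[OF isset_elts[OF omegaU[OF that]] g(1)])
  have gN: "g n \<in> univ N" if "n \<in> omega S" for n
    using g(2)[OF that] mkN[OF setof_U[OF i[OF that]]] by simp
  have eg: "elts N (g n) = g ` elts S n" if n: "n \<in> omega S" for n
  proof -
    have "g ` elts S n \<subseteq> univ N" using gN omega_elt[OF n] by blast
    then show ?thesis using g(2)[OF n] elts_setof_N[OF _ i[OF n]] by (simp add: mk_def elts_setof i n)
  qed
  have "g ` omega S \<subseteq> univ N" using gN by blast
  then obtain I where I: "I \<in> univ N" "elts N I = g ` omega S"
    using full[of "g ` omega S"] isset_image[OF isset_omega g(1)] by (auto simp: isset_def)
  have "elts N (g (zero S)) = {}" by (simp add: eg)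
  moreover have "elts N (g (succ S n)) = insert (g n) (elts N (g n))" if "n \<in> omega S" for n
    using that by (simp add: eg omegaU)
  ultimately have "is_inductive N I" unfolding is_inductive_def I using succ_omega zero_omega by blast
  then show ?thesis unfolding infinity_ax_def using I(1) by blast
qed

lemma choice_N: "choice_ax N"
  unfolding choice_ax_def
proof (intro ballI impI, elim conjE)
  fix A assume A: "A \<in> univ N" "\<forall>x\<in>elts N A. elts N x \<noteq> {}"
    "\<forall>x\<in>elts N A. \<forall>y\<in>elts N A. x \<noteq> y \<longrightarrow> elts N x \<inter> elts N y = {}"
  note AN = subsetD[OF elts_N_subset]
  \<comment> \<open>The element of \<open>S\<close> with the same extension as \<open>x\<close> in
    \<open>N\<close>. The guard keeps \<open>F\<close> total, since outside the class
    \<open>elts N x\<close> need not be a set.\<close>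
  define F where "F x = setof S {z\<in>elts N x. x \<in> univ N}" for x
  have iF: "isset S {z\<in>elts N x. x \<in> univ N}" for x
    using isset_elts_N[of x] isset_empty by (cases "x \<in> univ N") simp_all
  have Fd: "df (\<lambda>e. F (e 0))" unfolding F_def by (intro dfi dc_elts_N dc_N iF)
  have eF: "elts S (F x) = elts N x" if "x \<in> elts N A" for x
    using AN[OF that] elts_setof[OF iF[of x]] by (simp add: F_def)
  obtain c where c: "df (\<lambda>e. c (e 0))" "\<forall>x\<in>F ` elts N A. c x \<in> elts S x"
    using choice_function[OF isset_image[OF isset_elts_N[OF A(1)] Fd]] A(2) eF by fastforce
  have cF: "c (F x) \<in> elts N x" if "x \<in> elts N A" for x using c(2) eF[OF that] that by auto
  let ?D = "(\<lambda>x. c (F x)) ` elts N A"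
  have "isset S ?D"
    using isset_image[OF isset_elts_N[OF A(1)] df_app1[of c, OF c(1) Fd]] .
  moreover have "?D \<subseteq> univ N" using cF elts_N_subset by blast
  ultimately obtain C where C: "C \<in> univ N" "elts N C = ?D" using full[of ?D] by (auto simp: isset_def)
  have "elts N C \<inter> elts N x = {c (F x)}" if x: "x \<in> elts N A" for x
  proof -
    have "y = x" if "y \<in> elts N A" "c (F y) \<in> elts N x" for y
      using A(3) cF[OF that(1)] that x by blast
    then show ?thesis using cF[OF x] x unfolding C by blast
  qed
  then show "\<exists>C\<in>univ N. \<forall>x\<in>elts N A. \<exists>z. elts N C \<inter> elts N x = {z}" using C(1) by blast
qed

lemma ZFC_minus_N: "ZFC_minus N"
  unfolding ZFC_minus_def
proof (intro conjI infinity_N choice_N)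
  note NU = subsetD[OF N_subset]
  have fullI: "\<exists>y\<in>univ N. elts N y = A" if "A \<subseteq> univ N" "isset S A" for A
    using full[OF that(1)] that(2) by (auto simp: isset_def)
  show "extensionality_ax N" unfolding extensionality_ax_def using extensional_N by blast
  show "pairing_ax N" unfolding pairing_ax_def using fullI isset_pair NU by simp
  show "union_ax N" unfolding union_ax_def
  proof
    fix x assume x: "x \<in> univ N"
    show "\<exists>y\<in>univ N. elts N y = (\<Union>z\<in>elts N x. elts N z)"
    proof (rule fullI)
      show "isset S (\<Union>z\<in>elts N x. elts N z)"
        by (rule isset_UN'[OF isset_elts_N[OF x] dc_elts_N[OF df_var] isset_elts_N])
          (use elts_N_subset in blast)
    qed (use elts_N_subset in blast)
  qed
  show "powerset_ax N" unfolding powerset_ax_def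
  proof
    fix x assume x: "x \<in> univ N"
    let ?Q = "{w\<in>U. elts S w \<subseteq> elts N x}"
    \<comment> \<open>A subset of \<open>elts N x\<close> is represented by different elements in
      the two structures. Replacement exchanges each one in \<open>S\<close> for its counterpart in
      \<open>N\<close>.\<close>
    have "isset S {y\<in>U. \<exists>w\<in>?Q. y \<in> univ N \<and> elts N y = elts S w}"
    proof (rule isset_repl[OF isset_pow[OF isset_elts_N[OF x]]])
      show "dfn (\<lambda>e. e 1 \<in> univ N \<and> elts N (e 1) = elts S (e 0))" by (intro dfi dc_N dc_elts_N)
    qed (use extensional_N in blast)
    also have "{y\<in>U. \<exists>w\<in>?Q. y \<in> univ N \<and> elts N y = elts S w} = {z\<in>univ N. elts N z \<subseteq> elts N x}"
    proof (intro equalityI subsetI)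
      fix z assume z: "z \<in> {z\<in>univ N. elts N z \<subseteq> elts N x}"
      then obtain w where "w \<in> U" "elts S w = elts N z" using isset_elts_N[of z] by (auto simp: isset_def)
      then show "z \<in> {y\<in>U. \<exists>w\<in>?Q. y \<in> univ N \<and> elts N y = elts S w}" using z NU by auto
    qed auto
    finally show "\<exists>y\<in>univ N. elts N y = {z\<in>univ N. elts N z \<subseteq> elts N x}" by (intro fullI) auto
  qed
  show "separation_ax N" unfolding separation_ax_def
  proof (intro allI impI ballI)
    fix \<psi> :: fm and e :: "nat \<Rightarrow> 'a" and x assume e: "range e \<subseteq> univ N" and x: "x \<in> univ N"
    have eS: "env S e" using e NU by (auto simp: env_def)
    have "e(0 := z) = (\<lambda>n. if n \<noteq> 0 then e n else z)" for z by auto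
    then have "dfn (\<lambda>e'. sat N (e(0 := e' 0)) \<psi>)"
      using dfn_inst[OF dfn_sat_N[of \<psi>] eS, where D = "\<lambda>n. n \<noteq> 0" and f = "\<lambda>n. 0"] by simp
    from isset_sep[OF isset_elts_N[OF x], of "\<lambda>z. sat N (e(0 := z)) \<psi>", OF this]
    show "\<exists>y\<in>univ N. elts N y = {z \<in> elts N x. sat N (e(0 := z)) \<psi>}"
      using elts_N_subset by (intro fullI) auto
  qed
  show "replacement_ax N" unfolding replacement_ax_def
  proof (intro allI impI ballI)
    fix \<psi> :: fm and e :: "nat \<Rightarrow> 'a" and A assume e: "range e \<subseteq> univ N" and A: "A \<in> univ N"
      and f: "\<forall>x\<in>elts N A. \<forall>y\<in>univ N. \<forall>y'\<in>univ N.
        sat N (e(0 := x, 1 := y)) \<psi> \<and> sat N (e(0 := x, 1 := y')) \<psi> \<longrightarrow> y = y'"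
    have eS: "env S e" using e NU by (auto simp: env_def)
    have d: "dfn (\<lambda>e'. sat N (e(0 := e' 0, 1 := e' 1)) \<psi>)"
    proof (rule dfn_cong[OF _ dfn_inst[OF dfn_sat_N[of \<psi>] eS, where D = "\<lambda>n. n \<noteq> 0 \<and> n \<noteq> 1"]])
      show "sat N (e(0 := e' 0, 1 := e' 1)) \<psi> \<longleftrightarrow>
        sat N (\<lambda>n. if n \<noteq> 0 \<and> n \<noteq> 1 then e n else e' ((\<lambda>n. if n = 0 then 0 else 1) n)) \<psi>" for e'
        by (rule arg_cong[where f = "\<lambda>e. sat N e \<psi>"], rule ext) simp
    qed
    have "isset S {y\<in>U. \<exists>x\<in>elts N A. y \<in> univ N \<and> sat N (e(0 := x, 1 := y)) \<psi>}"
      by (rule isset_repl[OF isset_elts_N[OF A]]) (intro dfi dc_N d, use f in blast)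
    moreover have "{y\<in>U. \<exists>x\<in>elts N A. y \<in> univ N \<and> sat N (e(0 := x, 1 := y)) \<psi>} =
      {y\<in>univ N. \<exists>x\<in>elts N A. sat N (e(0 := x, 1 := y)) \<psi>}" using NU by blast
    ultimately show "\<exists>B\<in>univ N. elts N B = {y\<in>univ N. \<exists>x\<in>elts N A. sat N (e(0 := x, 1 := y)) \<psi>}"
      by (intro fullI) auto
  qed
qed

end

sublocale full_class \<subseteq> N: zfc N
  by unfold_locales (rule ZFC_minus_N)

context full_class
begin

text \<open>Agreement is claimed for assignments in \<open>N\<close> only. Elsewhere
  \<open>Q\<close> is uncontrolled, so its uses are guarded by membership in the class.\<close>

lemma dfn_transfer:
  assumes "N.dfn P" obtains Q where "dfn Q" "\<And>e. env N e \<Longrightarrow> Q e \<longleftrightarrow> P e"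
proof -
  obtain \<psi> c where c: "env N c" and \<psi>: "\<And>e. env N e \<Longrightarrow> P e \<longleftrightarrow> sat N (mix e c) \<psi>"
    using assms unfolding N.dfn_def by blast
  have d: "env S (\<lambda>n. c (n div 2))" using c N_subset by (auto simp: env_def)
  have "mix e c = (\<lambda>n. if odd n then c (n div 2) else e (n div 2))" for e
    by (rule ext) (simp add: mix_def)
  then have "dfn (\<lambda>e. sat N (mix e c) \<psi>)"
    using dfn_inst[OF dfn_sat_N[of \<psi>] d, where D = odd and f = "\<lambda>n. n div 2"] by simp
  then show ?thesis using that \<psi> by blast
qed

section \<open>Agreement of graph notions between a full class and the universe\<close>

lemma isset_N_D: "isset N A \<Longrightarrow> isset S A"
  using full N.isset_subset_U by blast

text \<open>Pairs of \<open>N\<close> and pairs of \<open>S\<close> are different elements, so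
  fullness alone does not settle this. From \<open>N\<close> to \<open>S\<close>, domain and range
  are sets and \<open>R\<close> is definable. From \<open>S\<close> to \<open>N\<close>, replacement
  exchanges the pairs.\<close>

lemma isset2_N_iff:
  assumes R: "R \<subseteq> univ N \<times> univ N" shows "isset2 N R \<longleftrightarrow> isset2 S R"
proof
  assume i: "isset2 N R"
  have W: "isset S (fst ` R)" "isset S (snd ` R)"
    using isset_N_D N.isset_domain2[OF i] N.isset_range2[OF i] by blast+
  obtain Q where Q: "dfn Q" "\<And>e. env N e \<Longrightarrow> Q e \<longleftrightarrow> (e 0, e 1) \<in> R"
    using dfn_transfer[OF N.dfn_isset2[OF i N.df_var N.df_var]] by blast
  let ?e = "\<lambda>e n. e (if n = 0 then 0 else 1 :: nat)"
  have "dfn (\<lambda>e. e 0 \<in> univ N \<and> e 1 \<in> univ N \<and> Q (?e e))"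
    by (intro dfi dc_N dfn_ren[OF Q(1)])
  moreover have "e 0 \<in> univ N \<and> e 1 \<in> univ N \<and> Q (?e e) \<longleftrightarrow> (e 0, e 1) \<in> R" for e :: "nat \<Rightarrow> 'a"
    using Q(2)[of "?e e"] R by (auto simp: env_def)
  ultimately have "dfn (\<lambda>e. (e 0, e 1) \<in> R)" by simp
  then show "isset2 S R" by (rule isset2I[OF W, rotated]) force
next
  assume i: "isset2 S R"
  obtain Q where Q: "dfn Q" "\<And>e. env N e \<Longrightarrow> Q e \<longleftrightarrow> e 0 = pair N (e 1) (e 2)"
    using dfn_transfer[OF N.dfn_eq[OF N.df_var N.df_pair[OF N.df_var N.df_var]]] by blast
  \<comment> \<open>The graph of pairing in \<open>N\<close>, turned into a ternary relation that is
    definable in \<open>S\<close>.\<close>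
  define T where "T y a b \<longleftrightarrow> Q (\<lambda>n. if n = 0 then y else if n = 1 then a else b)" for y a b
  have "dfn (\<lambda>e. T (e 0) (e 1) (e 2))"
  proof (rule dfn_cong[OF _ dfn_ren[OF Q(1), of "\<lambda>n. if n = 0 then 0 else if n = 1 then 1 else 2"]])
    show "T (e 0) (e 1) (e 2) \<longleftrightarrow> Q (\<lambda>n. e (if n = 0 then 0 else if n = 1 then 1 else 2))" for e
      unfolding T_def by (rule arg_cong[where f = Q], rule ext) simp
  qed
  note Td = dfn_rel3[of T, OF this]
  have T: "T y a b \<longleftrightarrow> y = pair N a b" if "y \<in> univ N" "a \<in> univ N" "b \<in> univ N" for y a b
    unfolding T_def using Q(2) that by (simp add: env_def)
  let ?P = "\<lambda>x y. y \<in> univ N \<and> tfst x \<in> univ N \<and> tsnd x \<in> univ N \<and> T y (tfst x) (tsnd x)"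
  have "isset S {y\<in>U. \<exists>x\<in>prs S R. ?P x y}"
  proof (rule isset_repl)
    show "isset S (prs S R)" using i by (simp add: isset2_def)
    show "dfn (\<lambda>e. ?P (e 0) (e 1))" by (intro dfi dc_N Td)
  qed (use T in blast)
  also have "{y\<in>U. \<exists>x\<in>prs S R. ?P x y} = prs N R"
  proof (intro equalityI subsetI)
    fix y assume "y \<in> {y\<in>U. \<exists>x\<in>prs S R. ?P x y}"
    then obtain x where x: "x \<in> prs S R" "?P x y" by blast
    then obtain a b where ab: "(a, b) \<in> R" "x = pair S a b" unfolding prs_def by auto
    then have "y = pair N a b" using x(2) T isset2D[OF i ab(1)] by auto
    then show "y \<in> prs N R" using ab(1) unfolding prs_def by force
  next
    fix y assume "y \<in> prs N R"
    then obtain a b where ab: "(a, b) \<in> R" "y = pair N a b" unfolding prs_def by auto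
    then have N: "a \<in> univ N" "b \<in> univ N" using R by auto
    then have y: "y \<in> univ N" using ab(2) by simp
    have "pair S a b \<in> prs S R" using ab(1) unfolding prs_def by force
    moreover have "?P (pair S a b) y" using T[OF y N] N y ab(2) isset2D[OF i ab(1)] by simp
    ultimately show "y \<in> {y\<in>U. \<exists>x\<in>prs S R. ?P x y}" using N_subset y by blast
  qed
  finally have "isset S (prs N R)" .
  moreover have "prs N R \<subseteq> univ N" using R unfolding prs_def by auto
  ultimately show "isset2 N R" unfolding isset2_def using full R by blast
qed

text \<open>\<open>S\<close> has more closed sets than \<open>N\<close>, but each can be cut down to
  the class and stays closed, since \<open>R\<close> lives there.\<close>

lemma rch_N_iff:
  assumes "R \<subseteq> univ N \<times> univ N" "a \<in> univ N" shows "rch N R a b \<longleftrightarrow> rch S R a b"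
proof
  assume r: "rch N R a b"
  show "rch S R a b" unfolding rch_def
  proof (intro allI impI, elim conjE)
    fix B assume B: "isset S B" "a \<in> B" "\<forall>u v. (u, v) \<in> R \<and> u \<in> B \<longrightarrow> v \<in> B"
    have "isset S (B \<inter> univ N)"
      by (rule isset_sub[OF B(1)]) (intro dfi dc_N dc_const B(1), blast)
    then have "isset N (B \<inter> univ N)" using full[of "B \<inter> univ N"] by blast
    moreover have "\<forall>u v. (u, v) \<in> R \<and> u \<in> B \<inter> univ N \<longrightarrow> v \<in> B \<inter> univ N" using B(3) assms(1) by blast
    ultimately show "b \<in> B" using r B(2) assms(2) unfolding rch_def by blast
  qed
next
  assume "rch S R a b"
  then show "rch N R a b" unfolding rch_def using isset_N_D by blast
qed

lemma gr_N_iff: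
  assumes "W \<subseteq> univ N" shows "gr N W R p \<longleftrightarrow> gr S W R p"
proof -
  have "isset2 N R \<longleftrightarrow> isset2 S R" if "R \<subseteq> W \<times> W" using isset2_N_iff that assms by blast
  moreover have "rch N R p a \<longleftrightarrow> rch S R p a" if "R \<subseteq> W \<times> W" "p \<in> W" for a
    using rch_N_iff that assms by blast
  ultimately show ?thesis unfolding gr_def full[OF assms] by blast
qed

lemma internal_fun_N_iff:
  assumes "A \<subseteq> univ N" "h ` A \<subseteq> univ N" shows "internal_fun N A h \<longleftrightarrow> internal_fun S A h"
proof -
  have "(\<lambda>a. (a, h a)) ` A \<subseteq> univ N \<times> univ N" using assms by auto
  moreover have "A \<subseteq> U" using assms N_subset by blast
  ultimately show ?thesis
    using isset2_N_iff internal_fun_isset2 N.internal_fun_isset2[OF assms(1)] by simp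
qed

text \<open>The external graph that \<open>absolute_for\<close> compares with. It has the vertices,
  edges and point of \<open>x\<close>, but is built with the pairs of \<open>S\<close>.\<close>

definition realize :: "'a \<Rightarrow> 'a" where
  "realize x = encode S (decode N x)"

lemma realize_eq: "realize x = encode S (verts N x, edges N x, pt N x)"
  by (simp add: realize_def verts_def edges_def pt_def)

lemma gr_realize:
  assumes "is_graph N x" shows "gr S (verts N x) (edges N x) (pt N x)"
  using N.is_graph_gr(1)[OF assms] gr_N_iff N.isset_subset_U N.is_graphD(1)[OF assms] by blast

lemma realize_parts:
  assumes "is_graph N x"
  shows "is_graph S (realize x)" "verts S (realize x) = verts N x" "edges S (realize x) = edges N x" "pt S (realize x) = pt N x"
  using grD[OF gr_realize[OF assms]] unfolding realize_eq by simp_all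

lemma realize_subgraph:
  assumes x: "is_graph N x" "a \<in> verts N x"
  shows "realize (subgraph_at N x a) = subgraph_at S (realize x) a"
proof -
  note p = realize_parts[OF x(1)] and g = N.is_graphD[OF x(1)]
  have e: "edges N x \<subseteq> univ N \<times> univ N" using g(3,6) by blast
  note r = rch_N_iff[OF e g(6)[OF x(2)]]
  have a: "a \<in> verts S (realize x)" using x(2) p(2) by simp
  show ?thesis
    unfolding subgraph_eq(1)[OF p(1) a] realize_eq[of "subgraph_at N x a"]
      N.subgraph_verts[OF x] N.subgraph_edges[OF x] N.subgraph_pt[OF x] p(2,3) r by simp
qed

lemma graph_iso_N_iff:
  assumes "is_graph N x" "is_graph N y" shows "graph_iso N x y \<longleftrightarrow> graph_iso S (realize x) (realize y)"
proof -
  have V: "verts N x \<subseteq> univ N" "verts N y \<subseteq> univ N" using N.is_graphD(6) assms by blast+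
  have "internal_fun N (verts N x) h \<longleftrightarrow> internal_fun S (verts N x) h" if "bij_betw h (verts N x) (verts N y)" for h
    using internal_fun_N_iff[OF V(1), of h] V(2) that unfolding bij_betw_def by blast
  then show ?thesis unfolding graph_iso_def realize_parts[OF assms(1)] realize_parts[OF assms(2)] by blast
qed

end

text \<open>Leastness of the transitive closure gives reachability from \<open>X\<close>: a set
  closed under the edges, cut down to \<open>T\<close>, is closed under elements. Stated for an
  arbitrary model because it is applied inside the class model.\<close>

lemma (in zfc) gr_trcl:
  assumes X: "X \<in> U"
  defines "T \<equiv> elts S (trcl S (setof S {X}))"
  shows "gr S T {(x, y). x \<in> T \<and> y \<in> T \<and> y \<in> elts S x} X"
proof -
  let ?R = "{(x, y). x \<in> T \<and> y \<in> T \<and> y \<in> elts S x}"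
  have iT: "isset S T" unfolding T_def by (rule isset_elts[OF trcl_single_U[OF X]])
  have XT: "X \<in> T" unfolding T_def by (rule trcl_single_self[OF X])
  have cl: "z \<in> T" if "y \<in> T" "z \<in> elts S y" for y z
    using trcl_single_trans[OF X] that unfolding T_def by blast
  have sub: "?R \<subseteq> T \<times> T" by blast
  have "dfn (\<lambda>e. e 0 \<in> T \<and> e 1 \<in> T \<and> e 1 \<in> elts S (e 0))" by (intro dfi dc_const iT)
  then have i2: "isset2 S ?R" by (intro isset2I[OF iT iT sub]) simp
  have "rch S ?R X a" if a: "a \<in> T" for a unfolding rch_def
  proof (intro allI impI, elim conjE)
    fix B assume B: "isset S B" "X \<in> B" "\<forall>u v. (u, v) \<in> ?R \<and> u \<in> B \<longrightarrow> v \<in> B"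
    have "isset S (B \<inter> T)" by (rule isset_sub[OF B(1)]) (intro dfi dc_const B(1) iT, blast)
    moreover have "z \<in> B \<inter> T" if "y \<in> B \<inter> T" "z \<in> elts S y" for y z
      using B(3) cl[of y z] that by blast
    ultimately have "T \<subseteq> B \<inter> T"
      using trcl_single_least[OF X, of "B \<inter> T"] B(2) XT unfolding T_def by blast
    then show "a \<in> B" using a by blast
  qed
  then show ?thesis unfolding gr_def using iT i2 sub XT by blast
qed

section \<open>The class of extensional graphs\<close>

locale regular_relation = zfc S for S :: "'a estruct" +
  fixes \<phi> :: fm
  assumes fv_rel: "fv \<phi> \<subseteq> {0, 1}"
    and regular_rel: "regular S \<phi>"
    and set_property_rel: "set_property S \<phi>"
begin

abbreviation rel :: "'a \<Rightarrow> 'a \<Rightarrow> bool" where "rel \<equiv> grel S \<phi>"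
abbreviation V\<^sub>0 :: "'a set" where "V\<^sub>0 \<equiv> V0 S \<phi>"
abbreviation \<pi> :: "'a \<Rightarrow> 'a" where "\<pi> \<equiv> min_rank_reps S \<phi>"
abbreviation V\<^sub>c :: "'a estruct" where "V\<^sub>c \<equiv> Vc S \<phi>"

text \<open>\<open>grel\<close> puts \<open>G\<close> into every variable except 1. As at most 0 and
  1 are free in \<phi>, this agrees with plain satisfaction.\<close>

lemma dfn_rel[dfi]: 
  assumes "df s" "df t" shows "dfn (\<lambda>e. rel (s e) (t e))"
proof (rule dfn_rel2[of rel, OF dfn_cong[OF _ dfn_sat[of \<phi>]] assms])
  show "rel (e 0) (e 1) \<longleftrightarrow> sat S e \<phi>" for e
    unfolding grel_def by (rule sat_cong) (use fv_rel in auto)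
qed

lemma rel_sym: "is_graph S G \<Longrightarrow> is_graph S H \<Longrightarrow> rel G H \<Longrightarrow> rel H G"
  using regular_rel unfolding regular_def equiv_def by (auto dest: symD)

lemma rel_trans: "is_graph S G \<Longrightarrow> is_graph S H \<Longrightarrow> is_graph S K \<Longrightarrow> rel G H \<Longrightarrow> rel H K \<Longrightarrow> rel G K"
  using regular_rel unfolding regular_def equiv_def by (auto dest: transD)

lemma rel_iso: "is_graph S G \<Longrightarrow> is_graph S H \<Longrightarrow> graph_iso S G H \<Longrightarrow> rel G H"
  using regular_rel unfolding regular_def by blast

lemma rel_same_child_graphs: "is_graph S G \<Longrightarrow> is_graph S H \<Longrightarrow> same_child_graphs S G H \<Longrightarrow> rel G H"
  using regular_rel unfolding regular_def by blast

lemma V0_graph: "G \<in> V\<^sub>0 \<Longrightarrow> is_graph S G"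
  by (simp add: V0_def)

lemma V0_U: "G \<in> V\<^sub>0 \<Longrightarrow> G \<in> U"
  using V0_graph is_graphD(7) by blast

lemma V0_inj:
  "G \<in> V\<^sub>0 \<Longrightarrow> a \<in> verts S G \<Longrightarrow> b \<in> verts S G \<Longrightarrow> rel (subgraph_at S G a) (subgraph_at S G b) \<Longrightarrow> a = b"
  by (simp add: V0_def rel_extensional_def)

lemma dc_V0[dfi]: "dc (\<lambda>e. V\<^sub>0)"
proof -
  have "dc (\<lambda>e. {G\<in>U. is_graph S G \<and> (\<forall>a\<in>elts S (gV G). \<forall>b\<in>elts S (gV G). rel (sg G a) (sg G b) \<longrightarrow> a = b)})"
    by (intro dfi)
  also have "{G\<in>U. is_graph S G \<and> (\<forall>a\<in>elts S (gV G). \<forall>b\<in>elts S (gV G). rel (sg G a) (sg G b) \<longrightarrow> a = b)} = V\<^sub>0"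
    unfolding V0_def rel_extensional_def
    by (intro Collect_cong) (auto simp: gparts subgraph_sg is_graphD(7))
  finally show ?thesis .
qed

lemma V0_subgraph:
  assumes "G \<in> V\<^sub>0" "a \<in> verts S G" shows "subgraph_at S G a \<in> V\<^sub>0"
proof -
  note G = V0_graph[OF assms(1)] assms(2)
  have "b = c" if "b \<in> verts S (subgraph_at S G a)" "c \<in> verts S (subgraph_at S G a)"
    "rel (subgraph_at S (subgraph_at S G a) b) (subgraph_at S (subgraph_at S G a) c)" for b c
    using V0_inj[OF assms(1), of b c] that unfolding subgraph_subgraph[OF G that(1)] subgraph_subgraph[OF G that(2)]
    by (simp add: subgraph_verts[OF G])
  then show ?thesis using subgraph_is_graph[OF G] unfolding V0_def rel_extensional_def by blast
qed

text \<open>The isomorphism restricts to isomorphisms between subgraphs at corresponding vertices,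
  so relatedness is carried over to \<open>G\<close>, where it forces equality.\<close>

lemma V0_iso:
  assumes "G \<in> V\<^sub>0" "is_graph S H" "graph_iso S H G" shows "H \<in> V\<^sub>0"
proof -
  note G = V0_graph[OF assms(1)]
  obtain h where h: "df (\<lambda>e. h (e 0))" "bij_betw h (verts S H) (verts S G)" and "h (pt S H) = pt S G"
    and he: "\<And>a b. a \<in> verts S H \<Longrightarrow> b \<in> verts S H \<Longrightarrow> (a, b) \<in> edges S H \<longleftrightarrow> (h a, h b) \<in> edges S G"
    by (rule graph_isoE[OF assms(3,2)]) blast
  have "a = b" if a: "a \<in> verts S H" and b: "b \<in> verts S H" and r: "rel (subgraph_at S H a) (subgraph_at S H b)" for a b
  proof -
    have hV: "h a \<in> verts S G" "h b \<in> verts S G" using bij_betwE[OF h(2)] a b by blast+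
    note g = subgraph_is_graph[OF assms(2) a] subgraph_is_graph[OF assms(2) b]
      subgraph_is_graph[OF G hV(1)] subgraph_is_graph[OF G hV(2)]
    have gi: "graph_iso S (subgraph_at S H c) (subgraph_at S G (h c))" if "c \<in> verts S H" for c
      by (rule graph_iso_subgraph[OF assms(2) G h]) (use he that in simp_all)
    have i: "rel (subgraph_at S H a) (subgraph_at S G (h a))" "rel (subgraph_at S H b) (subgraph_at S G (h b))"
      using rel_iso[OF g(1,3) gi[OF a]] rel_iso[OF g(2,4) gi[OF b]] .
    have "rel (subgraph_at S G (h a)) (subgraph_at S G (h b))"
      using rel_trans[OF g(3,1,4) rel_sym[OF g(1,3) i(1)] rel_trans[OF g(1,2,4) r i(2)]] .
    then have "h a = h b" by (rule V0_inj[OF assms(1) hV])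
    then show ?thesis using bij_betw_imp_inj_on[OF h(2)] a b by (simp add: inj_on_eq_iff)
  qed
  then show ?thesis using assms(2) unfolding V0_def rel_extensional_def by blast
qed

subsection \<open>Representatives of minimal rank\<close>

lemma elts_reps:
  assumes "G \<in> U"
  shows reps_U: "\<pi> G \<in> U"
    and "elts S (\<pi> G) = {H\<in>{H\<in>V\<^sub>0. rel H G}. \<exists>\<alpha>. has_rank S H \<alpha> \<and>
      (\<forall>K\<in>{H\<in>V\<^sub>0. rel H G}. \<forall>\<beta>. has_rank S K \<beta> \<longrightarrow> \<beta> \<notin> elts S \<alpha>)}" (is "_ = ?M")
proof -
  have "dc (\<lambda>e. {H\<in>V\<^sub>0. rel H G})" by (intro dfi df_const assms)
  from isset_min_rank(1)[OF this]
  show "\<pi> G \<in> U" "elts S (\<pi> G) = ?M"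
    unfolding min_rank_reps_def Let_def by (simp_all only: setof_U elts_setof)
qed

lemma df_reps[dfi]:
  assumes "df s" shows "df (\<lambda>e. \<pi> (s e))"
proof (rule df_app1[of \<pi>, OF df_rel assms])
  let ?C = "\<lambda>G. {H\<in>V\<^sub>0. rel H G}"
  let ?M = "\<lambda>G. {H\<in>?C G. \<exists>\<alpha>\<in>U. has_rank S H \<alpha> \<and> (\<forall>K\<in>?C G. \<forall>\<beta>\<in>U. has_rank S K \<beta> \<longrightarrow> \<beta> \<notin> elts S \<alpha>)}"
  have M: "elts S (\<pi> G) = ?M G" if "G \<in> U" for G
    unfolding elts_reps(2)[OF that] using has_rank_ordinal ordinalU by blast
  show "y = \<pi> (e 0) \<longleftrightarrow> elts S y = ?M (e 0)" if "env S e" "y \<in> U" for e y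
    unfolding M[OF envD[OF that(1)], symmetric] using elts_eqD[OF that(2) reps_U[OF envD[OF that(1)]]] by blast
  show "dfn (\<lambda>e. elts S (e 0) = ?M (e (Suc 0)))" by (intro dfi)
qed (use reps_U envD in blast)

lemma in_reps: "G \<in> U \<Longrightarrow> H \<in> elts S (\<pi> G) \<Longrightarrow> H \<in> V\<^sub>0 \<and> rel H G"
  unfolding elts_reps(2) by blast

lemma reps_nonempty:
  assumes "G \<in> V\<^sub>0" shows "elts S (\<pi> G) \<noteq> {}"
proof -
  note G = V0_graph[OF assms]
  obtain H \<alpha> where H: "is_graph S H" "graph_iso S G H" "has_rank S H \<alpha>"
    using graph_iso_has_rank[OF G] by blast
  have HG: "graph_iso S H G" by (rule graph_iso_sym[OF H(2) G H(1)])
  have "H \<in> {H\<in>V\<^sub>0. rel H G}" using V0_iso[OF assms H(1) HG] rel_iso[OF H(1) G HG] by blast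
  moreover have "dc (\<lambda>e. {H\<in>V\<^sub>0. rel H G})" by (intro dfi df_const V0_U assms)
  ultimately show ?thesis unfolding elts_reps(2)[OF V0_U[OF assms]] using isset_min_rank(2) H(3) by blast
qed

text \<open>Equal sets of representatives share a graph because they are nonempty, and that graph
  links \<open>G\<close> to \<open>H\<close>.\<close>

lemma reps_eq_iff:
  assumes "G \<in> V\<^sub>0" "H \<in> V\<^sub>0" shows "\<pi> G = \<pi> H \<longleftrightarrow> rel G H"
proof
  note g = V0_graph[OF assms(1)] V0_graph[OF assms(2)]
  assume "\<pi> G = \<pi> H"
  then obtain K where K: "K \<in> elts S (\<pi> G)" "K \<in> elts S (\<pi> H)" using reps_nonempty[OF assms(1)] by auto
  have k: "is_graph S K" "rel K G" "rel K H"
    using in_reps[OF V0_U[OF assms(1)] K(1)] in_reps[OF V0_U[OF assms(2)] K(2)] V0_graph by blast+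
  show "rel G H" using rel_trans[OF g(1) k(1) g(2) rel_sym[OF k(1) g(1) k(2)] k(3)] .
next
  note g = V0_graph[OF assms(1)] V0_graph[OF assms(2)]
  assume r: "rel G H"
  have "rel K G \<longleftrightarrow> rel K H" if "K \<in> V\<^sub>0" for K
    using rel_trans[OF V0_graph[OF that]] g r rel_sym[OF g r] by blast
  then have "{K\<in>V\<^sub>0. rel K G} = {K\<in>V\<^sub>0. rel K H}" by blast
  then show "\<pi> G = \<pi> H" unfolding min_rank_reps_def by simp
qed

lemma reps_iso: "G \<in> V\<^sub>0 \<Longrightarrow> is_graph S H \<Longrightarrow> graph_iso S H G \<Longrightarrow> \<pi> H = \<pi> G"
  using reps_eq_iff V0_iso rel_iso V0_graph by blast

subsection \<open>Extensional graphs related by the relation are isomorphic\<close>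

text \<open>Non-isomorphism is what makes the set of \<open>G\<close> and \<open>H\<close>
  admissible for the set property. Having both inside one extensional graph allows them to be
  compared as vertices.\<close>

lemma common_graph:
  assumes "G \<in> V\<^sub>0" "H \<in> V\<^sub>0" "\<not> graph_iso S G H"
  shows "\<exists>K\<in>V\<^sub>0. \<exists>a\<in>verts S K. \<exists>b\<in>verts S K. graph_iso S (subgraph_at S K a) G \<and> graph_iso S (subgraph_at S K b) H"
proof -
  have "\<not> graph_iso S H G" using assms graph_iso_sym V0_graph by blast
  moreover obtain X where X: "X \<in> U" "elts S X = {G, H}"
    using isset_pair[of G H] V0_U assms unfolding isset_def by blast
  ultimately have X': "elts S X \<subseteq> V\<^sub>0 \<and> (\<forall>H\<in>elts S X. \<forall>K\<in>elts S X. graph_iso S H K \<longrightarrow> H = K)"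
    using assms by auto
  obtain K where K: "K \<in> V\<^sub>0" "\<forall>H\<in>elts S X. \<exists>a\<in>children S K (pt S K). graph_iso S (subgraph_at S K a) H"
    using set_property_rel[unfolded set_property_def, rule_format, OF X(1) X'] by blast
  then show ?thesis using children_verts[OF V0_graph[OF K(1)]] X(2) by (metis insertCI)
qed

lemma rel_imp_iso:
  assumes "G \<in> V\<^sub>0" "H \<in> V\<^sub>0" "rel G H" shows "graph_iso S G H"
proof (rule ccontr)
  note g = V0_graph[OF assms(1)] V0_graph[OF assms(2)]
  assume n: "\<not> graph_iso S G H"
  obtain K a b where K: "K \<in> V\<^sub>0" "a \<in> verts S K" "b \<in> verts S K"
    "graph_iso S (subgraph_at S K a) G" "graph_iso S (subgraph_at S K b) H"
    using common_graph[OF assms(1,2) n] by blast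
  note s = V0_subgraph[OF K(1,2)] V0_subgraph[OF K(1,3)]
  have "\<pi> (subgraph_at S K a) = \<pi> (subgraph_at S K b)"
    using reps_iso[OF assms(1) V0_graph[OF s(1)] K(4)] reps_iso[OF assms(2) V0_graph[OF s(2)] K(5)]
      reps_eq_iff[OF assms(1,2)] assms(3) by simp
  then have "a = b" using V0_inj[OF K(1-3)] reps_eq_iff[OF s] by blast
  then have "graph_iso S G H"
    using graph_iso_trans[OF graph_iso_sym[OF K(4) V0_graph[OF s(1)] g(1)] _ g(1) V0_graph[OF s(1)]] K(5) by blast
  then show False using n by blast
qed

subsection \<open>The class model\<close>

lemma univ_Vc: "univ V\<^sub>c = \<pi> ` V\<^sub>0"
  by (simp add: Vc_def)

lemma reps_in_Vc: "G \<in> V\<^sub>0 \<Longrightarrow> \<pi> G \<in> univ V\<^sub>c"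
  by (simp add: univ_Vc)

lemma elts_Vc:
  assumes G: "G \<in> V\<^sub>0"
  shows "elts V\<^sub>c (\<pi> G) = (\<lambda>a. \<pi> (subgraph_at S G a)) ` children S G (pt S G)"
proof (intro equalityI subsetI)
  fix y assume "y \<in> (\<lambda>a. \<pi> (subgraph_at S G a)) ` children S G (pt S G)"
  then obtain a where a: "a \<in> children S G (pt S G)" "y = \<pi> (subgraph_at S G a)" by blast
  have "y \<in> univ V\<^sub>c" unfolding a(2)
    by (rule reps_in_Vc[OF V0_subgraph[OF G children_verts[OF V0_graph[OF G] a(1)]]])
  then show "y \<in> elts V\<^sub>c (\<pi> G)" unfolding elts_def Vc_def using a G by auto
next
  note g = V0_graph[OF G]
  fix y assume "y \<in> elts V\<^sub>c (\<pi> G)"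
  then obtain H a where H: "H \<in> V\<^sub>0" "a \<in> children S H (pt S H)" "\<pi> G = \<pi> H" "y = \<pi> (subgraph_at S H a)"
    unfolding elts_def Vc_def by auto
  note k = V0_graph[OF H(1)]
  have "rel H G" using reps_eq_iff[OF H(1) G] H(3) by simp
  obtain h where h: "df (\<lambda>e. h (e 0))" "bij_betw h (verts S H) (verts S G)" "h (pt S H) = pt S G"
    "\<And>a b. a \<in> verts S H \<Longrightarrow> b \<in> verts S H \<Longrightarrow> (a, b) \<in> edges S H \<longleftrightarrow> (h a, h b) \<in> edges S G"
    by (rule graph_isoE[OF rel_imp_iso[OF H(1) G \<open>rel H G\<close>] k]) blast
  have a: "a \<in> verts S H" by (rule children_verts[OF k H(2)])
  have ha: "h a \<in> children S G (pt S G)"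
    using h(3) h(4)[OF is_graphD(4)[OF k] a] H(2) by (simp add: children_def)
  have "graph_iso S (subgraph_at S H a) (subgraph_at S G (h a))"
    by (rule graph_iso_subgraph[OF k g h(1,2)]) (use h(4) a in simp_all)
  then have "\<pi> (subgraph_at S H a) = \<pi> (subgraph_at S G (h a))"
    by (rule reps_iso[OF V0_subgraph[OF G children_verts[OF g ha]] subgraph_is_graph[OF k a]])
  then show "y \<in> (\<lambda>a. \<pi> (subgraph_at S G a)) ` children S G (pt S G)" using ha H(4) by blast
qed

text \<open>Lets elements be computed in one ambient graph: the subgraph at a child of
  \<open>a\<close> is the same in \<open>G\<close> and in the subgraph at \<open>a\<close>.\<close>

lemma elts_Vc_subgraph:
  assumes G: "G \<in> V\<^sub>0" "a \<in> verts S G"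
  shows "elts V\<^sub>c (\<pi> (subgraph_at S G a)) = (\<lambda>c. \<pi> (subgraph_at S G c)) ` children S G a"
proof -
  note g = V0_graph[OF G(1)]
  have "subgraph_at S (subgraph_at S G a) c = subgraph_at S G c" if "c \<in> children S G a" for c
  proof (rule subgraph_subgraph[OF g G(2)])
    have "c \<in> children S (subgraph_at S G a) a"
      using that children_subgraph[OF g G(2) pt_in_subgraph[OF g G(2)]] by simp
    then show "c \<in> verts S (subgraph_at S G a)"
      by (rule children_verts[OF subgraph_is_graph[OF g G(2)]])
  qed
  then show ?thesis
    unfolding elts_Vc[OF V0_subgraph[OF G]] children_subgraph_pt[OF g G(2)] by (intro image_cong) auto
qed

lemma isset_elts_Vc:
  assumes "G \<in> V\<^sub>0" shows "isset S (elts V\<^sub>c (\<pi> G))"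
proof -
  note g = is_graphD[OF V0_graph[OF assms]]
  have "children S G (pt S G) = {b\<in>verts S G. (pt S G, b) \<in> edges S G}"
    using g(3) unfolding children_def by blast
  moreover have "isset S {b\<in>verts S G. (pt S G, b) \<in> edges S G}"
    by (rule isset_sep[OF g(1)]) (intro dfn_isset2 g(2) df_var df_const g(6) g(4))
  ultimately have "isset S ((\<lambda>a. \<pi> (sg G a)) ` children S G (pt S G))"
    by (intro isset_image) (auto intro!: dfi df_const V0_U assms)
  moreover have "\<pi> (sg G a) = \<pi> (subgraph_at S G a)" if "a \<in> children S G (pt S G)" for a
    using subgraph_sg[OF V0_graph[OF assms] children_verts[OF V0_graph[OF assms] that]] by simp
  ultimately show ?thesis unfolding elts_Vc[OF assms] by (simp cong: image_cong)
qed

text \<open>A point of the model is itself a nonempty set of graphs, so a choice function on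
  \<open>A\<close> yields representatives. Isomorphic ones would represent the same point, so the
  chosen graphs are admissible for the set property.\<close>

lemma set_in_Vc:
  assumes A: "isset S A" "A \<subseteq> univ V\<^sub>c" shows "isset V\<^sub>c A"
proof -
  have A': "\<exists>G\<in>V\<^sub>0. x = \<pi> G" if "x \<in> A" for x using A(2) that unfolding univ_Vc by blast
  have "elts S x \<noteq> {}" if "x \<in> A" for x using A'[OF that] reps_nonempty by blast
  then obtain c where c: "df (\<lambda>e. c (e 0))" "\<And>x. x \<in> A \<Longrightarrow> c x \<in> elts S x"
    using choice_function[OF A(1)] by blast
  have cA: "c x \<in> V\<^sub>0 \<and> \<pi> (c x) = x" if x: "x \<in> A" for x
  proof -
    obtain G where G: "G \<in> V\<^sub>0" "x = \<pi> G" using A'[OF x] by blast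
    have "c x \<in> V\<^sub>0 \<and> rel (c x) G" using in_reps[OF V0_U[OF G(1)]] c(2)[OF x] G(2) by blast
    then show ?thesis using reps_eq_iff G by blast
  qed
  obtain X where X: "X \<in> U" "elts S X = c ` A" using isset_image[OF A(1) c(1)] unfolding isset_def by blast
  have "H = K" if "H \<in> c ` A" "K \<in> c ` A" "graph_iso S H K" for H K
  proof -
    obtain x y where xy: "x \<in> A" "y \<in> A" "H = c x" "K = c y"
      using \<open>H \<in> c ` A\<close> \<open>K \<in> c ` A\<close> by blast
    then have "\<pi> H = \<pi> K" using reps_iso[of K H] that(3) cA V0_graph by blast
    then show ?thesis using xy cA by metis
  qed
  then have X': "elts S X \<subseteq> V\<^sub>0 \<and> (\<forall>H\<in>elts S X. \<forall>K\<in>elts S X. graph_iso S H K \<longrightarrow> H = K)"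
    unfolding X(2) using cA by blast
  obtain G where G: "G \<in> V\<^sub>0"
    "\<forall>a\<in>children S G (pt S G). \<exists>H\<in>elts S X. graph_iso S (subgraph_at S G a) H"
    "\<forall>H\<in>elts S X. \<exists>a\<in>children S G (pt S G). graph_iso S (subgraph_at S G a) H"
    using set_property_rel[unfolded set_property_def, rule_format, OF X(1) X'] by blast
  have sub: "is_graph S (subgraph_at S G a)" if "a \<in> children S G (pt S G)" for a
    using subgraph_is_graph V0_graph[OF G(1)] children_verts that by blast
  have "elts V\<^sub>c (\<pi> G) = A" unfolding elts_Vc[OF G(1)]
  proof (intro equalityI subsetI)
    fix y assume "y \<in> (\<lambda>a. \<pi> (subgraph_at S G a)) ` children S G (pt S G)"
    then obtain a where a: "a \<in> children S G (pt S G)" "y = \<pi> (subgraph_at S G a)" by blast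
    then obtain H where "H \<in> c ` A" "graph_iso S (subgraph_at S G a) H" using G(2) unfolding X(2) by blast
    then obtain x where x: "x \<in> A" "graph_iso S (subgraph_at S G a) (c x)" by blast
    then have "y = x" using a reps_iso[OF _ sub[OF a(1)] x(2)] cA[OF x(1)] by simp
    then show "y \<in> A" using x by simp
  next
    fix x assume x: "x \<in> A"
    then obtain a where a: "a \<in> children S G (pt S G)" "graph_iso S (subgraph_at S G a) (c x)"
      using G(3) unfolding X(2) by blast
    then have "\<pi> (subgraph_at S G a) = x" using reps_iso[OF _ sub[OF a(1)] a(2)] cA[OF x] by simp
    then show "x \<in> (\<lambda>a. \<pi> (subgraph_at S G a)) ` children S G (pt S G)" using a(1) by blast
  qed
  then show ?thesis unfolding isset_def using reps_in_Vc[OF G(1)] by blast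
qed

lemma extensional_Vc:
  assumes G: "G \<in> V\<^sub>0" "H \<in> V\<^sub>0" and e: "elts V\<^sub>c (\<pi> G) = elts V\<^sub>c (\<pi> H)"
  shows "\<pi> G = \<pi> H"
proof (rule ccontr)
  assume n: "\<pi> G \<noteq> \<pi> H"
  then have "\<not> graph_iso S G H" using reps_iso[OF G(2) V0_graph[OF G(1)]] by blast
  then obtain K a b where K: "K \<in> V\<^sub>0" "a \<in> verts S K" "b \<in> verts S K"
    "graph_iso S (subgraph_at S K a) G" "graph_iso S (subgraph_at S K b) H"
    using common_graph[OF G] by blast
  note k = V0_graph[OF K(1)]
  note s = subgraph_is_graph[OF k K(2)] subgraph_is_graph[OF k K(3)]
  have \<pi>: "\<pi> (subgraph_at S K a) = \<pi> G" "\<pi> (subgraph_at S K b) = \<pi> H"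
    using reps_iso[OF G(1) s(1) K(4)] reps_iso[OF G(2) s(2) K(5)] .
  \<comment> \<open>Extensionality of \<open>K\<close> makes the map from its vertices to points of
    the model injective, so equal sets of points come from equal sets of children.\<close>
  have sub: "children S K c \<subseteq> children S K d"
    if cd: "(\<lambda>x. \<pi> (subgraph_at S K x)) ` children S K c = (\<lambda>x. \<pi> (subgraph_at S K x)) ` children S K d" for c d
  proof
    fix x assume x: "x \<in> children S K c"
    then obtain y where y: "y \<in> children S K d" "\<pi> (subgraph_at S K x) = \<pi> (subgraph_at S K y)"
      using cd by blast
    have "x \<in> verts S K" "y \<in> verts S K" using children_verts[OF k] x y(1) by blast+
    then have "x = y" using V0_inj[OF K(1)] y(2) reps_eq_iff V0_subgraph[OF K(1)] by blast
    then show "x \<in> children S K d" using y(1) by simp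
  qed
  have "(\<lambda>x. \<pi> (subgraph_at S K x)) ` children S K a = (\<lambda>x. \<pi> (subgraph_at S K x)) ` children S K b"
    using e unfolding \<pi>[symmetric] elts_Vc_subgraph[OF K(1,2)] elts_Vc_subgraph[OF K(1,3)] .
  then have ab: "children S K a = children S K b" using sub by blast
  have cc: "subgraph_at S (subgraph_at S K v) ` children S K v = subgraph_at S K ` children S K v"
    if v: "v \<in> verts S K" for v
  proof (rule image_cong[OF refl])
    fix c assume "c \<in> children S K v"
    then have "c \<in> children S (subgraph_at S K v) v"
      using children_subgraph[OF k v pt_in_subgraph[OF k v]] by simp
    then show "subgraph_at S (subgraph_at S K v) c = subgraph_at S K c"
      using subgraph_subgraph[OF k v] children_verts[OF subgraph_is_graph[OF k v]] by blast
  qed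
  have "same_child_graphs S (subgraph_at S K a) (subgraph_at S K b)"
    unfolding same_child_graphs_def children_subgraph_pt[OF k K(2)] children_subgraph_pt[OF k K(3)]
    by (rule trans[OF cc[OF K(2)]]) (simp add: ab cc[OF K(3)])
  then have "rel (subgraph_at S K a) (subgraph_at S K b)" by (rule rel_same_child_graphs[OF s])
  then have "\<pi> (subgraph_at S K a) = \<pi> (subgraph_at S K b)"
    using reps_eq_iff V0_subgraph[OF K(1)] K(2,3) by blast
  then show False using n unfolding \<pi> by blast
qed

end

sublocale regular_relation \<subseteq> full_class S "Vc S \<phi>"
proof unfold_locales
  show "univ V\<^sub>c \<subseteq> univ S" unfolding univ_Vc using reps_U V0_U by blast
  show "dc (\<lambda>e. univ V\<^sub>c)" unfolding univ_Vc by (intro dfi)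
  \<comment> \<open>Membership rewritten with the definable \<open>gP\<close>, \<open>gE\<close> and
    \<open>sg\<close> in place of \<open>children\<close> and \<open>subgraph_at\<close>.\<close>
  have "mem V\<^sub>c y x \<longleftrightarrow> (\<exists>G\<in>V\<^sub>0. \<exists>a\<in>U. pair S (gP G) a \<in> elts S (gE G) \<and> x = \<pi> G \<and> y = \<pi> (sg G a))" for x y
  proof -
    have "a \<in> children S G (pt S G) \<longleftrightarrow> a \<in> U \<and> pair S (gP G) a \<in> elts S (gE G)" if G: "G \<in> V\<^sub>0" for G a
    proof -
      note g = V0_graph[OF G]
      have p: "pt S G \<in> U" using is_graphD(4,6)[OF g] by blast
      show ?thesis
        using edges_gE[OF g p, of a] children_verts[OF g, of a "pt S G"] is_graphD(6)[OF g] gparts(3)[OF g]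
        unfolding children_def by auto
    qed
    note ch = this
    have sub: "subgraph_at S G a = sg G a" if "G \<in> V\<^sub>0" "a \<in> children S G (pt S G)" for G a
      using subgraph_sg[OF V0_graph[OF that(1)] children_verts[OF V0_graph[OF that(1)] that(2)]] .
    have "(\<exists>a\<in>children S G (pt S G). x = \<pi> G \<and> y = \<pi> (subgraph_at S G a)) \<longleftrightarrow>
      (\<exists>a\<in>U. pair S (gP G) a \<in> elts S (gE G) \<and> x = \<pi> G \<and> y = \<pi> (sg G a))" if "G \<in> V\<^sub>0" for G
      using ch[OF that] sub[OF that] by metis
    then show ?thesis unfolding Vc_def by simp
  qed
  then show "dfn (\<lambda>e. mem V\<^sub>c (e 0) (e 1))" by simp (intro dfi)
  show "isset V\<^sub>c A \<longleftrightarrow> isset S A" if "A \<subseteq> univ V\<^sub>c" for A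
    using set_in_Vc[OF _ that] isset_elts_Vc unfolding isset_def[of V\<^sub>c] univ_Vc by blast
  show "x = y" if "x \<in> univ V\<^sub>c" "y \<in> univ V\<^sub>c" "elts V\<^sub>c x = elts V\<^sub>c y" for x y
    using that extensional_Vc unfolding univ_Vc by blast
qed

context regular_relation
begin

section \<open>The anti-foundation axiom\<close>

text \<open>The exact picture of \<open>\<pi> G\<close> in the class model is \<open>G\<close> itself, via \<open>a \<mapsto> \<pi> (G[a])\<close>.\<close>

lemma iso_exact_picture:
  assumes G: "G \<in> V\<^sub>0"
  defines "T \<equiv> elts V\<^sub>c (trcl V\<^sub>c (setof V\<^sub>c {\<pi> G}))"
  shows "graph_iso S G (realize (encode V\<^sub>c (T, {(x, y). x \<in> T \<and> y \<in> T \<and> y \<in> elts V\<^sub>c x}, \<pi> G)))"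
proof -
  note g0 = V0_graph[OF G]
  note g = is_graphD[OF g0]
  note X = reps_in_Vc[OF G]
  let ?R = "{(x, y). x \<in> T \<and> y \<in> T \<and> y \<in> elts V\<^sub>c x}"
  note gr = N.gr_trcl[OF X, folded T_def]
  note p = realize_parts[OF N.gr_is_graph[OF gr], unfolded N.gr_verts[OF gr] N.gr_edges[OF gr] N.gr_pt[OF gr]]
  \<comment> \<open>\<open>sg\<close> is used so that \<open>h\<close> is definable; on the vertices
    of \<open>G\<close> it agrees with \<open>subgraph_at\<close>.\<close>
  define h where "h a = \<pi> (sg G a)" for a
  have hd: "df (\<lambda>e. h (e 0))" unfolding h_def by (intro dfi df_const V0_U G)
  have h: "h a = \<pi> (subgraph_at S G a)" if "a \<in> verts S G" for a
    using subgraph_sg[OF g0 that] by (simp add: h_def)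
  have eh: "elts V\<^sub>c (h a) = h ` children S G a" if "a \<in> verts S G" for a
    unfolding h[OF that] elts_Vc_subgraph[OF G that]
    using h children_verts[OF g0] by (intro image_cong) auto
  have hpt: "h (pt S G) = \<pi> G" using h[OF g(4)] subgraph_pt_self[OF g0] by simp
  have inj: "inj_on h (verts S G)"
  proof (rule inj_onI)
    fix a b assume "a \<in> verts S G" "b \<in> verts S G" "h a = h b"
    then show "a = b" using h V0_inj[OF G] reps_eq_iff V0_subgraph[OF G] by simp
  qed
  have TX: "\<pi> G \<in> T" unfolding T_def by (rule N.trcl_single_self[OF X])
  have Tcl: "z \<in> T" if "y \<in> T" "z \<in> elts V\<^sub>c y" for y z
    using N.trcl_single_trans[OF X] that unfolding T_def by blast
  have iT: "isset S T" unfolding T_def using isset_elts_N[OF N.trcl_single_U[OF X]] .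
  have "h ` verts S G \<subseteq> T"
  proof clarify
    fix a assume a: "a \<in> verts S G"
    have "a \<in> verts S G \<and> h a \<in> T"
    proof (rule rch_induct[OF g(5)[OF a] g(1,3,4)])
      show "dfn (\<lambda>e. h (e 0) \<in> T)" by (intro dfi hd dc_const iT)
      show "h (pt S G) \<in> T" using TX hpt by simp
      show "h v \<in> T" if "(u, v) \<in> edges S G" "u \<in> verts S G" "h u \<in> T" for u v
        using Tcl[OF that(3)] eh[OF that(2)] that(1) unfolding children_def by blast
    qed
    then show "h a \<in> T" ..
  qed
  \<comment> \<open>The image of the vertices is a set of the class model by fullness. It contains
    the point and is closed under its elements, hence includes the least such set.\<close>
  moreover have "T \<subseteq> h ` verts S G" unfolding T_def
  proof (rule N.trcl_single_least[OF X])
    have "h ` verts S G \<subseteq> univ V\<^sub>c" using h reps_in_Vc V0_subgraph[OF G] by auto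
    then show "isset V\<^sub>c (h ` verts S G)" using full isset_image[OF g(1) hd] by blast
    show "\<pi> G \<in> h ` verts S G" using hpt g(4) by (metis imageI)
    show "z \<in> h ` verts S G" if "y \<in> h ` verts S G" "z \<in> elts V\<^sub>c y" for y z
      using that eh children_verts[OF g0] by blast
  qed
  ultimately have im: "h ` verts S G = T" by blast
  show ?thesis
  proof (rule graph_isoI[OF g0 hd])
    show "(a, b) \<in> edges S G \<longleftrightarrow> (h a, h b) \<in> edges S (realize (encode V\<^sub>c (T, ?R, \<pi> G)))"
      if "a \<in> verts S G" "b \<in> verts S G" for a b
    proof -
      have "h b \<in> h ` children S G a \<longleftrightarrow> b \<in> children S G a"
        using inj_on_image_mem_iff[OF inj that(2)] children_verts[OF g0] by blast
      then show ?thesis unfolding p(3) using im eh[OF that(1)] that by (auto simp: children_def)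
    qed
  qed (simp_all add: p hpt bij_betw_def inj im)
qed

lemma AFA_Vc:
  assumes abs: "absolute_for S \<phi> V\<^sub>c"
  shows "AFA V\<^sub>c \<phi>"
  unfolding AFA_def
proof (intro allI impI)
  fix x assume x: "is_graph V\<^sub>c x"
  note p = realize_parts[OF x]
  let ?T = "\<lambda>X. elts V\<^sub>c (trcl V\<^sub>c (setof V\<^sub>c {X}))"
  let ?P = "\<lambda>X. encode V\<^sub>c (?T X, {(x, y). x \<in> ?T X \<and> y \<in> ?T X \<and> y \<in> elts V\<^sub>c x}, X)"
  \<comment> \<open>Absoluteness is applied to the subgraphs at two vertices;
    \<open>realize_subgraph\<close> turns them into subgraphs of the realized graph.\<close>
  have "grel V\<^sub>c \<phi> (subgraph_at V\<^sub>c x a) (subgraph_at V\<^sub>c x b) \<longleftrightarrow>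
      rel (subgraph_at S (realize x) a) (subgraph_at S (realize x) b)"
    if "a \<in> verts V\<^sub>c x" "b \<in> verts V\<^sub>c x" for a b
    using abs N.subgraph_is_graph[OF x that(1)] N.subgraph_is_graph[OF x that(2)]
      realize_subgraph[OF x that(1)] realize_subgraph[OF x that(2)]
    unfolding absolute_for_def realize_def[symmetric] by simp
  then have "rel_extensional V\<^sub>c \<phi> x \<longleftrightarrow> realize x \<in> V\<^sub>0"
    unfolding V0_def rel_extensional_def using p(1,2) by simp
  moreover have "exact_picture V\<^sub>c x \<longleftrightarrow> (\<exists>G\<in>V\<^sub>0. graph_iso V\<^sub>c x (?P (\<pi> G)))"
    unfolding exact_picture_def Let_def univ_Vc by blast
  \<comment> \<open>Isomorphism inside the model is tested on the realized graphs, and the realized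
    exact picture is a copy of \<open>G\<close>.\<close>
  moreover have "graph_iso V\<^sub>c x (?P (\<pi> G)) \<longleftrightarrow> graph_iso S (realize x) G" if G: "G \<in> V\<^sub>0" for G
  proof -
    note P = N.gr_is_graph[OF N.gr_trcl[OF reps_in_Vc[OF G]]]
    note i = iso_exact_picture[OF G] and g = V0_graph[OF G]
    note e = realize_parts(1)[OF P]
    have "graph_iso S (realize x) (realize (?P (\<pi> G))) \<longleftrightarrow> graph_iso S (realize x) G"
      using graph_iso_trans[OF _ graph_iso_sym[OF i g e] p(1) e] graph_iso_trans[OF _ i p(1) g] by blast
    then show ?thesis using graph_iso_N_iff[OF x P] by simp
  qed
  \<comment> \<open>From right to left the witness is \<open>realize x\<close> itself; the other
    direction is closure of \<open>V\<^sub>0\<close> under isomorphism.\<close>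
  moreover have "(\<exists>G\<in>V\<^sub>0. graph_iso S (realize x) G) \<longleftrightarrow> realize x \<in> V\<^sub>0"
    using V0_iso[OF _ p(1)] graph_iso_refl[OF p(1)] by blast
  ultimately show "exact_picture V\<^sub>c x \<longleftrightarrow> rel_extensional V\<^sub>c \<phi> x" by blast
qed

end

theorem theorem4:
  fixes S :: "'a estruct" and \<phi> :: fm
  assumes "ZFC_minus S"
    and "fv \<phi> \<subseteq> {0, 1}"
    and "regular S \<phi>"
    and "set_property S \<phi>"
  shows "ZFC_minus (Vc S \<phi>) \<and>
    (absolute_for S \<phi> (Vc S \<phi>) \<longrightarrow> ZFC_minus (Vc S \<phi>) \<and> AFA (Vc S \<phi>) \<phi>)"
proof -
  interpret regular_relation S \<phi>
    using assms by unfold_locales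
  show ?thesis using ZFC_minus_N AFA_Vc by blast
qed

end
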